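(* Let $G$ be a graph, and let $\beta\in(0,\frac12)$. Then the following are equivalent: (a) $G\in\mathcal{G}_\beta$. (b) $G$ can be obtained from a forest by parallel extensions of edges (i.e., replacing an edge by several parallel edges) and additions of loops. (c) $G$ has no $K_3$ minor. Moreover, these equivalent conditions imply that $G\in\mathcal{G}_{\beta'}$ for all $\beta'>0$.
   Context: Graphs are finite and undirected, and may have loops and multiple edges. For a connected graph $G=(V,E)$, $T_G(\mathbf{x})=\sum_{T\in\mathcal{T}(G)}\prod_{e\in T}x_e$, where $\mathcal{T}(G)$ is the family of edge sets of spanning trees; for disconnected $G$, $T_G$ is the product of the spanning-tree polynomials of the connected components. For $\beta>0$, $\mathcal{G}_\beta$ denotes the class of graphs $G=(V,E)$ for which $T_G^{-\beta}$ is completely monotone on $(0,\infty)^E$. Here a $C^\infty$ function $f$ on $(0,\infty)^E$ is completely monotone if $(-1)^k\,\partial^kf/\partial x_{e_1}\cdots\partial x_{e_k}\ge 0$ everywhere on $(0,\infty)^E$ for all $k\ge 0$ and all $e_1,\ldots,e_k\in E$. *)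

theory Defs
  imports "HOL-Analysis.Analysis"
begin

section \<open>Finite undirected multigraphs\<close>

text \<open>Loops and parallel edges are allowed; an edge \<open>e\<close> is a loop iff \<open>ends G e\<close> is a singleton.
  The value of \<open>ends G\<close> outside \<open>edges G\<close> is irrelevant.\<close>

record ('v, 'e) mgraph =
  verts :: "'v set"
  edges :: "'e set"
  ends :: "'e \<Rightarrow> 'v set"

definition multigraph :: "('v, 'e) mgraph \<Rightarrow> bool" where
  "multigraph G \<longleftrightarrow> finite (verts G) \<and> finite (edges G) \<and>
     (\<forall>e\<in>edges G. ends G e \<subseteq> verts G \<and> card (ends G e) \<in> {1, 2})"

definition adjacency :: "('v, 'e) mgraph \<Rightarrow> 'v rel" where
  "adjacency G = {(u, v). \<exists>e\<in>edges G. ends G e = {u, v}}"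

definition graph_connected :: "('v, 'e) mgraph \<Rightarrow> bool" where
  "graph_connected G \<longleftrightarrow> verts G \<noteq> {} \<and> (\<forall>u\<in>verts G. \<forall>v\<in>verts G. (u, v) \<in> (adjacency G)\<^sup>*)"

definition component_of :: "('v, 'e) mgraph \<Rightarrow> 'v \<Rightarrow> 'v set" where
  "component_of G u = {v \<in> verts G. (u, v) \<in> (adjacency G)\<^sup>*}"

definition induced_subgraph :: "('v, 'e) mgraph \<Rightarrow> 'v set \<Rightarrow> ('v, 'e) mgraph" where
  "induced_subgraph G C = \<lparr>verts = C, edges = {e \<in> edges G. ends G e \<subseteq> C}, ends = ends G\<rparr>"

definition graph_components :: "('v, 'e) mgraph \<Rightarrow> ('v, 'e) mgraph set" where
  "graph_components G = (\<lambda>u. induced_subgraph G (component_of G u)) ` verts G"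

text \<open>A cycle \<open>v\<^sub>0 e\<^sub>0 v\<^sub>1 e\<^sub>1 \<dots> v\<^sub>k\<^sub>-\<^sub>1 e\<^sub>k\<^sub>-\<^sub>1 v\<^sub>0\<close> of length \<open>k \<ge> 1\<close>: a loop is a cycle of length 1 and
  a pair of parallel edges is a cycle of length 2.\<close>

definition is_cycle :: "('v, 'e) mgraph \<Rightarrow> 'v list \<Rightarrow> 'e list \<Rightarrow> bool" where
  "is_cycle G vs es \<longleftrightarrow> es \<noteq> [] \<and> length vs = length es \<and> distinct vs \<and> distinct es \<and>
     (\<forall>i<length es. es ! i \<in> edges G \<and>
        ends G (es ! i) = {vs ! i, vs ! (Suc i mod length es)})"

definition is_forest :: "('v, 'e) mgraph \<Rightarrow> bool" where
  "is_forest G \<longleftrightarrow> multigraph G \<and> (\<nexists>vs es. is_cycle G vs es)"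

definition is_tree :: "('v, 'e) mgraph \<Rightarrow> bool" where
  "is_tree G \<longleftrightarrow> is_forest G \<and> graph_connected G"


section \<open>The spanning-tree polynomial\<close>

definition spanning_trees :: "('v, 'e) mgraph \<Rightarrow> 'e set set" where
  "spanning_trees G = {T. T \<subseteq> edges G \<and> is_tree (G\<lparr>edges := T\<rparr>)}"

definition spanning_tree_sum :: "('v, 'e) mgraph \<Rightarrow> ('e \<Rightarrow> real) \<Rightarrow> real" where
  "spanning_tree_sum G x = (\<Sum>T\<in>spanning_trees G. \<Prod>e\<in>T. x e)"

definition spanning_tree_poly :: "('v, 'e) mgraph \<Rightarrow> ('e \<Rightarrow> real) \<Rightarrow> real" where
  "spanning_tree_poly G x =
     (if graph_connected G then spanning_tree_sum G x
      else \<Prod>H\<in>graph_components G. spanning_tree_sum H x)"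


section \<open>Complete monotonicity on \<open>(0,\<infinity>)\<^sup>E\<close>\<close>

definition pos_orthant :: "'e set \<Rightarrow> ('e \<Rightarrow> real) set" where
  "pos_orthant E = (\<Pi>\<^sub>E e\<in>E. {0<..})"

definition partial_deriv :: "'e \<Rightarrow> (('e \<Rightarrow> real) \<Rightarrow> real) \<Rightarrow> ('e \<Rightarrow> real) \<Rightarrow> real" where
  "partial_deriv e f x = deriv (\<lambda>t. f (x(e := t))) (x e)"

definition iterated_partial_deriv ::
  "'e list \<Rightarrow> (('e \<Rightarrow> real) \<Rightarrow> real) \<Rightarrow> ('e \<Rightarrow> real) \<Rightarrow> real" where
  "iterated_partial_deriv es f = foldr partial_deriv es f"

text \<open>\<open>C\<^sup>\<infinity>\<close>: the partial derivatives of all orders exist and are continuous. The domain carries the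
  product topology; for finite \<open>E\<close> this is the usual topology of \<open>\<real>\<^sup>E\<close>.\<close>

definition smooth_on_orthant :: "'e set \<Rightarrow> (('e \<Rightarrow> real) \<Rightarrow> real) \<Rightarrow> bool" where
  "smooth_on_orthant E f \<longleftrightarrow>
     (\<forall>es\<in>lists E.
        continuous_on (pos_orthant E) (iterated_partial_deriv es f) \<and>
        (\<forall>e\<in>E. \<forall>x\<in>pos_orthant E.
           (\<lambda>t. iterated_partial_deriv es f (x(e := t))) field_differentiable at (x e)))"

definition completely_monotone :: "'e set \<Rightarrow> (('e \<Rightarrow> real) \<Rightarrow> real) \<Rightarrow> bool" where
  "completely_monotone E f \<longleftrightarrow> smooth_on_orthant E f \<and>
     (\<forall>es\<in>lists E. \<forall>x\<in>pos_orthant E. (-1) ^ length es * iterated_partial_deriv es f x \<ge> 0)"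

definition cm_class :: "real \<Rightarrow> ('v, 'e) mgraph set" where
  "cm_class \<beta> = {G. multigraph G \<and>
     completely_monotone (edges G) (\<lambda>x. spanning_tree_poly G x powr (- \<beta>))}"


section \<open>Parallel extensions and additions of loops\<close>

definition parallel_extension :: "('v, 'e) mgraph \<Rightarrow> 'e \<Rightarrow> 'e set \<Rightarrow> ('v, 'e) mgraph" where
  "parallel_extension G e F =
     \<lparr>verts = verts G, edges = (edges G - {e}) \<union> F,
      ends = (\<lambda>f. if f \<in> F then ends G e else ends G f)\<rparr>"

definition add_loop :: "('v, 'e) mgraph \<Rightarrow> 'e \<Rightarrow> 'v \<Rightarrow> ('v, 'e) mgraph" where
  "add_loop G l v =
     \<lparr>verts = verts G, edges = insert l (edges G), ends = (ends G)(l := {v})\<rparr>"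

text \<open>In a parallel extension the new edges \<open>F\<close> may reuse the label \<open>e\<close> of the replaced edge, but no
  other label in use.\<close>

inductive forest_extension :: "('v, 'e) mgraph \<Rightarrow> bool" where
  forest: "is_forest G \<Longrightarrow> forest_extension G"
| parallel: "forest_extension G \<Longrightarrow> e \<in> edges G \<Longrightarrow> finite F \<Longrightarrow> F \<noteq> {} \<Longrightarrow>
    F \<inter> (edges G - {e}) = {} \<Longrightarrow> forest_extension (parallel_extension G e F)"
| loop: "forest_extension G \<Longrightarrow> l \<notin> edges G \<Longrightarrow> v \<in> verts G \<Longrightarrow>
    forest_extension (add_loop G l v)"


section \<open>Minors\<close>

definition delete_edge :: "('v, 'e) mgraph \<Rightarrow> 'e \<Rightarrow> ('v, 'e) mgraph" where
  "delete_edge G e = G\<lparr>edges := edges G - {e}\<rparr>"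

definition delete_vertex :: "('v, 'e) mgraph \<Rightarrow> 'v \<Rightarrow> ('v, 'e) mgraph" where
  "delete_vertex G v = G\<lparr>verts := verts G - {v}\<rparr>"

text \<open>Contraction of an edge \<open>e\<close> with ends \<open>u\<close> and \<open>v\<close>: \<open>e\<close> is removed and \<open>v\<close> is identified with \<open>u\<close>.
  Other edges joining \<open>u\<close> and \<open>v\<close> become loops; contracting a loop amounts to deleting it.\<close>

definition contract_edge :: "('v, 'e) mgraph \<Rightarrow> 'e \<Rightarrow> 'v \<Rightarrow> 'v \<Rightarrow> ('v, 'e) mgraph" where
  "contract_edge G e u v =
     \<lparr>verts = id(v := u) ` verts G, edges = edges G - {e},
      ends = (\<lambda>f. id(v := u) ` ends G f)\<rparr>"

inductive minor_step :: "('v, 'e) mgraph \<Rightarrow> ('v, 'e) mgraph \<Rightarrow> bool" where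
  delete_edge: "e \<in> edges G \<Longrightarrow> minor_step G (delete_edge G e)"
| delete_isolated: "v \<in> verts G \<Longrightarrow> \<forall>e\<in>edges G. v \<notin> ends G e \<Longrightarrow>
    minor_step G (delete_vertex G v)"
| contract_edge: "e \<in> edges G \<Longrightarrow> ends G e = {u, v} \<Longrightarrow> minor_step G (contract_edge G e u v)"

definition graph_iso :: "('v, 'e) mgraph \<Rightarrow> ('w, 'f) mgraph \<Rightarrow> bool" where
  "graph_iso G H \<longleftrightarrow> (\<exists>\<phi> \<psi>. bij_betw \<phi> (verts G) (verts H) \<and> bij_betw \<psi> (edges G) (edges H) \<and>
     (\<forall>e\<in>edges G. ends H (\<psi> e) = \<phi> ` ends G e))"

definition has_minor :: "('v, 'e) mgraph \<Rightarrow> ('w, 'f) mgraph \<Rightarrow> bool" where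
  "has_minor G H \<longleftrightarrow> (\<exists>G'. minor_step\<^sup>*\<^sup>* G G' \<and> graph_iso G' H)"

definition K3 :: "(nat, nat) mgraph" where
  "K3 = \<lparr>verts = {0, 1, 2}, edges = {0, 1, 2}, ends = (\<lambda>i. {i, (i + 1) mod 3})\<rparr>"

end

theory Submission
  imports Defs
begin

text \<open>Everything hinges on the condition that no non-loop edge has its ends joined by a walk avoiding all
  edges parallel to it. It depends on the adjacency relation only, so it is visibly stable under
  parallel extensions, loops and minors. If it holds, the spanning-tree polynomial of a component is a
  product of linear forms with disjoint supports, and every negative power is completely monotone.

  If it fails, some component has three spanning trees \<open>T\<close>, \<open>T - a + c\<close>, \<open>T - b + c\<close>; sending the other
  variables to infinity (on \<open>T\<close>) or to 0 (off \<open>T\<close>) degenerates the spanning-tree polynomial to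
  \<open>e\<^sub>2(x\<^sub>a, x\<^sub>b, x\<^sub>c)\<close>. Alternating finite differences survive this pointwise limit, and they give back
  the signs of the derivatives of \<open>e\<^sub>2\<^sup>-\<^sup>\<beta>\<close>. These signs are impossible for \<open>\<beta> < 1/2\<close>: the operator
  \<open>D(\<partial>)\<close>, \<open>D = a\<^sup>2 + b\<^sup>2 + c\<^sup>2 - 2(ab + bc + ca)\<close>, satisfies
  \<open>D(\<partial>) e\<^sub>2\<^sup>s = -4s(s + 1/2) e\<^sub>2\<^sup>s\<^sup>-\<^sup>1\<close>, so that \<open>D(\<partial>)\<^sup>2 e\<^sub>2\<^sup>-\<^sup>\<beta> < 0\<close> although \<open>D\<^sup>2\<close> is a square.\<close>

section \<open>Reachability and cycles\<close>

text \<open>If \<open>e\<^sub>2\<^sup>-\<^sup>\<beta>\<close> were the Laplace transform of a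
  positive measure, then \<open>D(\<partial>)\<^sup>2\<close> would multiply that measure by the
  square \<open>D\<^sup>2\<close>, and the result could not be negative. The obstacle is that
  \<open>D\<^sup>2\<close>, although a square, has negative coefficients, so the signs of the
  fourth-order derivatives alone do not give this. In place of a measure the proof uses the
  nonnegative Taylor coefficients at (1, 1, 1): those of high order n act like a measure on the
  triples (i, j, k) with sum n, with falling factorials in place of powers, and Euler's identity
  ties every order n to order 4. One application of D would not do: D is indefinite on the orthant,
  so the sign of \<open>D(\<partial>) e\<^sub>2\<^sup>-\<^sup>\<beta>\<close> is not constrained.
  The negative sign appears for two applications because the exponents -\<beta> and -\<beta> - 1 lie
  on different sides of the zero -1/2 of s(s + 1/2). This is the origin of the bound 1/2.\<close>

definition adj :: "('e \<Rightarrow> 'v set) \<Rightarrow> 'e set \<Rightarrow> 'v rel" where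
  "adj w A = {(u, v). \<exists>e\<in>A. w e = {u, v}}"

abbreviation reach :: "('e \<Rightarrow> 'v set) \<Rightarrow> 'e set \<Rightarrow> 'v rel" where
  "reach w A \<equiv> (adj w A)\<^sup>*"

lemma adjacency_eq: "adjacency G = adj (ends G) (edges G)"
  by (simp add: adjacency_def adj_def)

lemma sym_adj: "sym (adj w A)"
  by (auto simp: sym_def adj_def insert_commute)

lemma reach_sym: "(x, y) \<in> reach w A \<Longrightarrow> (y, x) \<in> reach w A"
  by (meson symD sym_adj sym_rtrancl)

lemma adj_mono: "A \<subseteq> B \<Longrightarrow> adj w A \<subseteq> adj w B"
  by (auto simp: adj_def)

lemma reach_mono: "A \<subseteq> B \<Longrightarrow> (x, y) \<in> reach w A \<Longrightarrow> (x, y) \<in> reach w B"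
  by (meson adj_mono rtrancl_mono subsetD)

lemma reach_edge: "e \<in> A \<Longrightarrow> w e = {p, q} \<Longrightarrow> (p, q) \<in> reach w A"
  by (auto simp: adj_def)

text \<open>A walk that crosses \<open>a\<close> several times can be shortened to one crossing or
  none, since an excursion that returns to an end of \<open>a\<close> may be skipped. The pair (p,
  q) records the direction of the remaining crossing.\<close>

lemma reach_insertE:
  assumes "(x, y) \<in> reach w (insert a A)"
  shows "(x, y) \<in> reach w A \<or>
    (\<exists>p q. w a = {p, q} \<and> (x, p) \<in> reach w A \<and> (q, y) \<in> reach w A)"
  using assms
proof (induction rule: rtrancl_induct)
  case base
  then show ?case by simp
next
  case (step y z)
  from step.hyps(2) consider "(y, z) \<in> adj w A" | "w a = {y, z}"
    by (auto simp: adj_def)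
  then show ?case
  proof cases
    case 1
    then show ?thesis using step.IH by (meson rtrancl.rtrancl_into_rtrancl)
  next
    case 2
    then show ?thesis using step.IH
      by (metis doubleton_eq_iff rtrancl.rtrancl_refl)
  qed
qed

definition is_path :: "('e \<Rightarrow> 'v set) \<Rightarrow> 'e set \<Rightarrow> 'v list \<Rightarrow> 'e list \<Rightarrow> bool" where
  "is_path w A vs es \<longleftrightarrow> length vs = Suc (length es) \<and> distinct vs \<and>
     (\<forall>i<length es. es ! i \<in> A \<and> w (es ! i) = {vs ! i, vs ! Suc i})"

text \<open>Loop erasure: when a walk comes back to a vertex, the path is cut back to its earlier
  visit there, so the vertices stay distinct.\<close>

lemma reach_imp_path:
  assumes "(x, y) \<in> reach w A"
  shows "\<exists>vs es. is_path w A vs es \<and> vs ! 0 = x \<and> vs ! length es = y"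
  using assms
proof (induction rule: rtrancl_induct)
  case base
  show ?case
    by (intro exI[of _ "[x]"] exI[of _ "[]"]) (simp add: is_path_def)
next
  case (step y z)
  then obtain vs es where p: "is_path w A vs es" "vs ! 0 = x" "vs ! length es = y" by blast
  obtain e where e: "e \<in> A" "w e = {y, z}" using step.hyps(2) by (auto simp: adj_def)
  show ?case
  proof (cases "z \<in> set vs")
    case True
    then obtain k where k: "k < length vs" "vs ! k = z" by (auto simp: in_set_conv_nth)
    have "is_path w A (take (Suc k) vs) (take k es)"
      using p k by (auto simp: is_path_def)
    moreover have "take (Suc k) vs ! 0 = x" "take (Suc k) vs ! length (take k es) = z"
      using p k by (auto simp: is_path_def)
    ultimately show ?thesis by blast
  next
    case False
    have "is_path w A (vs @ [z]) (es @ [e])"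
      using p e False by (auto simp: is_path_def nth_append less_Suc_eq)
    moreover have "(vs @ [z]) ! 0 = x" "(vs @ [z]) ! length (es @ [e]) = z"
      using p by (auto simp: is_path_def nth_append)
    ultimately show ?thesis by blast
  qed
qed

lemma path_distinct_edges:
  assumes "is_path w A vs es"
  shows "distinct es"
  unfolding distinct_conv_nth
proof (intro allI impI)
  fix i j assume ij: "i < length es" "j < length es" "i \<noteq> j"
  show "es ! i \<noteq> es ! j"
  proof
    assume "es ! i = es ! j"
    then have "{vs ! i, vs ! Suc i} = {vs ! j, vs ! Suc j}"
      using assms ij by (metis is_path_def)
    moreover have "i < length vs" "Suc i < length vs" "j < length vs" "Suc j < length vs"
      "distinct vs"
      using assms ij by (auto simp: is_path_def)
    ultimately show False
      using ij(3) by (auto simp: doubleton_eq_iff nth_eq_iff_index_eq)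
  qed
qed

text \<open>The empty path is included: then \<open>e\<close> is a loop and the cycle has length
  one.\<close>

lemma path_closes_to_cycle:
  assumes p: "is_path (ends G) (edges G - {e}) vs es"
    and e: "e \<in> edges G" "ends G e = {vs ! 0, vs ! length es}"
  shows "is_cycle G vs (es @ [e])"
  unfolding is_cycle_def
proof (intro conjI allI impI)
  show "distinct (es @ [e])"
    using path_distinct_edges[OF p] p by (auto simp: is_path_def in_set_conv_nth)
next
  fix i assume "i < length (es @ [e])"
  then consider "i < length es" | "i = length es" by fastforce
  then show "(es @ [e]) ! i \<in> edges G"
    and "ends G ((es @ [e]) ! i) = {vs ! i, vs ! (Suc i mod length (es @ [e]))}"
    using p e by (cases; auto simp: is_path_def nth_append insert_commute)+
qed (use p in \<open>auto simp: is_path_def\<close>)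

text \<open>The last edge is singled out because it is the only position at which the index wraps
  around; the edges before it form a walk between its ends.\<close>

lemma cycle_edge_redundant:
  assumes "is_cycle G vs es"
  shows "last es \<in> edges G" "ends G (last es) = {vs ! (length es - 1), vs ! 0}"
    and "(vs ! 0, vs ! (length es - 1)) \<in> reach (ends G) (edges G - {last es})"
proof -
  have c: "es \<noteq> []" "distinct es"
    "\<And>i. i < length es \<Longrightarrow> es ! i \<in> edges G"
    "\<And>i. i < length es \<Longrightarrow> ends G (es ! i) = {vs ! i, vs ! (Suc i mod length es)}"
    using assms by (auto simp: is_cycle_def)
  have l: "last es = es ! (length es - 1)" using c(1) by (rule last_conv_nth)
  show "last es \<in> edges G" "ends G (last es) = {vs ! (length es - 1), vs ! 0}"
    using c(1) c(3,4)[of "length es - 1"] by (auto simp: l)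
  have "(vs ! 0, vs ! i) \<in> reach (ends G) (edges G - {last es})" if "i < length es" for i
    using that
  proof (induction i)
    case (Suc i)
    have "es ! i \<noteq> last es" using Suc.prems c(2) unfolding l
      by (subst nth_eq_iff_index_eq) auto
    then have "(vs ! i, vs ! Suc i) \<in> adj (ends G) (edges G - {last es})"
      using c(3,4)[of i] Suc.prems by (auto simp: adj_def)
    then show ?case using Suc by (meson Suc_lessD rtrancl.rtrancl_into_rtrancl)
  qed simp
  then show "(vs ! 0, vs ! (length es - 1)) \<in> reach (ends G) (edges G - {last es})"
    using c(1) by simp
qed

text \<open>An edge lies on a cycle exactly if its ends stay joined after its deletion. Loops are
  covered by p = q, where reachability is trivial.\<close>

lemma acyclic_iff:
  "(\<nexists>vs es. is_cycle G vs es) \<longleftrightarrow>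
    (\<forall>e\<in>edges G. \<forall>p q. ends G e = {p, q} \<longrightarrow> (p, q) \<notin> reach (ends G) (edges G - {e}))"
proof
  assume L: "\<nexists>vs es. is_cycle G vs es"
  show "\<forall>e\<in>edges G. \<forall>p q. ends G e = {p, q} \<longrightarrow> (p, q) \<notin> reach (ends G) (edges G - {e})"
  proof (intro ballI allI impI notI)
    fix e p q
    assume e: "e \<in> edges G" "ends G e = {p, q}" "(p, q) \<in> reach (ends G) (edges G - {e})"
    then obtain vs es where "is_path (ends G) (edges G - {e}) vs es" "vs ! 0 = p" "vs ! length es = q"
      using reach_imp_path by metis
    then show False using L path_closes_to_cycle[of G e vs es] e by blast
  qed
next
  assume R: "\<forall>e\<in>edges G. \<forall>p q. ends G e = {p, q} \<longrightarrow> (p, q) \<notin> reach (ends G) (edges G - {e})"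
  show "\<nexists>vs es. is_cycle G vs es"
    using cycle_edge_redundant R by (metis insert_commute)
qed

section \<open>Graphs whose cycles have length at most two\<close>

definition tree_like :: "'v rel \<Rightarrow> bool" where
  "tree_like r \<longleftrightarrow> (\<forall>u v. (u, v) \<in> r \<longrightarrow> u \<noteq> v \<longrightarrow> (u, v) \<notin> (r - {(u, v), (v, u)})\<^sup>*)"

lemma tree_likeD:
  "tree_like r \<Longrightarrow> (u, v) \<in> r \<Longrightarrow> u \<noteq> v \<Longrightarrow> (u, v) \<notin> (r - {(u, v), (v, u)})\<^sup>*"
  by (simp add: tree_like_def)

text \<open>Reflexive pairs never help a walk. Comparing only \<open>s - Id\<close> with
  \<open>r\<close> lets this one lemma serve deletions, parallel extensions and added loops.\<close>

lemma tree_like_mono: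
  assumes "tree_like r" "s - Id \<subseteq> r"
  shows "tree_like s"
  unfolding tree_like_def
proof (clarify)
  fix u v assume uv: "(u, v) \<in> s" "u \<noteq> v" "(u, v) \<in> (s - {(u, v), (v, u)})\<^sup>*"
  have "(u, v) \<in> (s - {(u, v), (v, u)} - Id)\<^sup>*" using uv(3) by (simp add: rtrancl_r_diff_Id)
  also have "\<dots> \<subseteq> (r - {(u, v), (v, u)})\<^sup>*"
    using assms(2) by (intro rtrancl_mono) auto
  finally show False using tree_likeD[OF assms(1)] assms(2) uv(1,2) by blast
qed

lemma adj_Diff_class:
  "adj w {f \<in> A. w f \<noteq> {u, v}} = adj w A - {(u, v), (v, u)}"
  by (auto simp: adj_def insert_commute doubleton_eq_iff)

lemma multigraph_endsE:
  assumes "multigraph G" "e \<in> edges G"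
  obtains p q where "ends G e = {p, q}" "p \<in> verts G" "q \<in> verts G"
proof -
  have "card (ends G e) = 1 \<or> card (ends G e) = 2" and sub: "ends G e \<subseteq> verts G"
    using assms by (auto simp: multigraph_def)
  then have "\<exists>p q. ends G e = {p, q}"
    by (metis card_1_singletonE card_2_iff insert_absorb2)
  then show thesis using that sub by auto
qed

text \<open>In a forest, a walk avoiding all edges parallel to \<open>e\<close> in particular avoids
  \<open>e\<close>, so it would close a cycle. The two extension steps add at most reflexive pairs
  to the adjacency relation.\<close>

lemma forest_extension_tree_like:
  "forest_extension G \<Longrightarrow> tree_like (adjacency G)"
proof (induction rule: forest_extension.induct)
  case (forest G)
  have R: "\<forall>e\<in>edges G. \<forall>p q. ends G e = {p, q} \<longrightarrow> (p, q) \<notin> reach (ends G) (edges G - {e})"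
    using forest acyclic_iff[of G] by (simp add: is_forest_def)
  show ?case
    unfolding tree_like_def
  proof clarify
    fix u v assume uv: "(u, v) \<in> adjacency G" "(u, v) \<in> (adjacency G - {(u, v), (v, u)})\<^sup>*"
    then obtain e where e: "e \<in> edges G" "ends G e = {u, v}" by (auto simp: adjacency_def)
    have "(u, v) \<in> reach (ends G) {f \<in> edges G. ends G f \<noteq> {u, v}}"
      using uv(2) by (simp add: adj_Diff_class adjacency_eq)
    then have "(u, v) \<in> reach (ends G) (edges G - {e})"
      by (rule reach_mono[rotated]) (use e in auto)
    then show False using R e by blast
  qed
next
  case (parallel G e F)
  have "adjacency (parallel_extension G e F) - Id \<subseteq> adjacency G"
    using parallel by (auto simp: adjacency_def parallel_extension_def)
  then show ?case using parallel.IH tree_like_mono by blast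
next
  case (loop G l v)
  have "adjacency (add_loop G l v) - Id \<subseteq> adjacency G"
    using loop by (auto simp: adjacency_def add_loop_def split: if_splits)
  then show ?case using loop.IH tree_like_mono by blast
qed

lemma multigraph_update_edges:
  "multigraph G \<Longrightarrow> A \<subseteq> edges G \<Longrightarrow> multigraph (G\<lparr>edges := A\<rparr>)"
  by (auto simp: multigraph_def intro: finite_subset)

text \<open>One representative from each class of parallel non-loops gives a forest: a bypass of a
  representative through the others would avoid its whole class, which is excluded. The graph is
  then regrown class by class, and finally loop by loop.\<close>

lemma tree_like_forest_extension:
  assumes G: "multigraph G" and tl: "tree_like (adjacency G)"
  shows "forest_extension G"
proof -
  define N where "N = {e \<in> edges G. card (ends G e) = 2}"
  define rep where "rep = (\<lambda>s. SOME e. e \<in> N \<and> ends G e = s)"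
  define R where "R = rep ` ends G ` N"
  have rep: "rep s \<in> N" "ends G (rep s) = s" if "s \<in> ends G ` N" for s
  proof -
    have "\<exists>e. e \<in> N \<and> ends G e = s" using that by auto
    from someI_ex[OF this] show "rep s \<in> N" "ends G (rep s) = s" by (auto simp: rep_def)
  qed
  have finN: "finite N" "finite (edges G)" and NE: "N \<subseteq> edges G"
    using G by (auto simp: N_def multigraph_def)
  have RN: "R \<subseteq> N" using rep by (auto simp: R_def)
  have R_inj: "e = f" if "e \<in> R" "f \<in> R" "ends G e = ends G f" for e f
    using that rep by (auto simp: R_def)
  have "is_forest (G\<lparr>edges := R\<rparr>)"
    unfolding is_forest_def acyclic_iff
  proof (intro conjI ballI allI impI notI)
    show "multigraph (G\<lparr>edges := R\<rparr>)"
      using RN NE by (intro multigraph_update_edges[OF G]) auto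
    fix e p q
    assume e: "e \<in> edges (G\<lparr>edges := R\<rparr>)" "ends (G\<lparr>edges := R\<rparr>) e = {p, q}"
      "(p, q) \<in> reach (ends (G\<lparr>edges := R\<rparr>)) (edges (G\<lparr>edges := R\<rparr>) - {e})"
    then have e': "e \<in> R" "ends G e = {p, q}" "(p, q) \<in> reach (ends G) (R - {e})" by auto
    have "p \<noteq> q" using e' RN by (auto simp: N_def)
    have "(p, q) \<in> reach (ends G) {f \<in> edges G. ends G f \<noteq> {p, q}}"
      by (rule reach_mono[OF _ e'(3)]) (use e' R_inj RN NE in fastforce)
    moreover have "(p, q) \<in> adjacency G" using e' RN NE by (auto simp: adjacency_def)
    ultimately show False
      using tl \<open>p \<noteq> q\<close> by (auto simp: tree_like_def adj_Diff_class adjacency_eq)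
  qed
  then have base: "forest_extension (G\<lparr>edges := R\<rparr>)" by (rule forest_extension.forest)
  have classes: "forest_extension (G\<lparr>edges := R \<union> {e \<in> N. ends G e \<in> S}\<rparr>)"
    if "finite S" "S \<subseteq> ends G ` N" for S
    using that
  proof (induction S rule: finite_induct)
    case empty
    then show ?case using base by simp
  next
    case (insert s S)
    define H where "H = G\<lparr>edges := R \<union> {e \<in> N. ends G e \<in> S}\<rparr>"
    \<comment> \<open>The whole class contains the representative \<open>rep s\<close> that it
      replaces, a reuse of the label that the rule for parallel extensions allows.\<close>
    define F where "F = {e \<in> N. ends G e = s}"
    have s: "s \<in> ends G ` N" using insert by simp
    have "forest_extension (parallel_extension H (rep s) F)"
    proof (rule forest_extension.parallel)
      show "forest_extension H" using insert by (simp add: H_def)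
      show "rep s \<in> edges H" using s by (simp add: H_def R_def)
      show "finite F" using finN by (simp add: F_def)
      show "F \<noteq> {}" using s by (auto simp: F_def)
      show "F \<inter> (edges H - {rep s}) = {}"
        using insert.hyps(2) R_inj rep[OF s] s by (auto simp: H_def F_def R_def)
    qed
    moreover have "parallel_extension H (rep s) F = G\<lparr>edges := R \<union> {e \<in> N. ends G e \<in> insert s S}\<rparr>"
    proof -
      have "(R \<union> {e \<in> N. ends G e \<in> S} - {rep s}) \<union> F = R \<union> {e \<in> N. ends G e \<in> insert s S}"
        using rep[OF s] by (auto simp: F_def)
      moreover have "(\<lambda>f. if f \<in> F then ends G (rep s) else ends G f) = ends G"
        using rep[OF s] by (auto simp: F_def fun_eq_iff)
      ultimately show ?thesis
        by (intro mgraph.equality) (simp_all add: parallel_extension_def H_def cong: if_cong)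
    qed
    ultimately show ?case by simp
  qed
  have "R \<union> {e \<in> N. ends G e \<in> ends G ` N} = N" using RN by auto
  with classes[of "ends G ` N"] have N: "forest_extension (G\<lparr>edges := N\<rparr>)"
    using finN by simp
  have "forest_extension (G\<lparr>edges := N \<union> L\<rparr>)" if "finite L" "L \<subseteq> edges G - N" for L
    using that
  proof (induction L rule: finite_induct)
    case empty
    then show ?case using N by simp
  next
    case (insert l L)
    have "l \<in> edges G" "card (ends G l) \<noteq> 2" using insert.prems by (auto simp: N_def)
    then obtain v where v: "ends G l = {v}" "v \<in> verts G"
      using G by (auto simp: multigraph_def card_1_singleton_iff)
    have "forest_extension (add_loop (G\<lparr>edges := N \<union> L\<rparr>) l v)"
      by (rule forest_extension.loop) (use insert v in auto)
    moreover have "add_loop (G\<lparr>edges := N \<union> L\<rparr>) l v = G\<lparr>edges := N \<union> insert l L\<rparr>"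
      using v by (simp add: add_loop_def fun_upd_idem)
    ultimately show ?case by simp
  qed
  from this[of "edges G - N"] NE finN show ?thesis
    by (simp add: Un_absorb1)
qed

section \<open>Triangle minors\<close>

lemma minor_step_multigraph:
  assumes "minor_step G H" "multigraph G"
  shows "multigraph H"
  using assms
proof cases
  case (contract_edge e u v)
  have "card (f ` X) \<in> {1, 2}" if "card X \<in> {1, 2}" for f :: "'a \<Rightarrow> 'a" and X
  proof -
    have "finite X" "X \<noteq> {}" using that by (auto intro: card_ge_0_finite)
    then have "card (f ` X) \<le> card X" "card (f ` X) \<noteq> 0" by (auto intro: card_image_le)
    then show ?thesis using that by auto
  qed
  note card_img = this
  have G: "finite (verts G)" "finite (edges G)"
    "\<And>f. f \<in> edges G \<Longrightarrow> ends G f \<subseteq> verts G \<and> card (ends G f) \<in> {1, 2}"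
    using assms(2) by (auto simp: multigraph_def)
  have "id(v := u) ` ends G f \<subseteq> id(v := u) ` verts G \<and> card (id(v := u) ` ends G f) \<in> {1, 2}"
    if "f \<in> edges G - {e}" for f
    using G(3)[of f] that card_img by (simp only: Diff_iff image_mono simp_thms)
  with G(1,2) show ?thesis
    unfolding multigraph_def contract_edge(1) Defs.contract_edge_def by simp
qed (auto simp: multigraph_def delete_edge_def delete_vertex_def)

text \<open>A walk in \<open>s\<close> lifts to a walk in \<open>r\<close> if moves inside the
  fibres of \<pi> are inserted between the lifted steps. Those moves, and the lifts of steps other
  than (u, v) and (v, u), all avoid the pair (u', v') above (u, v), so a bypass downstairs gives a
  bypass upstairs.\<close>

lemma tree_like_contract:
  fixes \<pi> :: "'v \<Rightarrow> 'v"
  assumes tl: "tree_like r" and "sym r"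
    and s: "\<And>p q. (p, q) \<in> s \<Longrightarrow> \<exists>p' q'. (p', q') \<in> r \<and> \<pi> p' = p \<and> \<pi> q' = q"
    and ab: "\<And>p q. \<pi> p = \<pi> q \<Longrightarrow> p = q \<or> (p, q) \<in> r"
  shows "tree_like s"
  unfolding tree_like_def
proof clarify
  fix u v assume uv: "(u, v) \<in> s" "u \<noteq> v" "(u, v) \<in> (s - {(u, v), (v, u)})\<^sup>*"
  obtain u' v' where u': "(u', v') \<in> r" "\<pi> u' = u" "\<pi> v' = v" using s[OF uv(1)] by blast
  define t where "t = r - {(u', v'), (v', u')}"
  have fibre: "(p, q) \<in> t\<^sup>*" if "\<pi> p = \<pi> q" for p q
    using ab[OF that] that u' uv(2) by (auto simp: t_def)
  have "\<forall>q. \<pi> q = y \<longrightarrow> (u', q) \<in> t\<^sup>*" if "(u, y) \<in> (s - {(u, v), (v, u)})\<^sup>*" for y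
    using that
  proof (induction rule: rtrancl_induct)
    case base
    then show ?case using fibre u' by auto
  next
    case (step y z)
    obtain p q where pq: "(p, q) \<in> r" "\<pi> p = y" "\<pi> q = z" using s[of y z] step.hyps by blast
    have "(p, q) \<in> t" using pq step.hyps(2) u' by (auto simp: t_def)
    then show ?case using step.IH pq fibre by (metis rtrancl.rtrancl_into_rtrancl rtrancl_trans)
  qed
  then have "(u', v') \<in> t\<^sup>*" using uv(3) u' by blast
  then show False using tree_likeD[OF tl u'(1)] u' uv(2) unfolding t_def by metis
qed

lemma minor_step_tree_like:
  assumes "minor_step G H" "multigraph G" "tree_like (adjacency G)"
  shows "tree_like (adjacency H)"
  using assms(1)
proof cases
  case (delete_edge e)
  then have "adjacency H - Id \<subseteq> adjacency G" by (auto simp: adjacency_def Defs.delete_edge_def)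
  then show ?thesis using assms(3) tree_like_mono by blast
next
  case (delete_isolated v)
  then have "adjacency H - Id \<subseteq> adjacency G" by (auto simp: adjacency_def delete_vertex_def)
  then show ?thesis using assms(3) tree_like_mono by blast
next
  case (contract_edge e u v)
  let ?\<pi> = "id(v := u)"
  have symG: "sym (adjacency G)" by (simp add: adjacency_eq sym_adj)
  show ?thesis
  proof (rule tree_like_contract[OF assms(3) symG, of _ ?\<pi>])
    fix p q assume "(p, q) \<in> adjacency H"
    then obtain f where f: "f \<in> edges G" "?\<pi> ` ends G f = {p, q}"
      using contract_edge by (auto simp: adjacency_def Defs.contract_edge_def)
    obtain p' q' where pq: "ends G f = {p', q'}" using multigraph_endsE[OF assms(2) f(1)] by metis
    have "(p', q') \<in> adjacency G" "(q', p') \<in> adjacency G"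
      using f pq by (auto simp: adjacency_def insert_commute)
    moreover have "{?\<pi> p', ?\<pi> q'} = {p, q}" using f(2) unfolding pq by (simp only: image_insert image_empty)
    ultimately show "\<exists>p' q'. (p', q') \<in> adjacency G \<and> ?\<pi> p' = p \<and> ?\<pi> q' = q"
      by (metis doubleton_eq_iff)
  next
    fix p q assume "?\<pi> p = ?\<pi> q"
    moreover have "(u, v) \<in> adjacency G" "(v, u) \<in> adjacency G"
      using contract_edge by (auto simp: adjacency_def insert_commute)
    ultimately show "p = q \<or> (p, q) \<in> adjacency G" by (auto split: if_splits)
  qed
qed

lemma K3_ends: "ends K3 i = {i, (i + 1) mod 3}"
  by (simp add: K3_def)

text \<open>Each side of a triangle is bypassed by the other two.\<close>

lemma K3_not_tree_like:
  assumes iso: "graph_iso G K3" and G: "multigraph G"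
  shows "\<not> tree_like (adjacency G)"
proof -
  obtain \<phi> \<psi> where b: "bij_betw \<phi> (verts G) (verts K3)" "bij_betw \<psi> (edges G) (edges K3)"
    and h: "\<forall>e\<in>edges G. ends K3 (\<psi> e) = \<phi> ` ends G e"
    using iso by (auto simp: graph_iso_def)
  define p where "p = inv_into (verts G) \<phi>"
  have p: "p (\<phi> x) = x" if "x \<in> verts G" for x
    using b(1) that by (auto simp: p_def bij_betw_def)
  have edge: "(p i, p ((i + 1) mod 3)) \<in> adjacency G" if "i \<in> {0, 1, 2}" for i
  proof -
    have "i \<in> \<psi> ` edges G" using b(2) that by (simp add: bij_betw_def K3_def)
    then obtain e where e: "e \<in> edges G" "\<psi> e = i" by blast
    have sub: "ends G e \<subseteq> verts G" using G e by (auto simp: multigraph_def)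
    have "p ` \<phi> ` ends G e = ends G e" using p sub by (force simp: image_iff)
    moreover have "\<phi> ` ends G e = {i, (i + 1) mod 3}" using h e by (metis K3_ends)
    ultimately have "ends G e = {p i, p ((i + 1) mod 3)}" by (metis image_empty image_insert)
    then show ?thesis using e by (auto simp: adjacency_def)
  qed
  have "inj_on p {0, 1, 2}"
    using b(1) unfolding p_def by (intro inj_on_inv_into) (auto simp: bij_betw_def K3_def)
  then have d: "p 0 \<noteq> p 1" "p 1 \<noteq> p 2" "p 0 \<noteq> p 2" by (auto simp: inj_on_def)
  have e: "(p 0, p 1) \<in> adjacency G" "(p 1, p 2) \<in> adjacency G" "(p 2, p 0) \<in> adjacency G"
    using edge[of 0] edge[of 1] edge[of 2] by (simp_all add: numeral_2_eq_2)
  have s: "sym (adjacency G)" by (simp add: adjacency_eq sym_adj)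
  have "(p 0, p 2) \<in> adjacency G - {(p 0, p 1), (p 1, p 0)}"
    "(p 2, p 1) \<in> adjacency G - {(p 0, p 1), (p 1, p 0)}"
    using symD[OF s e(2)] symD[OF s e(3)] d by auto
  then have "(p 0, p 1) \<in> (adjacency G - {(p 0, p 1), (p 1, p 0)})\<^sup>*"
    by (meson converse_rtrancl_into_rtrancl r_into_rtrancl)
  then show ?thesis using tree_likeD[OF _ e(1) d(1)] by metis
qed

lemma tree_like_no_K3_minor:
  assumes "multigraph G" "tree_like (adjacency G)"
  shows "\<not> has_minor G K3"
proof
  assume "has_minor G K3"
  then obtain H where H: "minor_step\<^sup>*\<^sup>* G H" "graph_iso H K3" by (auto simp: has_minor_def)
  from H(1) have "multigraph H \<and> tree_like (adjacency H)"
    by (induction rule: rtranclp_induct)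
      (use assms minor_step_multigraph minor_step_tree_like in metis)+
  then show False using K3_not_tree_like H(2) by blast
qed

section \<open>From a long cycle to a triangle minor\<close>

lemma minor_delete_edges:
  assumes "finite D" "D \<subseteq> edges G"
  shows "minor_step\<^sup>*\<^sup>* G (G\<lparr>edges := edges G - D\<rparr>)"
  using assms
proof (induction D rule: finite_induct)
  case (insert e D)
  have "minor_step\<^sup>*\<^sup>* G (G\<lparr>edges := edges G - D\<rparr>)"
    using insert.IH insert.prems by simp
  moreover have "minor_step (G\<lparr>edges := edges G - D\<rparr>) (delete_edge (G\<lparr>edges := edges G - D\<rparr>) e)"
    using insert.hyps insert.prems by (intro minor_step.delete_edge) simp
  moreover have "delete_edge (G\<lparr>edges := edges G - D\<rparr>) e = G\<lparr>edges := edges G - insert e D\<rparr>"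
    by (intro mgraph.equality) (auto simp: Defs.delete_edge_def)
  ultimately show ?case by (metis rtranclp.rtrancl_into_rtrancl)
qed simp

lemma minor_delete_vertices:
  assumes "finite D" "D \<subseteq> verts G" "\<forall>e\<in>edges G. ends G e \<inter> D = {}"
  shows "minor_step\<^sup>*\<^sup>* G (G\<lparr>verts := verts G - D\<rparr>)"
  using assms
proof (induction D rule: finite_induct)
  case (insert v D)
  have "minor_step\<^sup>*\<^sup>* G (G\<lparr>verts := verts G - D\<rparr>)"
    using insert.IH insert.prems by simp
  moreover have "minor_step (G\<lparr>verts := verts G - D\<rparr>) (delete_vertex (G\<lparr>verts := verts G - D\<rparr>) v)"
    using insert.hyps insert.prems by (intro minor_step.delete_isolated) simp_all
  moreover have "delete_vertex (G\<lparr>verts := verts G - D\<rparr>) v = G\<lparr>verts := verts G - insert v D\<rparr>"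
    by (intro mgraph.equality) (auto simp: Defs.delete_vertex_def)
  ultimately show ?case by (metis rtranclp.rtrancl_into_rtrancl)
qed simp

lemma triangle_minor:
  assumes G: "multigraph G" and c: "is_cycle G vs es" and l: "length es = 3"
  shows "has_minor G K3"
proof -
  obtain e0 e1 e2 where es: "es = [e0, e1, e2]"
    using l by (auto simp: numeral_3_eq_3 length_Suc_conv)
  have "length vs = 3" using c l by (simp add: is_cycle_def)
  then obtain v0 v1 v2 where vs: "vs = [v0, v1, v2]"
    by (auto simp: numeral_3_eq_3 length_Suc_conv)
  have d: "distinct [v0, v1, v2]" "distinct [e0, e1, e2]"
    using c es vs by (auto simp: is_cycle_def)
  have all: "es ! i \<in> edges G \<and> ends G (es ! i) = {vs ! i, vs ! (Suc i mod 3)}" if "i < 3" for i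
    using c that unfolding is_cycle_def l by blast
  have e: "e0 \<in> edges G" "e1 \<in> edges G" "e2 \<in> edges G"
    "ends G e0 = {v0, v1}" "ends G e1 = {v1, v2}" "ends G e2 = {v2, v0}"
    using all[of 0] all[of 1] all[of 2] by (simp_all add: es vs)
  have v: "{v0, v1, v2} \<subseteq> verts G" using G e by (auto simp: multigraph_def)
  define H where "H = G\<lparr>edges := edges G - (edges G - {e0, e1, e2})\<rparr>"
  define K where "K = H\<lparr>verts := verts H - (verts G - {v0, v1, v2})\<rparr>"
  have fin: "finite (edges G)" "finite (verts G)" using G by (auto simp: multigraph_def)
  have E: "edges G - (edges G - {e0, e1, e2}) = {e0, e1, e2}" using e by auto
  have "minor_step\<^sup>*\<^sup>* G H" unfolding H_def by (rule minor_delete_edges) (use fin in auto)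
  moreover have "minor_step\<^sup>*\<^sup>* H K" unfolding K_def
    by (rule minor_delete_vertices) (use fin e in \<open>auto simp: H_def\<close>)
  ultimately have m: "minor_step\<^sup>*\<^sup>* G K" by (rule rtranclp_trans)
  have K: "verts K = {v0, v1, v2}" "edges K = {e0, e1, e2}" "ends K = ends G"
    using e v by (auto simp: K_def H_def)
  define \<phi> where "\<phi> = (\<lambda>x. if x = v0 then 0 else if x = v1 then 1 else (2::nat))"
  define \<psi> where "\<psi> = (\<lambda>x. if x = e0 then 0 else if x = e1 then 1 else (2::nat))"
  have "bij_betw \<phi> (verts K) (verts K3)" "bij_betw \<psi> (edges K) (edges K3)"
    using d by (auto simp: bij_betw_def K K3_def \<phi>_def \<psi>_def inj_on_def)
  moreover have "\<forall>f\<in>edges K. ends K3 (\<psi> f) = \<phi> ` ends K f"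
    using d by (auto simp: K K3_def e \<phi>_def \<psi>_def)
  ultimately have "graph_iso K K3" unfolding graph_iso_def by blast
  then show ?thesis using m by (auto simp: has_minor_def)
qed

text \<open>The closing edge joins \<open>vs ! k\<close> to \<open>vs ! 0\<close>. Merging these
  ends under the name \<open>vs ! 0\<close> turns the edge before it into the new closing edge, so
  truncating both lists yields the shorter cycle.\<close>

lemma cycle_contract:
  assumes c: "is_cycle G vs es" and l: "length es = Suc k" "k \<ge> 1"
  shows "is_cycle (contract_edge G (last es) (vs ! 0) (vs ! k)) (take k vs) (take k es)"
proof -
  have C: "length vs = Suc k" "distinct vs" "distinct es" "es \<noteq> []"
    and ce: "\<And>i. i < Suc k \<Longrightarrow> es ! i \<in> edges G \<and> ends G (es ! i) = {vs ! i, vs ! (Suc i mod Suc k)}"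
    using c l by (auto simp: is_cycle_def)
  have la: "last es = es ! k" using C(4) l by (simp add: last_conv_nth)
  show ?thesis
    unfolding is_cycle_def
  proof (intro conjI allI impI)
    fix i assume "i < length (take k es)"
    then have i: "i < k" "length (take k es) = k" using l by auto
    have "es ! i \<noteq> es ! k" using C i l by (subst nth_eq_iff_index_eq) auto
    then show "take k es ! i \<in> edges (contract_edge G (last es) (vs ! 0) (vs ! k))"
      using ce[of i] i by (auto simp: Defs.contract_edge_def la)
    have *: "vs ! j \<noteq> vs ! k" if "j < k" for j
      using C that by (subst nth_eq_iff_index_eq) auto
    show "ends (contract_edge G (last es) (vs ! 0) (vs ! k)) (take k es ! i) =
        {take k vs ! i, take k vs ! (Suc i mod length (take k es))}"
    proof (cases "Suc i = k")
      case True
      then show ?thesis using ce[of i] i *[of i] l(2)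
        by (simp add: Defs.contract_edge_def)
    next
      case False
      then show ?thesis using ce[of i] i *[of i] *[of "Suc i"]
        by (simp add: Defs.contract_edge_def)
    qed
  qed (use C l in auto)
qed

lemma long_cycle_K3_minor:
  assumes "multigraph G" "is_cycle G vs es" "length es \<ge> 3"
  shows "has_minor G K3"
  using assms
proof (induction "length es" arbitrary: G vs es rule: less_induct)
  case less
  show ?case
  proof (cases "length es = 3")
    case True
    then show ?thesis using less.prems triangle_minor by blast
  next
    case False
    define k where "k = length es - 1"
    have k: "length es = Suc k" "k \<ge> 3" using False less.prems by (auto simp: k_def)
    let ?H = "contract_edge G (last es) (vs ! 0) (vs ! k)"
    have "ends G (last es) = {vs ! 0, vs ! k}" "last es \<in> edges G"
      using cycle_edge_redundant[OF less.prems(2)] k by (auto simp: insert_commute)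
    then have step: "minor_step G ?H" by (intro minor_step.contract_edge)
    have "has_minor ?H K3"
    proof (rule less.hyps)
      show "is_cycle ?H (take k vs) (take k es)"
        using cycle_contract[OF less.prems(2) k(1)] k by simp
      show "multigraph ?H" using step less.prems minor_step_multigraph by blast
    qed (use k in auto)
    then show ?thesis using step
      by (auto simp: has_minor_def intro: converse_rtranclp_into_rtranclp)
  qed
qed

lemma not_tree_like_K3_minor:
  assumes G: "multigraph G" and n: "\<not> tree_like (adjacency G)"
  shows "has_minor G K3"
proof -
  obtain u v where uv: "(u, v) \<in> adjacency G" "u \<noteq> v"
    "(u, v) \<in> (adjacency G - {(u, v), (v, u)})\<^sup>*"
    using n unfolding tree_like_def by metis
  obtain e where e: "e \<in> edges G" "ends G e = {u, v}" using uv(1) by (auto simp: adjacency_def)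
  have "(u, v) \<in> reach (ends G) {f \<in> edges G. ends G f \<noteq> {u, v}}"
    using uv(3) by (simp add: adj_Diff_class adjacency_eq)
  from reach_imp_path[OF this]
  obtain vs es where p: "is_path (ends G) {f \<in> edges G. ends G f \<noteq> {u, v}} vs es"
    "vs ! 0 = u" "vs ! length es = v" by blast
  \<comment> \<open>Length 0 would give u = v; length 1 would be a single edge with ends {u, v}, and
    the path avoids such edges. Hence the closed cycle has at least three edges.\<close>
  have len: "length es \<noteq> 0" "length es \<noteq> 1" using p uv(2) by (auto simp: is_path_def)
  have "is_path (ends G) (edges G - {e}) vs es" using p(1) e by (auto simp: is_path_def)
  then have "is_cycle G vs (es @ [e])" using e p by (intro path_closes_to_cycle) auto
  moreover have "length (es @ [e]) \<ge> 3" using len by (cases "length es") auto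
  ultimately show ?thesis by (rule long_cycle_K3_minor[OF G])
qed

section \<open>Alternating finite differences\<close>

text \<open>Minus the forward difference in coordinate \<open>fst d\<close> with step
  \<open>snd d\<close>; with this sign all iterates are nonnegative for completely monotone
  functions.\<close>

definition neg_diff :: "'i \<times> real \<Rightarrow> (('i \<Rightarrow> real) \<Rightarrow> real) \<Rightarrow> ('i \<Rightarrow> real) \<Rightarrow> real" where
  "neg_diff d F x = F x - F (x(fst d := x (fst d) + snd d))"

definition alternating :: "'i set \<Rightarrow> (('i \<Rightarrow> real) \<Rightarrow> real) \<Rightarrow> bool" where
  "alternating I F \<longleftrightarrow>
     (\<forall>ds\<in>lists (I \<times> {0<..}). \<forall>x. (\<forall>i\<in>I. 0 < x i) \<longrightarrow> 0 \<le> foldr neg_diff ds F x)"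

lemma alternatingD:
  "alternating I F \<Longrightarrow> ds \<in> lists (I \<times> {0<..}) \<Longrightarrow> (\<And>i. i \<in> I \<Longrightarrow> 0 < x i) \<Longrightarrow> 0 \<le> foldr neg_diff ds F x"
  by (simp add: alternating_def)

lemma alternating_nonneg: "alternating I F \<Longrightarrow> (\<And>i. i \<in> I \<Longrightarrow> 0 < x i) \<Longrightarrow> 0 \<le> F x"
  using alternatingD[of I F "[]"] by simp

text \<open>Positive steps never leave the orthant, so an iterated difference evaluates the
  functions only at points where convergence is assumed.\<close>

lemma neg_diffs_tendsto:
  assumes "\<And>x. (\<forall>i\<in>I. 0 < x i) \<Longrightarrow> (\<lambda>n. F n x) \<longlonglongrightarrow> G x"
    and "ds \<in> lists (I \<times> {0<..})" "\<forall>i\<in>I. 0 < x i"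
  shows "(\<lambda>n. foldr neg_diff ds (F n) x) \<longlonglongrightarrow> foldr neg_diff ds G x"
  using assms(2,3)
proof (induction ds arbitrary: x rule: list.induct)
  case Nil
  then show ?case using assms(1) by simp
next
  case (Cons d ds)
  obtain i h where d: "d = (i, h)" "i \<in> I" "h > 0" using Cons.prems by auto
  have "\<forall>j\<in>I. 0 < (x(i := x i + h)) j" using Cons.prems d by (auto intro: add_pos_pos)
  with Cons d show ?case
    by (auto simp: neg_diff_def intro!: tendsto_diff)
qed

lemma alternating_limit:
  assumes "\<And>n. alternating I (F n)"
    and "\<And>x. (\<forall>i\<in>I. 0 < x i) \<Longrightarrow> (\<lambda>n. F n x) \<longlonglongrightarrow> G x"
  shows "alternating I G"
  unfolding alternating_def
proof (intro ballI allI impI)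
  fix ds :: "('a \<times> real) list" and x :: "'a \<Rightarrow> real"
  assume *: "ds \<in> lists (I \<times> {0<..})" "\<forall>i\<in>I. 0 < x i"
  show "0 \<le> foldr neg_diff ds G x"
    by (rule tendsto_lowerbound[OF neg_diffs_tendsto[of I F G, OF assms(2) *]])
      (use * alternatingD[OF assms(1)] in auto)
qed

lemma neg_diffs_scale:
  "foldr neg_diff ds (\<lambda>x. c * F x) x = c * foldr neg_diff ds F x"
  by (induction ds arbitrary: x) (simp_all add: neg_diff_def algebra_simps)

lemma alternating_scale: "alternating I F \<Longrightarrow> 0 \<le> c \<Longrightarrow> alternating I (\<lambda>x. c * F x)"
  by (simp add: alternating_def neg_diffs_scale)

lemma alternating_neg_diff:
  assumes "alternating I F" "i \<in> I" "h > 0"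
  shows "alternating I (neg_diff (i, h) F)"
  unfolding alternating_def
proof (intro ballI allI impI)
  fix ds :: "('a \<times> real) list" and x :: "'a \<Rightarrow> real"
  assume *: "ds \<in> lists (I \<times> {0<..})" "\<forall>i\<in>I. 0 < x i"
  \<comment> \<open>Appending on the right makes (i, h) the innermost difference.\<close>
  have "0 \<le> foldr neg_diff (ds @ [(i, h)]) F x"
    by (rule alternatingD[OF assms(1)]) (use * assms in auto)
  then show "0 \<le> foldr neg_diff ds (neg_diff (i, h) F) x" by simp
qed

lemma alternating_cong:
  assumes "alternating I F" and "\<And>x. (\<forall>i\<in>I. 0 < x i) \<Longrightarrow> F x = G x"
  shows "alternating I G"
  by (rule alternating_limit[of I "\<lambda>_. F"]) (use assms in auto)

text \<open>\<open>G\<close> is minus a partial derivative, hence a pointwise limit of positive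
  multiples of alternating differences. This is the way back from differences to
  derivatives.\<close>

lemma alternating_deriv:
  assumes F: "alternating I F" and i: "i \<in> I"
    and G: "\<And>x. (\<forall>i\<in>I. 0 < x i) \<Longrightarrow>
      ((\<lambda>t. F (x(i := t))) has_real_derivative - G x) (at (x i))"
  shows "alternating I G"
proof (rule alternating_limit)
  show "alternating I (\<lambda>x. real (Suc n) * neg_diff (i, 1 / real (Suc n)) F x)" for n
    by (intro alternating_scale alternating_neg_diff F i) auto
next
  fix x :: "'a \<Rightarrow> real" assume x: "\<forall>i\<in>I. 0 < x i"
  have "((\<lambda>h. (F (x(i := x i + h)) - F (x(i := x i))) / h) \<longlongrightarrow> - G x) (at 0)"
    using G[OF x] by (simp add: DERIV_def)
  then have "((\<lambda>h. (F (x(i := x i + h)) - F (x(i := x i))) / h) \<longlongrightarrow> - G x) (at_right 0)"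
    by (rule filterlim_mono) (simp_all add: at_le)
  moreover have "filterlim (\<lambda>n. 1 / real (Suc n)) (at_right 0) sequentially"
    using LIMSEQ_inverse_real_of_nat
    by (auto simp: filterlim_at inverse_eq_divide)
  ultimately have "(\<lambda>n. (F (x(i := x i + 1 / real (Suc n))) - F (x(i := x i))) / (1 / real (Suc n))) \<longlonglongrightarrow> - G x"
    by (rule filterlim_compose)
  from tendsto_minus[OF this]
  show "(\<lambda>n. real (Suc n) * neg_diff (i, 1 / real (Suc n)) F x) \<longlonglongrightarrow> G x"
    by (simp add: neg_diff_def algebra_simps)
qed

section \<open>Derivatives of powers of the quadratic form \<open>x\<^sub>0x\<^sub>1 + x\<^sub>1x\<^sub>2 + x\<^sub>2x\<^sub>0\<close>\<close>

definition pos3 :: "(nat \<Rightarrow> real) \<Rightarrow> bool" where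
  "pos3 x \<longleftrightarrow> 0 < x 0 \<and> 0 < x 1 \<and> 0 < x 2"

definition esym2 :: "(nat \<Rightarrow> real) \<Rightarrow> real" where
  "esym2 x = x 0 * x 1 + x 1 * x 2 + x 2 * x 0"

text \<open>The partial derivative of \<open>esym2\<close> in coordinate i, for i < 3.\<close>

definition co_sum :: "nat \<Rightarrow> (nat \<Rightarrow> real) \<Rightarrow> real" where
  "co_sum i x = x 0 + x 1 + x 2 - x i"

text \<open>A monomial in the coordinates times a power of \<open>esym2\<close>, all exponents real.
  The value zero off the positive orthant turns identities between derivatives into equations of
  functions.\<close>

definition qmono :: "(nat \<Rightarrow> real) \<Rightarrow> real \<Rightarrow> (nat \<Rightarrow> real) \<Rightarrow> real" where
  "qmono a s x = (if pos3 x
     then exp (a 0 * ln (x 0) + a 1 * ln (x 1) + a 2 * ln (x 2) + s * ln (esym2 x)) else 0)"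

text \<open>Minus the partial derivative, with the same zero convention, so that it can be iterated
  and rewritten as an operator.\<close>

definition Dneg :: "nat \<Rightarrow> ((nat \<Rightarrow> real) \<Rightarrow> real) \<Rightarrow> (nat \<Rightarrow> real) \<Rightarrow> real" where
  "Dneg i F x = (if pos3 x then - deriv (\<lambda>t. F (x(i := t))) (x i) else 0)"

text \<open>The linear span of the generalized monomials of degree r. It is stable under
  \<open>Dneg\<close>, which lowers r by one, so linearity, symmetry of second derivatives and
  Euler's identity are available at every order.\<close>

inductive qspan :: "real \<Rightarrow> ((nat \<Rightarrow> real) \<Rightarrow> real) \<Rightarrow> bool" where
  mono: "a 0 + a 1 + a 2 + 2 * s = r \<Longrightarrow> qspan r (\<lambda>x. c * qmono a s x)"
| add: "qspan r F \<Longrightarrow> qspan r G \<Longrightarrow> qspan r (\<lambda>x. F x + G x)"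

lemma qmono_outside: "\<not> pos3 x \<Longrightarrow> qmono a s x = 0"
  by (simp add: qmono_def)

lemma less3: "i < (3::nat) \<longleftrightarrow> i = 0 \<or> i = 1 \<or> i = 2"
  by auto

lemma pos3_iff: "pos3 x \<longleftrightarrow> (\<forall>i<3. 0 < x i)"
  by (auto simp: pos3_def less3)

lemma esym2_pos: "pos3 x \<Longrightarrow> 0 < esym2 x"
  by (simp add: pos3_def esym2_def add_pos_pos)

lemma esym2_upd: "i < 3 \<Longrightarrow> esym2 (x(i := t)) = esym2 x + (t - x i) * co_sum i x"
  by (auto simp: esym2_def co_sum_def less3 algebra_simps)

lemma co_sum_upd:
  "i < 3 \<Longrightarrow> j < 3 \<Longrightarrow> co_sum j (x(i := t)) = co_sum j x + (if i = j then 0 else t - x i)"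
  by (auto simp: co_sum_def less3)

lemma eventually_pos3: "pos3 x \<Longrightarrow> i < 3 \<Longrightarrow> eventually (\<lambda>t. pos3 (x(i := t))) (nhds (x i))"
proof -
  assume x: "pos3 x" "i < 3"
  then have "eventually (\<lambda>t. t \<in> {0<..}) (nhds (x i))"
    by (intro eventually_nhds_in_open) (auto simp: pos3_iff)
  then show ?thesis by eventually_elim (use x in \<open>auto simp: pos3_iff\<close>)
qed

text \<open>The partial derivative of the logarithm of \<open>qmono a s\<close>.\<close>

definition logder :: "(nat \<Rightarrow> real) \<Rightarrow> real \<Rightarrow> nat \<Rightarrow> (nat \<Rightarrow> real) \<Rightarrow> real" where
  "logder a s i x = a i / x i + s * co_sum i x / esym2 x"

lemma qmono_deriv:
  assumes x: "pos3 x" and i: "i < 3"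
  shows "((\<lambda>t. qmono a s (x(i := t))) has_real_derivative qmono a s x * logder a s i x) (at (x i))"
proof -
  have q: "0 < esym2 x" using x by (rule esym2_pos)
  have "((\<lambda>t. exp (a 0 * ln ((x(i := t)) 0) + a 1 * ln ((x(i := t)) 1) + a 2 * ln ((x(i := t)) 2)
      + s * ln (esym2 x + (t - x i) * co_sum i x))) has_real_derivative qmono a s x * logder a s i x) (at (x i))"
  proof -
    consider "i = 0" | "i = 1" | "i = 2" using i by (auto simp: less3)
    then show ?thesis
    proof cases
      case 1
      then show ?thesis using x q
        by (auto intro!: derivative_eq_intros simp: qmono_def logder_def pos3_def field_simps)
    next
      case 2
      then show ?thesis using x q
        by (auto intro!: derivative_eq_intros simp: qmono_def logder_def pos3_def field_simps)
    next
      case 3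
      then show ?thesis using x q
        by (auto intro!: derivative_eq_intros simp: qmono_def logder_def pos3_def field_simps)
    qed
  qed
  then show ?thesis
  proof (rule DERIV_cong_ev[OF refl _ refl, THEN iffD1, rotated])
    show "eventually (\<lambda>t. exp (a 0 * ln ((x(i := t)) 0) + a 1 * ln ((x(i := t)) 1) + a 2 * ln ((x(i := t)) 2)
      + s * ln (esym2 x + (t - x i) * co_sum i x)) = qmono a s (x(i := t))) (nhds (x i))"
      using eventually_pos3[OF x i] by eventually_elim (simp add: qmono_def esym2_upd i)
  qed
qed

lemma Dneg_eqI:
  assumes "\<And>x. pos3 x \<Longrightarrow> ((\<lambda>t. F (x(i := t))) has_real_derivative - G x) (at (x i))"
    and "\<And>x. \<not> pos3 x \<Longrightarrow> G x = 0"
  shows "Dneg i F = G"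
  by (rule ext) (use assms DERIV_imp_deriv in \<open>fastforce simp: Dneg_def\<close>)

lemma Dneg_qmono:
  assumes "i < 3"
  shows "Dneg i (qmono a s) = (\<lambda>x. - (qmono a s x * logder a s i x))"
  by (rule Dneg_eqI) (use qmono_deriv assms in \<open>auto simp: qmono_def\<close>)

text \<open>The shape of \<open>logder a s j\<close> along a coordinate i \<noteq> j, with p =
  \<open>x i\<close>: A is the fixed term, the numerator \<open>co_sum j\<close> moves with slope
  one and \<open>esym2\<close> with slope C.\<close>

lemma DERIV_aux_off_diagonal:
  fixes Q :: real
  assumes "Q \<noteq> 0"
  shows "((\<lambda>t. A + s * (B + (t - p)) / (Q + (t - p) * C)) has_real_derivative
    (s / Q - s * C * B / Q\<^sup>2)) (at p)"
  using assms
  by (auto intro!: derivative_eq_intros simp: power2_eq_square) (simp add: field_simps)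

text \<open>The case i = j: here \<open>co_sum i\<close> does not depend on the moving coordinate,
  while the first term does.\<close>

lemma DERIV_aux_diagonal:
  fixes Q :: real
  assumes "Q \<noteq> 0" "p \<noteq> 0"
  shows "((\<lambda>t. A / t + s * B / (Q + (t - p) * C)) has_real_derivative
    (- A / p\<^sup>2 - s * C * B / Q\<^sup>2)) (at p)"
  using assms
  by (auto intro!: derivative_eq_intros simp: power2_eq_square)

text \<open>The product rule for \<open>qmono\<close> times its logarithmic derivative; the two
  signs of \<open>Dneg\<close> cancel. The result is visibly symmetric in i and j, which is the
  source of \<open>Dneg_commute\<close>.\<close>

lemma Dneg_Dneg_qmono:
  assumes i: "i < 3" and j: "j < 3"
  shows "Dneg i (Dneg j (qmono a s)) = (\<lambda>x. qmono a s x * (logder a s i x * logder a s j x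
    + (if i = j then - a i / (x i)\<^sup>2 else s / esym2 x)
    - s * co_sum i x * co_sum j x / (esym2 x)\<^sup>2))"
  unfolding Dneg_qmono[OF j]
proof (rule Dneg_eqI)
  fix x assume x: "pos3 x"
  have q: "esym2 x \<noteq> 0" using esym2_pos[OF x] by simp
  have xi: "x i \<noteq> 0" "x j \<noteq> 0" using x i j by (auto simp: pos3_iff)
  have L: "((\<lambda>t. logder a s j (x(i := t))) has_real_derivative
     ((if i = j then - a i / (x i)\<^sup>2 else s / esym2 x)
    - s * co_sum i x * co_sum j x / (esym2 x)\<^sup>2)) (at (x i))"
    unfolding logder_def esym2_upd[OF i] co_sum_upd[OF i j]
    using DERIV_aux_off_diagonal[OF q] DERIV_aux_diagonal[OF q xi(1)]
    by (cases "i = j") auto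
  from DERIV_minus[OF DERIV_mult[OF qmono_deriv[OF x i] L]]
  show "((\<lambda>t. - (qmono a s (x(i := t)) * logder a s j (x(i := t)))) has_real_derivative
     - (qmono a s x * (logder a s i x * logder a s j x
    + (if i = j then - a i / (x i)\<^sup>2 else s / esym2 x)
    - s * co_sum i x * co_sum j x / (esym2 x)\<^sup>2))) (at (x i))"
    by (rule DERIV_cong) (simp add: algebra_simps)
qed (simp add: qmono_def)

lemma qmono_shift_down:
  "i < 3 \<Longrightarrow> pos3 x \<Longrightarrow> qmono (a(i := a i - 1)) s x = qmono a s x / x i"
  by (auto simp: less3 qmono_def pos3_def algebra_simps exp_add exp_diff)

lemma qmono_shift_up:
  "i < 3 \<Longrightarrow> pos3 x \<Longrightarrow> qmono (a(i := a i + 1)) (s - 1) x = qmono a s x * x i / esym2 x"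
  using esym2_pos[of x]
  by (auto simp: less3 qmono_def pos3_def algebra_simps exp_add exp_diff)

text \<open>The derivative consists of three monomials of degree r - 1: one from the power of
  \<open>x i\<close>, and one for each of the two summands of \<open>co_sum i\<close>.\<close>

lemma qspan_D_qmono:
  assumes i: "i < 3" and r: "a 0 + a 1 + a 2 + 2 * s = r"
  shows "qspan (r - 1) (\<lambda>x. c * - (qmono a s x * logder a s i x))"
proof -
  \<comment> \<open>The two indices other than i.\<close>
  define j k where "j = (if i = 0 then 1 else 0 :: nat)" and "k = (if i = 2 then 1 else 2 :: nat)"
  have jk: "j < 3" "k < 3" by (auto simp: j_def k_def)
  have "qspan (r - 1) (\<lambda>x. (- c * a i * qmono (a(i := a i - 1)) s x)
      + ((- c * s) * qmono (a(j := a j + 1)) (s - 1) x + (- c * s) * qmono (a(k := a k + 1)) (s - 1) x))"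
    using i r unfolding less3 by (intro qspan.add qspan.mono) (auto simp: j_def k_def)
  also have "(\<lambda>x. (- c * a i * qmono (a(i := a i - 1)) s x)
      + ((- c * s) * qmono (a(j := a j + 1)) (s - 1) x + (- c * s) * qmono (a(k := a k + 1)) (s - 1) x))
    = (\<lambda>x. c * - (qmono a s x * logder a s i x))"
  proof
    fix x
    have c: "co_sum i x = x j + x k" using i by (auto simp: less3 co_sum_def j_def k_def)
    show "(- c * a i * qmono (a(i := a i - 1)) s x)
      + ((- c * s) * qmono (a(j := a j + 1)) (s - 1) x + (- c * s) * qmono (a(k := a k + 1)) (s - 1) x)
      = c * - (qmono a s x * logder a s i x)"
    proof (cases "pos3 x")
      case True
      show ?thesis
        unfolding qmono_shift_down[OF i True] qmono_shift_up[OF jk(1) True] qmono_shift_up[OF jk(2) True]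
          logder_def c by (simp add: algebra_simps add_divide_distrib)
    qed (simp add: qmono_def)
  qed
  finally show ?thesis .
qed

lemma qspan_deriv:
  assumes "qspan r F" "i < 3"
  shows "pos3 x \<Longrightarrow> ((\<lambda>t. F (x(i := t))) has_real_derivative - Dneg i F x) (at (x i))"
    and "\<not> pos3 x \<Longrightarrow> F x = 0"
    and "qspan (r - 1) (Dneg i F)"
proof -
  have "(\<forall>x. pos3 x \<longrightarrow> (\<lambda>t. F (x(i := t))) field_differentiable at (x i)) \<and>
    (\<forall>x. \<not> pos3 x \<longrightarrow> F x = 0) \<and> qspan (r - 1) (Dneg i F)"
    using assms
  proof (induction rule: qspan.induct)
    case (mono a s r c)
    have d: "((\<lambda>t. c * qmono a s (x(i := t))) has_real_derivative - (c * - (qmono a s x * logder a s i x))) (at (x i))"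
      if "pos3 x" for x
      using DERIV_cmult[OF qmono_deriv[OF that mono(2)], of c a s] by simp
    have "Dneg i (\<lambda>x. c * qmono a s x) = (\<lambda>x. c * - (qmono a s x * logder a s i x))"
      by (rule Dneg_eqI) (use d in \<open>auto simp: qmono_def\<close>)
    moreover have "(\<lambda>t. c * qmono a s (x(i := t))) field_differentiable at (x i)" if "pos3 x" for x
      using d[OF that] unfolding field_differentiable_def by blast
    ultimately show ?case using qspan_D_qmono[OF mono(2,1), of c]
      by (simp add: qmono_outside del: fun_upd_apply)
  next
    case (add r F G)
    have d: "((\<lambda>t. F (x(i := t)) + G (x(i := t))) has_real_derivative - (Dneg i F x + Dneg i G x)) (at (x i))"
      if "pos3 x" for x
    proof -
      have "((\<lambda>t. F (x(i := t))) has_real_derivative - Dneg i F x) (at (x i))"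
        "((\<lambda>t. G (x(i := t))) has_real_derivative - Dneg i G x) (at (x i))"
        using add that by (auto simp: Dneg_def DERIV_deriv_iff_field_differentiable simp del: fun_upd_apply)
      from DERIV_add[OF this] show ?thesis by simp
    qed
    have "Dneg i (\<lambda>x. F x + G x) = (\<lambda>x. Dneg i F x + Dneg i G x)"
      by (rule Dneg_eqI) (use d in \<open>auto simp: Dneg_def\<close>)
    moreover have "(\<lambda>t. F (x(i := t)) + G (x(i := t))) field_differentiable at (x i)" if "pos3 x" for x
      using d[OF that] unfolding field_differentiable_def by blast
    ultimately show ?case using add qspan.add by (simp del: fun_upd_apply)
  qed
  then show "pos3 x \<Longrightarrow> ((\<lambda>t. F (x(i := t))) has_real_derivative - Dneg i F x) (at (x i))"
    and "\<not> pos3 x \<Longrightarrow> F x = 0" and "qspan (r - 1) (Dneg i F)"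
    by (auto simp: Dneg_def DERIV_deriv_iff_field_differentiable simp del: fun_upd_apply)
qed

lemma Dneg_add:
  assumes "qspan r F" "qspan r G" "i < 3"
  shows "Dneg i (\<lambda>x. F x + G x) = (\<lambda>x. Dneg i F x + Dneg i G x)"
proof (rule Dneg_eqI)
  fix x assume "pos3 x"
  from DERIV_add[OF qspan_deriv(1)[OF assms(1,3) this] qspan_deriv(1)[OF assms(2,3) this]]
  show "((\<lambda>t. F (x(i := t)) + G (x(i := t))) has_real_derivative - (Dneg i F x + Dneg i G x)) (at (x i))"
    by simp
qed (simp add: Dneg_def)

lemma Dneg_cmult:
  assumes "qspan r F" "i < 3"
  shows "Dneg i (\<lambda>x. c * F x) = (\<lambda>x. c * Dneg i F x)"
proof (rule Dneg_eqI)
  fix x assume "pos3 x"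
  from DERIV_cmult[OF qspan_deriv(1)[OF assms this], of c]
  show "((\<lambda>t. c * F (x(i := t))) has_real_derivative - (c * Dneg i F x)) (at (x i))" by simp
qed (simp add: Dneg_def)

lemma qspan_cmult: "qspan r F \<Longrightarrow> qspan r (\<lambda>x. c * F x)"
proof (induction rule: qspan.induct)
  case (mono a s r d)
  then show ?case using qspan.mono[of a s r "c * d"] by (simp add: mult.assoc)
next
  case (add r F G)
  then show ?case by (simp add: distrib_left qspan.add)
qed

lemma qspan_qmono: "a 0 + a 1 + a 2 + 2 * s = r \<Longrightarrow> qspan r (qmono a s)"
  using qspan.mono[of a s r 1] by simp

lemma Dneg_commute:
  assumes "qspan r F" "i < 3" "j < 3"
  shows "Dneg i (Dneg j F) = Dneg j (Dneg i F)"
  using assms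
proof (induction rule: qspan.induct)
  case (mono a s r c)
  note q = qspan_qmono[OF mono(1)]
  have "Dneg i (Dneg j (qmono a s)) = Dneg j (Dneg i (qmono a s))"
    unfolding Dneg_Dneg_qmono[OF mono(2,3)] Dneg_Dneg_qmono[OF mono(3,2)]
    by (auto simp: fun_eq_iff algebra_simps)
  then show ?case
    by (simp add: Dneg_cmult[OF q mono(2)] Dneg_cmult[OF q mono(3)]
      Dneg_cmult[OF qspan_deriv(3)[OF q mono(2)] mono(3)]
      Dneg_cmult[OF qspan_deriv(3)[OF q mono(3)] mono(2)])
next
  case (add r F G)
  note FG = add.hyps
  show ?case
    using add.IH add.prems
    by (simp add: Dneg_add[OF FG] Dneg_add[OF qspan_deriv(3)[OF FG(1)] qspan_deriv(3)[OF FG(2)]])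
qed

text \<open>Euler's identity for functions homogeneous of degree r, with the sign of
  \<open>Dneg\<close>. On monomials it comes down to the same identity for \<open>esym2\<close>, of
  degree 2.\<close>

lemma qspan_Euler:
  assumes "qspan r F" "pos3 x"
  shows "x 0 * Dneg 0 F x + x 1 * Dneg 1 F x + x 2 * Dneg 2 F x = - r * F x"
  using assms
proof (induction rule: qspan.induct)
  case (mono a s r c)
  note q = qspan_qmono[OF mono(1)]
  have e: "esym2 x \<noteq> 0" using esym2_pos[OF mono(2)] by simp
  have x: "x 0 \<noteq> 0" "x 1 \<noteq> 0" "x 2 \<noteq> 0" using mono(2) by (auto simp: pos3_def)
  have "x 0 * co_sum 0 x + x 1 * co_sum 1 x + x 2 * co_sum 2 x = 2 * esym2 x"
    by (simp add: co_sum_def esym2_def algebra_simps)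
  then have "s * (x 0 * co_sum 0 x + x 1 * co_sum 1 x + x 2 * co_sum 2 x) / esym2 x = 2 * s"
    using e by simp
  then have "x 0 * logder a s 0 x + x 1 * logder a s 1 x + x 2 * logder a s 2 x = r"
    using x mono(1) by (simp add: logder_def algebra_simps add_divide_distrib)
  then have "c * qmono a s x * (x 0 * logder a s 0 x + x 1 * logder a s 1 x + x 2 * logder a s 2 x)
     = c * qmono a s x * r" by simp
  then show ?case by (simp add: Dneg_cmult[OF q] Dneg_qmono algebra_simps)
next
  case (add r F G)
  then show ?case by (simp add: Dneg_add[OF add.hyps] algebra_simps)
qed

section \<open>Signed mixed derivatives of a power of the quadratic form\<close>

definition pow_deriv :: "real \<Rightarrow> nat \<Rightarrow> nat \<Rightarrow> nat \<Rightarrow> (nat \<Rightarrow> real) \<Rightarrow> real" where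
  "pow_deriv \<beta> i j k = (Dneg 0 ^^ i) ((Dneg 1 ^^ j) ((Dneg 2 ^^ k) (qmono (\<lambda>_. 0) (- \<beta>))))"

lemma qspan_funpow: "qspan r F \<Longrightarrow> i < 3 \<Longrightarrow> qspan (r - real n) ((Dneg i ^^ n) F)"
proof (induction n)
  case (Suc n)
  then show ?case using qspan_deriv(3)[of "r - real n" "(Dneg i ^^ n) F" i]
    by (simp add: algebra_simps)
qed simp

lemma Dneg_commute_funpow:
  "qspan r F \<Longrightarrow> i < 3 \<Longrightarrow> j < 3 \<Longrightarrow> Dneg i ((Dneg j ^^ n) F) = (Dneg j ^^ n) (Dneg i F)"
proof (induction n)
  case (Suc n)
  then show ?case using Dneg_commute[OF qspan_funpow[OF Suc.prems(1,3), of n] Suc.prems(2,3)]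
    by simp
qed simp

lemma qspan_base: "qspan (- 2 * \<beta>) (qmono (\<lambda>_. 0) (- \<beta>))"
  by (rule qspan_qmono) simp

lemma qspan_pow_deriv: "qspan (- 2 * \<beta> - real (i + j + k)) (pow_deriv \<beta> i j k)"
proof -
  have "qspan (- 2 * \<beta> - real k - real j - real i) (pow_deriv \<beta> i j k)"
    unfolding pow_deriv_def by (intro qspan_funpow qspan_base) auto
  then show ?thesis by (simp add: algebra_simps)
qed

text \<open>The definition fixes the order of differentiation; commutativity moves a new derivative
  into its block.\<close>

lemma Dneg_pow_deriv:
  "Dneg 0 (pow_deriv \<beta> i j k) = pow_deriv \<beta> (Suc i) j k"
  "Dneg 1 (pow_deriv \<beta> i j k) = pow_deriv \<beta> i (Suc j) k"
  "Dneg 2 (pow_deriv \<beta> i j k) = pow_deriv \<beta> i j (Suc k)"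
proof -
  have q2: "qspan (- 2 * \<beta> - real k) ((Dneg 2 ^^ k) (qmono (\<lambda>_. 0) (- \<beta>)))"
    by (intro qspan_funpow qspan_base) auto
  have q1: "qspan (- 2 * \<beta> - real k - real j) ((Dneg 1 ^^ j) ((Dneg 2 ^^ k) (qmono (\<lambda>_. 0) (- \<beta>))))"
    by (intro qspan_funpow q2) auto
  show "Dneg 0 (pow_deriv \<beta> i j k) = pow_deriv \<beta> (Suc i) j k"
    by (simp add: pow_deriv_def)
  show "Dneg 1 (pow_deriv \<beta> i j k) = pow_deriv \<beta> i (Suc j) k"
    unfolding pow_deriv_def by (subst Dneg_commute_funpow[OF q1]) auto
  show "Dneg 2 (pow_deriv \<beta> i j k) = pow_deriv \<beta> i j (Suc k)"
    unfolding pow_deriv_def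
    by (subst Dneg_commute_funpow[OF q1], simp, simp, subst Dneg_commute_funpow[OF q2]) auto
qed

text \<open>The operator \<open>D(\<partial>)\<close>; the signs of \<open>Dneg\<close> cancel in
  second order. At the squared side lengths of a triangle, D is -16 times the squared area by
  Heron's formula, hence the name.\<close>

definition Heron :: "((nat \<Rightarrow> real) \<Rightarrow> real) \<Rightarrow> (nat \<Rightarrow> real) \<Rightarrow> real" where
  "Heron F = (\<lambda>x. (Dneg 0 (Dneg 0 F) x + Dneg 1 (Dneg 1 F) x + Dneg 2 (Dneg 2 F) x)
     + (-2) * (Dneg 0 (Dneg 1 F) x + Dneg 1 (Dneg 2 F) x + Dneg 2 (Dneg 0 F) x))"

text \<open>As a symmetric matrix, D is minus the inverse of the quadratic form
  \<open>esym2\<close>. This is the classical identity for powers of a nondegenerate quadratic form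
  in m variables, with factor s(s + m/2 - 1), for m = 3. In the computation, D takes the value -4
  \<open>esym2\<close> at the gradient of \<open>esym2\<close>, and the three mixed second
  derivatives of \<open>esym2\<close>, each equal to 1, give the term -6s.\<close>

lemma Heron_qmono:
  "Heron (qmono (\<lambda>_. 0) s) = (\<lambda>x. -4 * s * (s + 1/2) * qmono (\<lambda>_. 0) (s - 1) x)"
proof
  fix x
  show "Heron (qmono (\<lambda>_. 0) s) x = -4 * s * (s + 1/2) * qmono (\<lambda>_. 0) (s - 1) x"
  proof (cases "pos3 x")
    case True
    let ?q = "esym2 x"
    have q: "?q > 0" using True by (rule esym2_pos)
    have e: "qmono (\<lambda>_. 0) (s - 1) x = qmono (\<lambda>_. 0) s x / ?q"
      using True q by (simp add: qmono_def algebra_simps exp_diff)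
    define a b c where "a = co_sum 0 x" and "b = co_sum 1 x" and "c = co_sum 2 x"
    have h: "a^2 + b^2 + c^2 - 2 * a * b - 2 * b * c - 2 * c * a = - 4 * ?q"
      by (simp add: a_def b_def c_def co_sum_def esym2_def power2_eq_square algebra_simps)
    have "Heron (qmono (\<lambda>_. 0) s) x = qmono (\<lambda>_. 0) s x *
      ((s^2 - s) * (a^2 + b^2 + c^2 - 2 * a * b - 2 * b * c - 2 * c * a) / ?q^2 - 6 * s / ?q)"
      unfolding Heron_def using q
      by (simp add: Dneg_Dneg_qmono logder_def a_def b_def c_def power2_eq_square divide_simps)
        (simp add: algebra_simps)
    also have "\<dots> = -4 * s * (s + 1/2) * (qmono (\<lambda>_. 0) s x / ?q)"
      unfolding h using q by (simp add: power2_eq_square divide_simps) (simp add: algebra_simps)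
    finally show ?thesis by (simp only: e)
  next
    case False
    then show ?thesis by (simp add: Heron_def Dneg_def qmono_outside)
  qed
qed

lemma Heron_add:
  assumes "qspan r F" "qspan r G"
  shows "Heron (\<lambda>x. F x + G x) = (\<lambda>x. Heron F x + Heron G x)"
proof -
  have "Dneg i (Dneg j (\<lambda>x. F x + G x)) = (\<lambda>x. Dneg i (Dneg j F) x + Dneg i (Dneg j G) x)"
    if "i < 3" "j < 3" for i j
    by (simp add: Dneg_add[OF assms that(2)]
      Dneg_add[OF qspan_deriv(3)[OF assms(1) that(2)] qspan_deriv(3)[OF assms(2) that(2)] that(1)])
  then show ?thesis by (simp add: Heron_def algebra_simps)
qed

lemma Heron_cmult:
  assumes "qspan r F"
  shows "Heron (\<lambda>x. c * F x) = (\<lambda>x. c * Heron F x)"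
proof -
  have "Dneg i (Dneg j (\<lambda>x. c * F x)) = (\<lambda>x. c * Dneg i (Dneg j F) x)"
    if "i < 3" "j < 3" for i j
    by (simp add: Dneg_cmult[OF assms that(2)] Dneg_cmult[OF qspan_deriv(3)[OF assms that(2)] that(1)])
  then show ?thesis by (simp add: Heron_def algebra_simps)
qed

lemma Heron_pow_deriv:
  "Heron (pow_deriv \<beta> i j k) = (\<lambda>x.
     (pow_deriv \<beta> (i+2) j k x + pow_deriv \<beta> i (j+2) k x + pow_deriv \<beta> i j (k+2) x)
     + (-2) * (pow_deriv \<beta> (i+1) (j+1) k x + pow_deriv \<beta> i (j+1) (k+1) x + pow_deriv \<beta> (i+1) j (k+1) x))"
  by (simp add: Heron_def Dneg_pow_deriv Dneg_pow_deriv[unfolded One_nat_def])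

definition one3 :: "nat \<Rightarrow> real" where "one3 = (\<lambda>_. 1)"

lemma pos3_one3: "pos3 one3" by (simp add: pos3_def one3_def)

definition pow_deriv_one :: "real \<Rightarrow> nat \<Rightarrow> nat \<Rightarrow> nat \<Rightarrow> real" where
  "pow_deriv_one \<beta> i j k = pow_deriv \<beta> i j k one3"

text \<open>At (1, 1, 1) the factors \<open>x i\<close> in Euler's identity are one, so it becomes a
  recurrence between consecutive orders of differentiation.\<close>

lemma pow_deriv_one_Euler:
  "(2 * \<beta> + real (i + j + k)) * pow_deriv_one \<beta> i j k = pow_deriv_one \<beta> (Suc i) j k + pow_deriv_one \<beta> i (Suc j) k + pow_deriv_one \<beta> i j (Suc k)"
  using qspan_Euler[OF qspan_pow_deriv pos3_one3, of \<beta> i j k]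
  by (simp add: Dneg_pow_deriv Dneg_pow_deriv[unfolded One_nat_def] pow_deriv_one_def) (simp add: one3_def algebra_simps)

text \<open>The left side is \<open>D\<^sup>2\<close> multiplied out, each monomial replaced by the
  derivative of that type. The right side comes from \<open>Heron_qmono\<close> at s = -\<beta> and
  at s = -\<beta> - 1; for 0 < \<beta> < 1/2 the first factor is positive and the second
  negative.\<close>

lemma pow_deriv_one_Heron_squared:
  "pow_deriv_one \<beta> 4 0 0 + pow_deriv_one \<beta> 0 4 0 + pow_deriv_one \<beta> 0 0 4
   - 4 * (pow_deriv_one \<beta> 3 1 0 + pow_deriv_one \<beta> 1 3 0 + pow_deriv_one \<beta> 0 3 1 + pow_deriv_one \<beta> 0 1 3 + pow_deriv_one \<beta> 3 0 1 + pow_deriv_one \<beta> 1 0 3)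
   + 6 * (pow_deriv_one \<beta> 2 2 0 + pow_deriv_one \<beta> 0 2 2 + pow_deriv_one \<beta> 2 0 2)
   + 4 * (pow_deriv_one \<beta> 2 1 1 + pow_deriv_one \<beta> 1 2 1 + pow_deriv_one \<beta> 1 1 2)
   = - 16 * \<beta> * (1/2 - \<beta>) * (\<beta> + 1) * (\<beta> + 1/2) * qmono (\<lambda>_. 0) (- \<beta> - 2) one3"
proof -
  let ?f = "qmono (\<lambda>_. 0) (- \<beta>)"
  have f: "?f = pow_deriv \<beta> 0 0 0" by (simp add: pow_deriv_def)
  have "Heron (Heron ?f) = (\<lambda>x. -4 * (-\<beta>) * (-\<beta> + 1/2) * (-4 * (-\<beta> - 1) * ((-\<beta> - 1) + 1/2) * qmono (\<lambda>_. 0) (-\<beta> - 1 - 1) x))"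
    unfolding Heron_qmono by (subst Heron_cmult[OF qspan_qmono[OF refl]]) (simp add: Heron_qmono)
  then have 1: "Heron (Heron ?f) one3 = - 16 * \<beta> * (1/2 - \<beta>) * (\<beta> + 1) * (\<beta> + 1/2) * qmono (\<lambda>_. 0) (- \<beta> - 2) one3"
    by (simp add: algebra_simps)
  have q: "qspan (- 2 * \<beta> - 2) (pow_deriv \<beta> i j k)" if "i + j + k = 2" for i j k
    using qspan_pow_deriv[of \<beta> i j k] that by simp
  note qs = q[of 2 0 0] q[of 0 2 0] q[of 0 0 2] q[of 1 1 0] q[of 0 1 1] q[of 1 0 1]
  define A where "A = (\<lambda>x. pow_deriv \<beta> 2 0 0 x + pow_deriv \<beta> 0 2 0 x + pow_deriv \<beta> 0 0 2 x)"
  define B where "B = (\<lambda>x. pow_deriv \<beta> 1 1 0 x + pow_deriv \<beta> 0 1 1 x + pow_deriv \<beta> 1 0 1 x)"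
  have AB: "qspan (- 2 * \<beta> - 2) A" "qspan (- 2 * \<beta> - 2) B"
    unfolding A_def B_def using qs by (auto intro!: qspan.add)
  have HA: "Heron A = (\<lambda>x. Heron (pow_deriv \<beta> 2 0 0) x + Heron (pow_deriv \<beta> 0 2 0) x + Heron (pow_deriv \<beta> 0 0 2) x)"
    unfolding A_def using qs
    by (simp add: Heron_add[where r = "- 2 * \<beta> - 2"] qspan.add)
  have HB: "Heron B = (\<lambda>x. Heron (pow_deriv \<beta> 1 1 0) x + Heron (pow_deriv \<beta> 0 1 1) x + Heron (pow_deriv \<beta> 1 0 1) x)"
    unfolding B_def using qs
    by (simp add: Heron_add[where r = "- 2 * \<beta> - 2"] qspan.add)
  have "Heron ?f = (\<lambda>x. A x + (-2) * B x)"
    unfolding f Heron_pow_deriv A_def B_def by (simp add: numeral_2_eq_2)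
  then have "Heron (Heron ?f) = (\<lambda>x. Heron A x + (-2) * Heron B x)"
    using Heron_add[OF AB(1) qspan_cmult[OF AB(2), of "-2"]] Heron_cmult[OF AB(2), of "-2"] by simp
  then have "Heron (Heron ?f) one3 = Heron A one3 - 2 * Heron B one3" by simp
  also have "\<dots> = pow_deriv_one \<beta> 4 0 0 + pow_deriv_one \<beta> 0 4 0 + pow_deriv_one \<beta> 0 0 4
   - 4 * (pow_deriv_one \<beta> 3 1 0 + pow_deriv_one \<beta> 1 3 0 + pow_deriv_one \<beta> 0 3 1 + pow_deriv_one \<beta> 0 1 3 + pow_deriv_one \<beta> 3 0 1 + pow_deriv_one \<beta> 1 0 3)
   + 6 * (pow_deriv_one \<beta> 2 2 0 + pow_deriv_one \<beta> 0 2 2 + pow_deriv_one \<beta> 2 0 2)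
   + 4 * (pow_deriv_one \<beta> 2 1 1 + pow_deriv_one \<beta> 1 2 1 + pow_deriv_one \<beta> 1 1 2)"
    unfolding HA HB Heron_pow_deriv by (simp add: pow_deriv_one_def numeral_eq_Suc)
  finally show ?thesis using 1 by simp
qed

section \<open>A discrete form of Polya's positivity argument\<close>

definition triples :: "nat \<Rightarrow> (nat \<times> nat \<times> nat) set" where
  "triples n = {(i, j, k). i + j + k = n}"

text \<open>The falling factorial i(i - 1)...(i - p + 1).\<close>

definition ffall :: "nat \<Rightarrow> nat \<Rightarrow> real" where
  "ffall p i = (\<Prod>r<p. real i - real r)"

lemma finite_triples: "finite (triples n)"
  by (rule finite_subset[of _ "{..n} \<times> {..n} \<times> {..n}"]) (auto simp: triples_def)

text \<open>Both sides are the falling factorial of i + 1 of length p + 1, with its first or its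
  last factor split off.\<close>

lemma ffall_step: "real (Suc i) * ffall p i = ffall p (Suc i) * (real (Suc i) - real p)"
proof -
  have "real (Suc i) * ffall p i = (\<Prod>r<Suc p. real (Suc i) - real r)"
    by (simp add: prod.lessThan_Suc_shift ffall_def del: prod.lessThan_Suc)
  then show ?thesis by (simp add: ffall_def)
qed

text \<open>Makes the boundary terms vanish when summation indices are shifted.\<close>

lemma ffall_0: "ffall p 0 * real p = 0"
  by (cases p) (auto simp: ffall_def prod.lessThan_Suc_shift simp del: prod.lessThan_Suc)

lemma ffall_eq_0: "i < p \<Longrightarrow> ffall p i = 0"
  by (auto simp: ffall_def)

lemma ffall_self: "ffall p p = fact p"
proof (induction p)
  case (Suc p)
  have "ffall (Suc p) (Suc p) = real (Suc p) * ffall p p"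
    using ffall_step[of p p] by (simp add: ffall_def)
  then show ?case using Suc by simp
qed (simp add: ffall_def)

text \<open>The coefficient of \<open>u^i v^j w^k\<close> in the expansion of
  \<open>e\<^sub>2\<^sup>-\<^sup>\<beta>\<close> at the point (1 - u, 1 - v, 1 - w).\<close>

definition taylor_coeff :: "real \<Rightarrow> nat \<Rightarrow> nat \<Rightarrow> nat \<Rightarrow> real" where
  "taylor_coeff \<beta> i j k = pow_deriv_one \<beta> i j k / (fact i * fact j * fact k)"

lemma taylor_coeff_Euler:
  "(2 * \<beta> + real (i + j + k)) * taylor_coeff \<beta> i j k =
    real (Suc i) * taylor_coeff \<beta> (Suc i) j k + real (Suc j) * taylor_coeff \<beta> i (Suc j) k + real (Suc k) * taylor_coeff \<beta> i j (Suc k)"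
proof -
  have "(2 * \<beta> + real (i + j + k)) * taylor_coeff \<beta> i j k =
    (pow_deriv_one \<beta> (Suc i) j k + pow_deriv_one \<beta> i (Suc j) k + pow_deriv_one \<beta> i j (Suc k)) / (fact i * fact j * fact k)"
    by (simp add: taylor_coeff_def pow_deriv_one_Euler[symmetric])
  moreover have "real (Suc l) * (x / (fact (Suc l) * y)) = x / (fact l * y)" for l and x y :: real
    unfolding fact_Suc times_divide_eq_right mult.assoc
    by (rule nonzero_mult_divide_mult_cancel_left) simp
  note this[of i "pow_deriv_one \<beta> (Suc i) j k" "fact j * fact k"]
    this[of j "pow_deriv_one \<beta> i (Suc j) k" "fact i * fact k"] this[of k "pow_deriv_one \<beta> i j (Suc k)" "fact i * fact j"]
  ultimately show ?thesis by (simp only: taylor_coeff_def add_divide_distrib ac_simps)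
qed

text \<open>By homogeneity this is \<open>pow_deriv_one \<beta> p q r\<close> times the coefficient
  of \<open>t^(n - p - q - r)\<close> in \<open>(1 - t)^(-2 \<beta> - p - q - r)\<close>. The
  recurrence \<open>moment_step\<close> and the initial value \<open>moment_top\<close> express this
  without power series.\<close>

definition moment :: "real \<Rightarrow> nat \<Rightarrow> nat \<Rightarrow> nat \<Rightarrow> nat \<Rightarrow> real" where
  "moment \<beta> p q r n = (\<Sum>(i, j, k)\<in>triples n. ffall p i * ffall q j * ffall r k * taylor_coeff \<beta> i j k)"

lemma sum_triples_shift:
  fixes h :: "nat \<Rightarrow> nat \<Rightarrow> nat \<Rightarrow> real"
  shows "(\<And>j k. h 0 j k = 0) \<Longrightarrow> (\<Sum>(i, j, k)\<in>triples (Suc n). h i j k) = (\<Sum>(i, j, k)\<in>triples n. h (Suc i) j k)"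
    and "(\<And>i k. h i 0 k = 0) \<Longrightarrow> (\<Sum>(i, j, k)\<in>triples (Suc n). h i j k) = (\<Sum>(i, j, k)\<in>triples n. h i (Suc j) k)"
    and "(\<And>i j. h i j 0 = 0) \<Longrightarrow> (\<Sum>(i, j, k)\<in>triples (Suc n). h i j k) = (\<Sum>(i, j, k)\<in>triples n. h i j (Suc k))"
proof -
  let ?f = "\<lambda>(i, j, k). h i j k"
  show "sum ?f (triples (Suc n)) = (\<Sum>(i, j, k)\<in>triples n. h (Suc i) j k)" if "\<And>j k. h 0 j k = 0"
  proof -
    have "sum ?f (triples (Suc n)) = sum ?f (triples (Suc n) \<inter> {(i, j, k). i \<noteq> 0})"
      by (rule sum.mono_neutral_right) (use that in \<open>auto simp: finite_triples intro!: gr0I\<close>)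
    also have "\<dots> = (\<Sum>(i, j, k)\<in>triples n. h (Suc i) j k)"
      by (rule sum.reindex_bij_witness[where i = "\<lambda>(i, j, k). (Suc i, j, k)" and j = "\<lambda>(i, j, k). (i - 1, j, k)"])
        (clarsimp simp: triples_def; fail)+
    finally show ?thesis .
  qed
  show "sum ?f (triples (Suc n)) = (\<Sum>(i, j, k)\<in>triples n. h i (Suc j) k)" if "\<And>i k. h i 0 k = 0"
  proof -
    have "sum ?f (triples (Suc n)) = sum ?f (triples (Suc n) \<inter> {(i, j, k). j \<noteq> 0})"
      by (rule sum.mono_neutral_right) (use that in \<open>auto simp: finite_triples intro!: gr0I\<close>)
    also have "\<dots> = (\<Sum>(i, j, k)\<in>triples n. h i (Suc j) k)"
      by (rule sum.reindex_bij_witness[where i = "\<lambda>(i, j, k). (i, Suc j, k)" and j = "\<lambda>(i, j, k). (i, j - 1, k)"])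
        (clarsimp simp: triples_def; fail)+
    finally show ?thesis .
  qed
  show "sum ?f (triples (Suc n)) = (\<Sum>(i, j, k)\<in>triples n. h i j (Suc k))" if "\<And>i j. h i j 0 = 0"
  proof -
    have "sum ?f (triples (Suc n)) = sum ?f (triples (Suc n) \<inter> {(i, j, k). k \<noteq> 0})"
      by (rule sum.mono_neutral_right) (use that in \<open>auto simp: finite_triples intro!: gr0I\<close>)
    also have "\<dots> = (\<Sum>(i, j, k)\<in>triples n. h i j (Suc k))"
      by (rule sum.reindex_bij_witness[where i = "\<lambda>(i, j, k). (i, j, Suc k)" and j = "\<lambda>(i, j, k). (i, j, k - 1)"])
        (clarsimp simp: triples_def; fail)+
    finally show ?thesis .
  qed
qed

text \<open>Euler's recurrence raises one index and brings a factor such as i + 1, which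
  \<open>ffall_step\<close> trades for i + 1 - p while updating the falling factorial. After the
  index shifts the three factors add up to n + 1 - (p + q + r).\<close>

lemma moment_step:
  "(2 * \<beta> + real n) * moment \<beta> p q r n = (real (Suc n) - real (p + q + r)) * moment \<beta> p q r (Suc n)"
proof -
  let ?F = "\<lambda>i j k. ffall p i * ffall q j * ffall r k"
  define h0 h1 h2 where "h0 = (\<lambda>i j k. ?F i j k * (real i - real p) * taylor_coeff \<beta> i j k)"
    and "h1 = (\<lambda>i j k. ?F i j k * (real j - real q) * taylor_coeff \<beta> i j k)"
    and "h2 = (\<lambda>i j k. ?F i j k * (real k - real r) * taylor_coeff \<beta> i j k)"
  have s0: "?F i j k * (real (Suc i) * taylor_coeff \<beta> (Suc i) j k) = h0 (Suc i) j k" for i j k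
    using arg_cong[OF ffall_step[of i p], of "\<lambda>u. u * ffall q j * ffall r k * taylor_coeff \<beta> (Suc i) j k"]
    by (simp only: h0_def ac_simps)
  have s1: "?F i j k * (real (Suc j) * taylor_coeff \<beta> i (Suc j) k) = h1 i (Suc j) k" for i j k
    using arg_cong[OF ffall_step[of j q], of "\<lambda>u. u * ffall p i * ffall r k * taylor_coeff \<beta> i (Suc j) k"]
    by (simp only: h1_def ac_simps)
  have s2: "?F i j k * (real (Suc k) * taylor_coeff \<beta> i j (Suc k)) = h2 i j (Suc k)" for i j k
    using arg_cong[OF ffall_step[of k r], of "\<lambda>u. u * ffall p i * ffall q j * taylor_coeff \<beta> i j (Suc k)"]
    by (simp only: h2_def ac_simps)
  have z: "h0 0 j k = 0" "h1 j 0 k = 0" "h2 j k 0 = 0" for j k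
    using ffall_0[of p] ffall_0[of q] ffall_0[of r] by (auto simp: h0_def h1_def h2_def)
  have "(2 * \<beta> + real n) * moment \<beta> p q r n
     = (\<Sum>(i, j, k)\<in>triples n. ?F i j k * ((2 * \<beta> + real (i + j + k)) * taylor_coeff \<beta> i j k))"
    unfolding moment_def sum_distrib_left
    by (rule sum.cong) (auto simp: triples_def algebra_simps)
  also have "\<dots> = (\<Sum>(i, j, k)\<in>triples n. h0 (Suc i) j k + h1 i (Suc j) k + h2 i j (Suc k))"
    unfolding taylor_coeff_Euler distrib_left s0 s1 s2 ..
  also have "\<dots> = (\<Sum>(i, j, k)\<in>triples n. h0 (Suc i) j k) + (\<Sum>(i, j, k)\<in>triples n. h1 i (Suc j) k)
     + (\<Sum>(i, j, k)\<in>triples n. h2 i j (Suc k))"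
    by (simp add: case_prod_unfold sum.distrib)
  also have "\<dots> = (\<Sum>(i, j, k)\<in>triples (Suc n). h0 i j k + h1 i j k + h2 i j k)"
    using sum_triples_shift(1)[of h0] sum_triples_shift(2)[of h1] sum_triples_shift(3)[of h2] z
    by (simp add: case_prod_unfold sum.distrib)
  also have "\<dots> = (real (Suc n) - real (p + q + r)) * moment \<beta> p q r (Suc n)"
  proof -
    have "h0 i j k + h1 i j k + h2 i j k = (real (Suc n) - real (p + q + r)) * (?F i j k * taylor_coeff \<beta> i j k)"
      if "i + j + k = Suc n" for i j k
    proof -
      have "h0 i j k + h1 i j k + h2 i j k = (real (i + j + k) - real (p + q + r)) * (?F i j k * taylor_coeff \<beta> i j k)"
        by (simp add: h0_def h1_def h2_def algebra_simps)
      then show ?thesis unfolding that .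
    qed
    then show ?thesis
      unfolding moment_def sum_distrib_left by (intro sum.cong) (auto simp: triples_def)
  qed
  finally show ?thesis .
qed

text \<open>Every other triple with this sum has an entry below the corresponding one of (p, q, r),
  where the falling factorial is zero; at (p, q, r) the factorials cancel those in
  \<open>taylor_coeff\<close>.\<close>

lemma moment_top: "moment \<beta> p q r (p + q + r) = pow_deriv_one \<beta> p q r"
proof -
  have "moment \<beta> p q r (p + q + r) = (\<Sum>(i, j, k)\<in>{(p, q, r)}. ffall p i * ffall q j * ffall r k * taylor_coeff \<beta> i j k)"
    unfolding moment_def
  proof (rule sum.mono_neutral_right[OF finite_triples])
    have "ffall p i * ffall q j * ffall r k * taylor_coeff \<beta> i j k = 0"
      if "i + j + k = p + q + r" "(i, j, k) \<noteq> (p, q, r)" for i j k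
    proof -
      have "\<not> (p \<le> i \<and> q \<le> j \<and> r \<le> k)"
      proof
        assume "p \<le> i \<and> q \<le> j \<and> r \<le> k"
        then have "i = p" "j = q" "k = r" using that(1) by linarith+
        then show False using that(2) by simp
      qed
      then have "i < p \<or> j < q \<or> k < r" by (simp add: not_le)
      then show ?thesis by (elim disjE) (simp_all add: ffall_eq_0)
    qed
    note zero = this
    show "\<forall>x\<in>triples (p + q + r) - {(p, q, r)}. (case x of (i, j, k) \<Rightarrow> ffall p i * ffall q j * ffall r k * taylor_coeff \<beta> i j k) = 0"
    proof
      fix x assume x: "x \<in> triples (p + q + r) - {(p, q, r)}"
      obtain i j k where ijk: "x = (i, j, k)" by (cases x)
      show "(case x of (i, j, k) \<Rightarrow> ffall p i * ffall q j * ffall r k * taylor_coeff \<beta> i j k) = 0"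
        unfolding ijk prod.case by (rule zero) (use x in \<open>simp_all add: ijk triples_def\<close>)
    qed
  qed (simp add: finite_triples triples_def)
  also have "\<dots> = fact p * fact q * fact r * (pow_deriv_one \<beta> p q r / (fact p * fact q * fact r))"
    by (simp only: sum.insert_if sum.empty finite.emptyI empty_iff if_False prod.case ffall_self taylor_coeff_def add_0_right)
  also have "\<dots> = pow_deriv_one \<beta> p q r"
    by (simp only: times_divide_eq_right) (rule nonzero_mult_div_cancel_left, simp)
  finally show ?thesis .
qed

text \<open>\<open>D\<^sup>2\<close> multiplied out, with \<open>moment \<beta> p q r n\<close> in
  place of the monomial with exponents p, q, r.\<close>

definition heron_moment :: "real \<Rightarrow> nat \<Rightarrow> real" where
  "heron_moment \<beta> n = (let m = \<lambda>p q r. moment \<beta> p q r n in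
     m 4 0 0 + m 0 4 0 + m 0 0 4
   - 4 * (m 3 1 0 + m 1 3 0 + m 0 3 1 + m 0 1 3 + m 3 0 1 + m 1 0 3)
   + 6 * (m 2 2 0 + m 0 2 2 + m 2 0 2)
   + 4 * (m 2 1 1 + m 1 2 1 + m 1 1 2))"

text \<open>All terms have p + q + r = 4, so \<open>moment_step\<close> applies with the common
  factor n + 1 - 4.\<close>

lemma heron_moment_step:
  "(2 * \<beta> + real n) * heron_moment \<beta> n = (real n - 3) * heron_moment \<beta> (Suc n)"
proof -
  have *: "(2 * \<beta> + real n) * moment \<beta> p q r n = (real n - 3) * moment \<beta> p q r (Suc n)"
    if "p + q + r = 4" for p q r
  proof -
    have "real (Suc n) - real (p + q + r) = real n - 3" unfolding that by simp
    then show ?thesis using moment_step[of \<beta> n p q r] by (simp only:)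
  qed
  define c d where "c = 2 * \<beta> + real n" and "d = real n - 3"
  have **: "c * moment \<beta> p q r n = d * moment \<beta> p q r (Suc n)" if "p + q + r = 4" for p q r
    unfolding c_def d_def by (rule *[OF that])
  note ms = **[of 4 0 0] **[of 0 4 0] **[of 0 0 4] **[of 3 1 0] **[of 1 3 0] **[of 0 3 1] **[of 0 1 3]
    **[of 3 0 1] **[of 1 0 3] **[of 2 2 0] **[of 0 2 2] **[of 2 0 2] **[of 2 1 1] **[of 1 2 1] **[of 1 1 2]
  have "c * heron_moment \<beta> n = d * heron_moment \<beta> (Suc n)"
    unfolding heron_moment_def Let_def distrib_left right_diff_distrib mult.left_commute[of c] mult.left_commute[of d]
    by (simp only: ms add_0 add_0_right add_num_simps numeral_plus_numeral numeral_plus_one one_plus_numeral one_add_one)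
  then show ?thesis by (simp add: c_def d_def)
qed

lemma heron_moment_4:
  "heron_moment \<beta> 4 = - 16 * \<beta> * (1/2 - \<beta>) * (\<beta> + 1) * (\<beta> + 1/2) * qmono (\<lambda>_. 0) (- \<beta> - 2) one3"
proof -
  have m: "moment \<beta> p q r 4 = pow_deriv_one \<beta> p q r" if "p + q + r = 4" for p q r
    using moment_top[of \<beta> p q r] unfolding that .
  note ms = m[of 4 0 0] m[of 0 4 0] m[of 0 0 4] m[of 3 1 0] m[of 1 3 0] m[of 0 3 1] m[of 0 1 3]
    m[of 3 0 1] m[of 1 0 3] m[of 2 2 0] m[of 0 2 2] m[of 2 0 2] m[of 2 1 1] m[of 1 2 1] m[of 1 1 2]
  show ?thesis
    unfolding heron_moment_def Let_def
    by (rule trans[OF _ pow_deriv_one_Heron_squared]) (simp only: ms add_0 add_0_right add_num_simps numeral_plus_numeral numeral_plus_one one_plus_numeral one_add_one)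
qed

lemma heron_weight_bound:
  fixes i j k :: nat
  defines "F \<equiv> \<lambda>p q r. ffall p i * ffall q j * ffall r k"
  shows "F 4 0 0 + F 0 4 0 + F 0 0 4
   - 4 * (F 3 1 0 + F 1 3 0 + F 0 3 1 + F 0 1 3 + F 3 0 1 + F 1 0 3)
   + 6 * (F 2 2 0 + F 0 2 2 + F 2 0 2)
   + 4 * (F 2 1 1 + F 1 2 1 + F 1 1 2) \<ge> - 6 * real (i + j + k) ^ 3"
proof -
  define a b c where "a = real i" and "b = real j" and "c = real k"
  have f: "ffall 0 n = 1" "ffall 1 n = real n" "ffall 2 n = real n ^ 2 - real n"
    "ffall 3 n = real n ^ 3 - 3 * real n ^ 2 + 2 * real n"
    "ffall 4 n = real n ^ 4 - 6 * real n ^ 3 + 11 * real n ^ 2 - 6 * real n" for n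
    by (simp_all add: ffall_def eval_nat_numeral algebra_simps)
  have sq: "real n ^ 2 \<ge> real n" for n
    by (cases n) (auto simp: power2_eq_square)
  have nn: "a \<ge> 0" "b \<ge> 0" "c \<ge> 0" by (auto simp: a_def b_def c_def)
  have sqs: "a^2 \<ge> a" "b^2 \<ge> b" "c^2 \<ge> c" using sq by (auto simp: a_def b_def c_def)
  have m: "a^2 * b \<ge> a * b" "a^2 * c \<ge> a * c" "b^2 * a \<ge> a * b" "b^2 * c \<ge> b * c" "c^2 * a \<ge> a * c" "c^2 * b \<ge> b * c"
    using sqs nn mult_right_mono by (metis mult.commute)+
  have p: "a * b * c \<ge> 0" "a * b \<ge> 0" "b * c \<ge> 0" "a * c \<ge> 0" using nn by auto
  define S where "S = (a^2 + b^2 + c^2 - 2 * a * b - 2 * b * c - 2 * a * c)^2"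
  define L where "L = F 4 0 0 + F 0 4 0 + F 0 0 4
   - 4 * (F 3 1 0 + F 1 3 0 + F 0 3 1 + F 0 1 3 + F 3 0 1 + F 1 0 3)
   + 6 * (F 2 2 0 + F 0 2 2 + F 2 0 2)
   + 4 * (F 2 1 1 + F 1 2 1 + F 1 1 2)"
  define C where "C = (a + b + c) ^ 3"
  have "L + 6 * C = S
     + 11 * (a^2 + b^2 + c^2) - 6 * (a + b + c)
     + 24 * (a^2 * b + a^2 * c + b^2 * a + b^2 * c + c^2 * a + c^2 * b)
     - 10 * (a * b + b * c + a * c) + 24 * (a * b * c)"
    unfolding L_def S_def C_def F_def f a_def[symmetric] b_def[symmetric] c_def[symmetric]
    by (simp add: eval_nat_numeral algebra_simps)
  moreover have "S \<ge> 0" by (simp add: S_def)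
  \<comment> \<open>Stated for arbitrary reals, so that the nonlinear terms enter linear arithmetic
    as atoms.\<close>
  moreover have "11 * (x + y + z) - 6 * (u + v + w) \<ge> 0"
    if "x \<ge> u" "y \<ge> v" "z \<ge> w" "u \<ge> 0" "v \<ge> 0" "w \<ge> 0" for x y z u v w :: real
    using that by (simp add: algebra_simps)
  note this[OF sqs nn]
  moreover have "24 * (x1 + x2 + x3 + x4 + x5 + x6) - 10 * (u + w + v) \<ge> 0"
    if "x1 \<ge> u" "x2 \<ge> v" "x3 \<ge> u" "x4 \<ge> w" "x5 \<ge> v" "x6 \<ge> w" "u \<ge> 0" "v \<ge> 0" "w \<ge> 0"
    for u v w x1 x2 x3 x4 x5 x6 :: real
    using that by (simp add: algebra_simps)
  note this[OF m p(2) p(4) p(3)]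
  ultimately have "L + 6 * C \<ge> 0"
    using p(1) by linarith
  then show ?thesis by (simp add: L_def C_def a_def b_def c_def)
qed

section \<open>Signs of the derivatives and the contradiction for small exponents\<close>

lemma pos3_set: "(\<forall>i\<in>{0, 1, 2}. 0 < x i) \<longleftrightarrow> pos3 x"
  by (simp add: pos3_def)

lemma alternating_Dneg:
  assumes "alternating {0, 1, 2} F" "qspan r F" "i \<in> {0, 1, 2}"
  shows "alternating {0, 1, 2} (Dneg i F)"
proof (rule alternating_deriv[OF assms(1,3)])
  fix x :: "nat \<Rightarrow> real" assume "\<forall>i\<in>{0, 1, 2}. 0 < x i"
  then have "pos3 x" by (simp only: pos3_set)
  then show "((\<lambda>t. F (x(i := t))) has_real_derivative - Dneg i F x) (at (x i))"
    using qspan_deriv(1)[OF assms(2)] assms(3) less3 by blast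
qed

lemma alternating_pow_deriv:
  assumes "alternating {0, 1, 2} (qmono (\<lambda>_. 0) (- \<beta>))"
  shows "alternating {0, 1, 2} (pow_deriv \<beta> i j k)"
proof (induction i)
  case 0
  show ?case
  proof (induction j)
    case 0
    show ?case
    proof (induction k)
      case 0
      then show ?case using assms by (simp add: pow_deriv_def)
    next
      case (Suc k)
      from alternating_Dneg[OF Suc qspan_pow_deriv, of 2] show ?case unfolding Dneg_pow_deriv by simp
    qed
  next
    case (Suc j)
    from alternating_Dneg[OF Suc qspan_pow_deriv, of 1] show ?case unfolding Dneg_pow_deriv by simp
  qed
next
  case (Suc i)
  from alternating_Dneg[OF Suc qspan_pow_deriv, of 0] show ?case unfolding Dneg_pow_deriv by simp
qed

text \<open>By homogeneity \<open>D(\<partial>)\<^sup>2 e\<^sub>2\<^sup>-\<^sup>\<beta>\<close> at \<open>(1, 1, 1)\<close> is a positive multiple of a sum of nonnegative Taylor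
  coefficients of order \<open>n\<close>, weighted by \<open>D\<^sup>2\<close> with powers replaced by falling factorials. The weights
  are at least \<open>-6n\<^sup>3\<close>, while \<open>D\<^sup>2\<close> has degree 4, so the negative value is ruled out as \<open>n\<close> grows.\<close>

lemma esym2_powr_not_alternating:
  assumes b: "0 < \<beta>" "\<beta> < 1/2"
  shows "\<not> alternating {0, 1, 2} (\<lambda>x. esym2 x powr (- \<beta>))"
proof
  assume alt: "alternating {0, 1, 2} (\<lambda>x. esym2 x powr (- \<beta>))"
  have "alternating {0, 1, 2} (qmono (\<lambda>_. 0) (- \<beta>))"
  proof (rule alternating_cong[OF alt])
    fix x :: "nat \<Rightarrow> real" assume "\<forall>i\<in>{0, 1, 2}. 0 < x i"
    then have x: "pos3 x" by (simp only: pos3_set)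
    show "esym2 x powr - \<beta> = qmono (\<lambda>_. 0) (- \<beta>) x"
      using x esym2_pos[OF x] by (simp add: qmono_def powr_def)
  qed
  then have alt': "alternating {0, 1, 2} (pow_deriv \<beta> i j k)" for i j k
    by (rule alternating_pow_deriv)
  have c: "taylor_coeff \<beta> i j k \<ge> 0" for i j k
    unfolding taylor_coeff_def pow_deriv_one_def using alternating_nonneg[OF alt', of one3 i j k]
    by (simp add: one3_def)
  \<comment> \<open>\<open>S n\<close> is the sum of all Taylor coefficients of order n, the scale
    against which \<open>W n\<close> is measured.\<close>
  define W S where "W = heron_moment \<beta>" and "S = moment \<beta> 0 0 0"
  have S0: "S 0 > 0"
  proof -
    have "S 0 = pow_deriv \<beta> 0 0 0 one3" using moment_top[of \<beta> 0 0 0] by (simp add: S_def pow_deriv_one_def)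
    then show ?thesis using pos3_one3 by (simp add: pow_deriv_def qmono_def)
  qed
  have Sstep: "S (Suc n) = (2 * \<beta> + real n) / (real n + 1) * S n" for n
    using moment_step[of \<beta> n 0 0 0] by (simp add: S_def field_simps)
  have Spos: "S n > 0" for n
    by (induction n) (use S0 Sstep b in \<open>auto intro!: mult_pos_pos divide_pos_pos\<close>)
  \<comment> \<open>The recurrences multiply \<open>W\<close> by (2\<beta> + n)/(n - 3) and
    \<open>S\<close> by (2\<beta> + n)/(n + 1), so the quotient of \<open>W\<close> by
    \<open>S\<close> grows like n(n - 1)(n - 2)(n - 3), whose value at n = 4 is 24.\<close>
  have ratio: "W n * 24 * S 4 = W 4 * S n * (real n * (real n - 1) * (real n - 2) * (real n - 3))"
    if "n \<ge> 4" for n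
    using that
  proof (induction n rule: dec_induct)
    case base
    then show ?case by simp
  next
    case (step n)
    have n: "real n - 3 \<noteq> 0" using step.hyps by simp
    have "(real n - 3) * (W (Suc n) * 24 * S 4) = (2 * \<beta> + real n) * (W n * 24 * S 4)"
      using arg_cong[OF heron_moment_step[of \<beta> n], of "\<lambda>u. u * 24 * S 4"]
      by (simp only: W_def mult.assoc)
    also have "\<dots> = (2 * \<beta> + real n) * (W 4 * S n * (real n * (real n - 1) * (real n - 2) * (real n - 3)))"
      by (simp only: step.IH)
    also have "\<dots> = W 4 * ((2 * \<beta> + real n) * S n) * (real n * (real n - 1) * (real n - 2) * (real n - 3))"
      by (simp only: ac_simps)
    also have "(2 * \<beta> + real n) * S n = (real n + 1) * S (Suc n)"
      unfolding Sstep by (simp add: field_simps)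
    also have "W 4 * ((real n + 1) * S (Suc n)) * (real n * (real n - 1) * (real n - 2) * (real n - 3))
       = (real n - 3) * (W 4 * S (Suc n) * (real (Suc n) * (real (Suc n) - 1) * (real (Suc n) - 2) * (real (Suc n) - 3)))"
      by (simp add: algebra_simps)
    finally show ?case using n by simp
  qed
  \<comment> \<open>Nonnegativity of every Taylor coefficient allows the weights to be bounded below
    term by term.\<close>
  have bound: "W n \<ge> - 6 * real n ^ 3 * S n" for n
  proof -
    have "- 6 * real n ^ 3 * S n = (\<Sum>(i, j, k)\<in>triples n. - 6 * real (i + j + k) ^ 3 * taylor_coeff \<beta> i j k)"
      unfolding S_def moment_def sum_distrib_left
      by (rule sum.cong) (auto simp: triples_def ffall_def)
    also have "\<dots> \<le> (\<Sum>(i, j, k)\<in>triples n. (let F = \<lambda>p q r. ffall p i * ffall q j * ffall r k in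
      F 4 0 0 + F 0 4 0 + F 0 0 4
   - 4 * (F 3 1 0 + F 1 3 0 + F 0 3 1 + F 0 1 3 + F 3 0 1 + F 1 0 3)
   + 6 * (F 2 2 0 + F 0 2 2 + F 2 0 2)
   + 4 * (F 2 1 1 + F 1 2 1 + F 1 1 2)) * taylor_coeff \<beta> i j k)"
      unfolding case_prod_unfold
      by (intro sum_mono mult_right_mono c) (use heron_weight_bound in \<open>simp only: Let_def\<close>)
    also have "\<dots> = W n"
      unfolding W_def heron_moment_def moment_def Let_def case_prod_unfold
      by (simp only: sum.distrib sum_subtractf sum_distrib_left distrib_left distrib_right left_diff_distrib right_diff_distrib mult.assoc)
    finally show ?thesis .
  qed
  \<comment> \<open>The positivity of this constant is where \<beta> < 1/2 is used.\<close>
  define K where "K = - W 4"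
  have K: "K > 0"
    unfolding K_def W_def heron_moment_4 using b pos3_one3
    by (auto simp: qmono_def intro!: mult_pos_pos)
  \<comment> \<open>For n \<ge> 6 each of n - 1, n - 2, n - 3 is at least n/2, so the estimates
    reduce to K n^3 / 8 \<le> 144 n^2 S 4. Here 144 = 6 * 24 and 1152 = 8 * 144.\<close>
  obtain n where n: "real n > 1152 * S 4 / K" "n \<ge> 6"
  proof -
    obtain m where "real m > 1152 * S 4 / K" using reals_Archimedean2 by blast
    then have "real (m + 6) > 1152 * S 4 / K" by simp
    then show ?thesis using that[of "m + 6"] by simp
  qed
  have n': "real n \<ge> 6" using n(2) by simp
  have "- 6 * real n ^ 3 * S n * (24 * S 4) \<le> W n * (24 * S 4)"
    using bound Spos[of 4] by (intro mult_right_mono) auto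
  also have "\<dots> = - K * S n * (real n * (real n - 1) * (real n - 2) * (real n - 3))"
    using ratio[of n] n(2) by (simp add: K_def mult.assoc)
  finally have "K * S n * (real n * (real n - 1) * (real n - 2) * (real n - 3)) \<le> 144 * real n ^ 3 * S n * S 4"
    by simp
  then have "(S n * real n) * (K * ((real n - 1) * (real n - 2) * (real n - 3))) \<le> (S n * real n) * (144 * real n ^ 2 * S 4)"
    by (simp add: algebra_simps power2_eq_square power3_eq_cube)
  then have 1: "K * ((real n - 1) * (real n - 2) * (real n - 3)) \<le> 144 * real n ^ 2 * S 4"
    using Spos[of n] n' by (simp only: mult_le_cancel_left_pos mult_pos_pos)
  have "(real n / 2) * (real n / 2) * (real n / 2) \<le> (real n - 1) * (real n - 2) * (real n - 3)"
    using n' by (intro mult_mono) auto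
  then have "K * ((real n / 2) * (real n / 2) * (real n / 2)) \<le> 144 * real n ^ 2 * S 4"
    using 1 K by (meson mult_left_mono order_less_imp_le order_trans)
  then have "(real n)\<^sup>2 * (K * real n) \<le> (real n)\<^sup>2 * (1152 * S 4)"
    by (simp add: algebra_simps power2_eq_square)
  then have "K * real n \<le> 1152 * S 4"
    using n' by (simp add: mult_le_cancel_left)
  then show False using n(1) K by (simp add: field_simps)
qed

section \<open>Completely monotone functions on the orthant\<close>

lemma pos_orthant_upd: "x \<in> pos_orthant E \<Longrightarrow> e \<in> E \<Longrightarrow> t > 0 \<Longrightarrow> x(e := t) \<in> pos_orthant E"
  by (auto simp: pos_orthant_def PiE_def extensional_def)

lemma pos_orthantD: "x \<in> pos_orthant E \<Longrightarrow> e \<in> E \<Longrightarrow> 0 < x e"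
  by (auto simp: pos_orthant_def)

text \<open>\<open>\<phi> es\<close> stands for the signed derivative along \<open>es\<close>. The
  induction on \<open>ds\<close> treats all \<open>es\<close> at once: the differences of
  \<open>\<phi> es\<close> are nonincreasing in coordinate i because their derivative is minus the
  same differences of \<open>\<phi> (i # es)\<close>. The derivative rule is carried along to make
  this step available again.\<close>

lemma neg_diffs_family_nonneg:
  fixes \<phi> :: "'e list \<Rightarrow> ('e \<Rightarrow> real) \<Rightarrow> real"
  assumes nonneg: "\<And>es x. es \<in> lists E \<Longrightarrow> x \<in> pos_orthant E \<Longrightarrow> 0 \<le> \<phi> es x"
    and deriv: "\<And>es e x. es \<in> lists E \<Longrightarrow> e \<in> E \<Longrightarrow> x \<in> pos_orthant E \<Longrightarrow>
      ((\<lambda>t. \<phi> es (x(e := t))) has_real_derivative - \<phi> (e # es) x) (at (x e))"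
    and "ds \<in> lists (E \<times> {0<..})" "es \<in> lists E" "x \<in> pos_orthant E"
  shows "0 \<le> foldr neg_diff ds (\<phi> es) x"
    and "e \<in> E \<Longrightarrow> ((\<lambda>t. foldr neg_diff ds (\<phi> es) (x(e := t)))
      has_real_derivative - foldr neg_diff ds (\<phi> (e # es)) x) (at (x e))"
proof -
  have "0 \<le> foldr neg_diff ds (\<phi> es) x \<and>
    (\<forall>e\<in>E. ((\<lambda>t. foldr neg_diff ds (\<phi> es) (x(e := t)))
      has_real_derivative - foldr neg_diff ds (\<phi> (e # es)) x) (at (x e)))"
    using assms(3-5)
  proof (induction ds arbitrary: es x rule: list.induct)
    case Nil
    then show ?case using nonneg deriv by (simp del: fun_upd_apply)
  next
    case (Cons d ds)
    obtain i h where d: "d = (i, h)" by (cases d)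
    have ih: "i \<in> E" "h > 0" "ds \<in> lists (E \<times> {0<..})" using Cons.prems(1) d by auto
    define F where "F = foldr neg_diff ds (\<phi> es)"
    define G where "G = (\<lambda>e. foldr neg_diff ds (\<phi> (e # es)))"
    have FG: "((\<lambda>t. F (y(e := t))) has_real_derivative - G e y) (at (y e))"
      and G0: "0 \<le> G e y" if "y \<in> pos_orthant E" "e \<in> E" for y e
      using Cons.IH[OF ih(3), of es y] Cons.IH[OF ih(3), of "e # es" y] Cons.prems that
      by (simp_all add: F_def G_def del: fun_upd_apply)
    define y where "y = x(i := x i + h)"
    have xi: "x i > 0" using Cons.prems(3) ih(1) by (rule pos_orthantD)
    have y: "y \<in> pos_orthant E"
      unfolding y_def using Cons.prems ih xi by (intro pos_orthant_upd) auto
    have "F (x(i := x i + h)) \<le> F (x(i := x i))"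
    proof (rule DERIV_nonpos_imp_nonincreasing[where f = "\<lambda>t. F (x(i := t))"])
      fix t assume t: "x i \<le> t"
      have z: "x(i := t) \<in> pos_orthant E"
        using Cons.prems ih xi t by (intro pos_orthant_upd) auto
      show "\<exists>l. ((\<lambda>t. F (x(i := t))) has_real_derivative l) (at t) \<and> l \<le> 0"
        using FG[OF z ih(1)] G0[OF z ih(1)] by (intro exI[of _ "- G i (x(i := t))"]) simp
    qed (use ih in simp)
    then have 1: "0 \<le> foldr neg_diff (d # ds) (\<phi> es) x"
      by (simp add: neg_diff_def d F_def)
    have 2: "((\<lambda>t. foldr neg_diff (d # ds) (\<phi> es) (x(e := t)))
      has_real_derivative - foldr neg_diff (d # ds) (\<phi> (e # es)) x) (at (x e))" if e: "e \<in> E" for e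
    proof -
      have "((\<lambda>t. F ((x(e := t))(i := (x(e := t)) i + h))) has_real_derivative - G e y) (at (x e))"
      \<comment> \<open>In the stepped coordinate the step is a translation of t; in any other
        coordinate it only moves the base point.\<close>
      proof (cases "e = i")
        case True
        have "((\<lambda>t. F (y(i := t))) has_real_derivative - G i y) (at (x i + h))"
          using FG[OF y ih(1)] by (simp add: y_def)
        then have "((\<lambda>t. F (y(i := t + h))) has_real_derivative - G i y) (at (x i))"
          by (simp add: DERIV_shift)
        then show ?thesis using True by (simp add: y_def)
      next
        case False
        have "(\<lambda>t. F ((x(e := t))(i := (x(e := t)) i + h))) = (\<lambda>t. F (y(e := t)))"
          using False by (simp add: y_def fun_upd_twist)
        moreover have "y e = x e" using False by (simp add: y_def)
        ultimately show ?thesis using FG[OF y e] by simp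
      qed
      from DERIV_diff[OF FG[OF Cons.prems(3) e] this]
      show ?thesis by (simp add: neg_diff_def d F_def G_def y_def)
    qed
    show ?case using 1 2 by blast
  qed
  then show "0 \<le> foldr neg_diff ds (\<phi> es) x"
    and "e \<in> E \<Longrightarrow> ((\<lambda>t. foldr neg_diff ds (\<phi> es) (x(e := t)))
      has_real_derivative - foldr neg_diff ds (\<phi> (e # es)) x) (at (x e))"
    by auto
qed

lemma completely_monotone_neg_diffs:
  assumes "completely_monotone E f" "ds \<in> lists (E \<times> {0<..})" "x \<in> pos_orthant E"
  shows "0 \<le> foldr neg_diff ds f x"
proof -
  define \<phi> where "\<phi> = (\<lambda>es x. (-1) ^ length es * iterated_partial_deriv es f x)"
  have "0 \<le> foldr neg_diff ds (\<phi> []) x"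
  proof (rule neg_diffs_family_nonneg(1)[of E])
    fix es x assume "es \<in> lists E" "x \<in> pos_orthant E"
    then show "0 \<le> \<phi> es x" using assms(1) by (simp add: completely_monotone_def \<phi>_def)
  next
    fix es e x assume *: "es \<in> lists E" "e \<in> E" "x \<in> pos_orthant E"
    then have "(\<lambda>t. iterated_partial_deriv es f (x(e := t))) field_differentiable at (x e)"
      using assms(1) by (simp add: completely_monotone_def smooth_on_orthant_def)
    then have "((\<lambda>t. iterated_partial_deriv es f (x(e := t))) has_real_derivative
        iterated_partial_deriv (e # es) f x) (at (x e))"
      by (simp add: iterated_partial_deriv_def partial_deriv_def DERIV_deriv_iff_field_differentiable)
    from DERIV_cmult[OF this, of "(-1) ^ length es"]
    show "((\<lambda>t. \<phi> es (x(e := t))) has_real_derivative - \<phi> (e # es) x) (at (x e))"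
      by (simp add: \<phi>_def)
  qed (use assms in auto)
  then show ?thesis by (simp add: \<phi>_def iterated_partial_deriv_def)
qed

text \<open>If a class of nonnegative continuous functions is stable under minus each partial
  derivative, then every iterated derivative of \<open>f\<close> is, up to sign, a member of it.
  Agreement on the orthant suffices, since the orthant meets a coordinate line through one of its
  points in an open half-line; \<open>near\<close> makes this precise.\<close>

lemma completely_monotoneI:
  assumes P: "P F" and f: "\<And>x. x \<in> pos_orthant E \<Longrightarrow> f x = F x"
    and nonneg: "\<And>G x. P G \<Longrightarrow> x \<in> pos_orthant E \<Longrightarrow> 0 \<le> G x"
    and cont: "\<And>G. P G \<Longrightarrow> continuous_on (pos_orthant E) G"
    and deriv: "\<And>G e. P G \<Longrightarrow> e \<in> E \<Longrightarrow> \<exists>H. P H \<and>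
      (\<forall>x\<in>pos_orthant E. ((\<lambda>t. G (x(e := t))) has_real_derivative - H x) (at (x e)))"
  shows "completely_monotone E f"
proof -
  have near: "((\<lambda>t. g (x(e := t))) has_real_derivative c * - H x) (at (x e))"
    if "\<And>x. x \<in> pos_orthant E \<Longrightarrow> g x = c * G x" "x \<in> pos_orthant E" "e \<in> E"
      "((\<lambda>t. G (x(e := t))) has_real_derivative - H x) (at (x e))" for g G H c e x
  proof (rule DERIV_cong_ev[OF refl _ refl, THEN iffD1, OF _ DERIV_cmult[OF that(4), of c]])
    have "eventually (\<lambda>t. t \<in> {0<..}) (nhds (x e))"
      using pos_orthantD[OF that(2,3)] by (intro eventually_nhds_in_open) auto
    then show "eventually (\<lambda>t. c * G (x(e := t)) = g (x(e := t))) (nhds (x e))"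
      by eventually_elim (use that pos_orthant_upd in force)
  qed
  have ex: "\<exists>G. P G \<and> (\<forall>x\<in>pos_orthant E. iterated_partial_deriv es f x = (-1) ^ length es * G x)"
    if "es \<in> lists E" for es
    using that
  proof (induction es rule: list.induct)
    case Nil
    then show ?case using P f by (auto simp: iterated_partial_deriv_def)
  next
    case (Cons e es)
    then obtain G where G: "P G" "\<And>x. x \<in> pos_orthant E \<Longrightarrow> iterated_partial_deriv es f x = (-1) ^ length es * G x"
      by auto
    have e: "e \<in> E" using Cons.prems by simp
    obtain H where H: "P H"
      "\<And>x. x \<in> pos_orthant E \<Longrightarrow> ((\<lambda>t. G (x(e := t))) has_real_derivative - H x) (at (x e))"
      using deriv[OF G(1) e] by blast
    have "iterated_partial_deriv (e # es) f x = (-1) ^ length (e # es) * H x" if "x \<in> pos_orthant E" for x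
      using DERIV_imp_deriv[OF near[where g = "iterated_partial_deriv es f" and G = G and H = H and c = "(-1) ^ length es", OF G(2) that e H(2)[OF that]]]
      by (simp add: iterated_partial_deriv_def partial_deriv_def)
    then show ?case using H(1) by blast
  qed
  show ?thesis
    unfolding completely_monotone_def smooth_on_orthant_def
  proof (intro conjI ballI)
    fix es assume es: "es \<in> lists E"
    obtain G where G: "P G" "\<And>x. x \<in> pos_orthant E \<Longrightarrow> iterated_partial_deriv es f x = (-1) ^ length es * G x"
      using ex[OF es] by blast
    show "continuous_on (pos_orthant E) (iterated_partial_deriv es f)"
      by (subst continuous_on_cong[OF refl G(2)]) (auto intro: continuous_on_mult_left[OF cont[OF G(1)]])
    fix x assume x: "x \<in> pos_orthant E"
    show "0 \<le> (-1) ^ length es * iterated_partial_deriv es f x"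
      using G(2)[OF x] nonneg[OF G(1) x] by (simp flip: mult.assoc power_add)
    fix e assume e: "e \<in> E"
    obtain H where H: "P H"
      "\<And>x. x \<in> pos_orthant E \<Longrightarrow> ((\<lambda>t. G (x(e := t))) has_real_derivative - H x) (at (x e))"
      using deriv[OF G(1) e] by blast
    show "(\<lambda>t. iterated_partial_deriv es f (x(e := t))) field_differentiable at (x e)"
      using near[where g = "iterated_partial_deriv es f" and G = G and H = H and c = "(-1) ^ length es", OF G(2) x e H(2)[OF x]] unfolding field_differentiable_def by blast
  qed
qed

section \<open>Products of negative powers of linear forms\<close>

context
  fixes E :: "'e set" and J :: "'j set" and C :: "'j \<Rightarrow> 'e set"
  assumes fin: "finite E" "finite J" and C: "\<And>j. j \<in> J \<Longrightarrow> C j \<subseteq> E \<and> C j \<noteq> {}"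
begin

text \<open>The product over j of the linear forms \<open>\<Sum>e\<in>C j. x e\<close>, each to the
  power \<open>- s j\<close>.\<close>

definition lin_power :: "('j \<Rightarrow> real) \<Rightarrow> ('e \<Rightarrow> real) \<Rightarrow> real" where
  "lin_power s x = exp (- (\<Sum>j\<in>J. s j * ln (\<Sum>e\<in>C j. x e)))"

text \<open>Minus a derivative raises one exponent \<open>s k\<close> by one and multiplies by
  \<open>s k\<close>, so nonnegative coefficients and exponents are preserved.\<close>

inductive lin_cone :: "(('e \<Rightarrow> real) \<Rightarrow> real) \<Rightarrow> bool" where
  power: "0 \<le> c \<Longrightarrow> (\<And>j. 0 \<le> s j) \<Longrightarrow> lin_cone (\<lambda>x. c * lin_power s x)"
| add: "lin_cone F \<Longrightarrow> lin_cone G \<Longrightarrow> lin_cone (\<lambda>x. F x + G x)"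

lemma lin_pos: "j \<in> J \<Longrightarrow> x \<in> pos_orthant E \<Longrightarrow> 0 < (\<Sum>e\<in>C j. x e)"
  using C[of j] fin by (intro sum_pos) (auto dest: finite_subset intro: pos_orthantD)

lemma lin_cone_sum: "finite K \<Longrightarrow> (\<And>k. k \<in> K \<Longrightarrow> lin_cone (F k)) \<Longrightarrow> lin_cone (\<lambda>x. \<Sum>k\<in>K. F k x)"
proof (induction K rule: finite_induct)
  case empty
  then show ?case using power[of 0 "\<lambda>_. 0"] by simp
next
  case (insert k K)
  then show ?case by (simp add: lin_cone.add)
qed

lemma lin_cone_nonneg: "lin_cone F \<Longrightarrow> 0 \<le> F x"
  by (induction rule: lin_cone.induct) (auto simp: lin_power_def)

lemma lin_cone_continuous: "lin_cone F \<Longrightarrow> continuous_on (pos_orthant E) F"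
proof (induction rule: lin_cone.induct)
  case (power c s)
  have "continuous_on (pos_orthant E) (\<lambda>x. x e)" for e
    by (rule continuous_on_subset[OF continuous_on_product_coordinates]) simp
  then show ?case unfolding lin_power_def
    by (intro continuous_intros) (use lin_pos in fastforce)+
qed (auto intro: continuous_intros)

lemma lin_power_deriv:
  assumes x: "x \<in> pos_orthant E" and e: "e \<in> E"
  shows "((\<lambda>t. lin_power s (x(e := t))) has_real_derivative
    - (\<Sum>k\<in>{k \<in> J. e \<in> C k}. s k * lin_power (s(k := s k + 1)) x)) (at (x e))"
proof -
  have lin: "((\<lambda>t. \<Sum>f\<in>C j. (x(e := t)) f) has_real_derivative (if e \<in> C j then 1 else 0)) (at (x e))"
    if "j \<in> J" for j
  proof -
    have finC: "finite (C j)" using C[OF that] fin by (auto dest: finite_subset)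
    have "((\<lambda>t. (x(e := t)) f) has_real_derivative (if f = e then 1 else 0)) (at (x e))" for f
      by (cases "f = e") auto
    then have "((\<lambda>t. \<Sum>f\<in>C j. (x(e := t)) f) has_real_derivative (\<Sum>f\<in>C j. if f = e then 1 else 0)) (at (x e))"
      by (intro DERIV_sum)
    then show ?thesis
      using finC by (simp add: sum.delta del: fun_upd_apply)
  qed
  have lg: "((\<lambda>t. \<Sum>j\<in>J. s j * ln (\<Sum>f\<in>C j. (x(e := t)) f)) has_real_derivative
    (\<Sum>j\<in>J. s j * ((if e \<in> C j then 1 else 0) / (\<Sum>f\<in>C j. x f)))) (at (x e))"
  proof (intro DERIV_sum DERIV_cmult)
    fix j assume j: "j \<in> J"
    from DERIV_chain2[OF DERIV_ln_divide lin[OF j]] lin_pos[OF j x]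
    show "((\<lambda>t. ln (\<Sum>f\<in>C j. (x(e := t)) f)) has_real_derivative
      ((if e \<in> C j then 1 else 0) / (\<Sum>f\<in>C j. x f))) (at (x e))" by simp
  qed
  have shift: "lin_power (s(k := s k + 1)) x = lin_power s x / (\<Sum>f\<in>C k. x f)" if "k \<in> J" for k
  proof -
    have "(\<Sum>j\<in>J. (s(k := s k + 1)) j * ln (\<Sum>f\<in>C j. x f))
      = (\<Sum>j\<in>J. s j * ln (\<Sum>f\<in>C j. x f) + (if j = k then ln (\<Sum>f\<in>C k. x f) else 0))"
      by (rule sum.cong) (auto simp: algebra_simps)
    also have "\<dots> = (\<Sum>j\<in>J. s j * ln (\<Sum>f\<in>C j. x f)) + ln (\<Sum>f\<in>C k. x f)"
      using that fin by (simp add: sum.distrib)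
    finally show ?thesis
      using lin_pos[OF that x] by (simp add: lin_power_def exp_diff)
  qed
  have "(\<Sum>k\<in>{k \<in> J. e \<in> C k}. s k * lin_power (s(k := s k + 1)) x)
    = lin_power s x * (\<Sum>j\<in>J. s j * ((if e \<in> C j then 1 else 0) / (\<Sum>f\<in>C j. x f)))"
    unfolding sum_distrib_left using fin
    by (intro sum.mono_neutral_cong_left) (auto simp: shift)
  then show ?thesis
    using DERIV_fun_exp[OF DERIV_minus[OF lg]] by (simp add: lin_power_def)
qed

lemma lin_cone_deriv:
  assumes "lin_cone F" "e \<in> E"
  shows "\<exists>G. lin_cone G \<and>
    (\<forall>x\<in>pos_orthant E. ((\<lambda>t. F (x(e := t))) has_real_derivative - G x) (at (x e)))"
  using assms
proof (induction rule: lin_cone.induct)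
  case (power c s)
  let ?G = "\<lambda>x. \<Sum>k\<in>{k \<in> J. e \<in> C k}. (c * s k) * lin_power (s(k := s k + 1)) x"
  have "lin_cone ?G"
    using power fin by (intro lin_cone_sum lin_cone.power) (auto simp: add_nonneg_nonneg)
  moreover have "((\<lambda>t. c * lin_power s (x(e := t))) has_real_derivative - ?G x) (at (x e))"
    if "x \<in> pos_orthant E" for x
    using DERIV_cmult[OF lin_power_deriv[OF that power(3)], of c s]
    by (simp add: sum_distrib_left mult.assoc)
  ultimately show ?case by blast
next
  case (add F1 F2)
  then obtain G1 G2 where G: "lin_cone G1" "lin_cone G2"
    "\<And>x. x \<in> pos_orthant E \<Longrightarrow> ((\<lambda>t. F1 (x(e := t))) has_real_derivative - G1 x) (at (x e))"
    "\<And>x. x \<in> pos_orthant E \<Longrightarrow> ((\<lambda>t. F2 (x(e := t))) has_real_derivative - G2 x) (at (x e))"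
    by blast
  have "((\<lambda>t. F1 (x(e := t)) + F2 (x(e := t))) has_real_derivative - (G1 x + G2 x)) (at (x e))"
    if "x \<in> pos_orthant E" for x
    using DERIV_add[OF G(3,4)[OF that]] by simp
  with lin_cone.add[OF G(1,2)] show ?case by (intro exI[of _ "\<lambda>x. G1 x + G2 x"]) blast
qed

lemma completely_monotone_lin_power:
  assumes "0 < \<beta>" and f: "\<And>x. x \<in> pos_orthant E \<Longrightarrow> f x = (\<Prod>j\<in>J. \<Sum>e\<in>C j. x e)"
  shows "completely_monotone E (\<lambda>x. f x powr - \<beta>)"
proof (rule completely_monotoneI[where P = lin_cone and F = "\<lambda>x. 1 * lin_power (\<lambda>_. \<beta>) x"])
  fix x assume x: "x \<in> pos_orthant E"
  have "f x > 0" unfolding f[OF x] using lin_pos x by (intro prod_pos) auto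
  moreover have "ln (f x) = (\<Sum>j\<in>J. ln (\<Sum>e\<in>C j. x e))"
    unfolding f[OF x] using lin_pos[OF _ x] fin by (intro ln_prod) force+
  ultimately show "f x powr - \<beta> = 1 * lin_power (\<lambda>_. \<beta>) x"
    by (simp add: powr_def lin_power_def sum_distrib_left sum_negf)
next
  show "lin_cone (\<lambda>x. 1 * lin_power (\<lambda>_. \<beta>) x)"
    using assms(1) by (intro lin_cone.power) auto
qed (use lin_cone_nonneg lin_cone_continuous lin_cone_deriv in auto)

end

section \<open>Spanning trees as minimal connecting sets\<close>

text \<open>The set V is a parameter: minimal connecting sets are spanning trees when V is the
  vertex set, and paths when V = {u, v}.\<close>

definition connects :: "('e \<Rightarrow> 'v set) \<Rightarrow> 'v set \<Rightarrow> 'e set \<Rightarrow> bool" where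
  "connects w V A \<longleftrightarrow> (\<forall>x\<in>V. \<forall>y\<in>V. (x, y) \<in> reach w A)"

definition min_connecting :: "('e \<Rightarrow> 'v set) \<Rightarrow> 'v set \<Rightarrow> 'e set \<Rightarrow> bool" where
  "min_connecting w V A \<longleftrightarrow> connects w V A \<and> (\<forall>e\<in>A. \<not> connects w V (A - {e}))"

lemma connects_mono: "connects w V A \<Longrightarrow> A \<subseteq> B \<Longrightarrow> connects w V B"
  unfolding connects_def using reach_mono by metis

text \<open>Each edge of a walk in \<open>A\<close> may be replaced by a walk in
  \<open>B\<close>.\<close>

lemma connectsI_reach:
  assumes "connects w V A" and "\<And>e p q. e \<in> A \<Longrightarrow> w e = {p, q} \<Longrightarrow> (p, q) \<in> reach w B"
  shows "connects w V B"
proof -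
  have "adj w A \<subseteq> reach w B" using assms(2) by (auto simp: adj_def)
  then have "reach w A \<subseteq> reach w B" by (rule rtrancl_subset_rtrancl)
  then show ?thesis using assms(1) by (auto simp: connects_def)
qed

lemma connects_delete:
  assumes "connects w V A" "w e = {p, q}" "(p, q) \<in> reach w (A - {e})"
  shows "connects w V (A - {e})"
proof (rule connectsI_reach[OF assms(1)])
  fix f p' q' assume f: "f \<in> A" "w f = {p', q'}"
  show "(p', q') \<in> reach w (A - {e})"
  proof (cases "f = e")
    case True
    then show ?thesis using assms(2,3) f reach_sym by (metis doubleton_eq_iff)
  next
    case False
    then show ?thesis using f by (intro reach_edge) auto
  qed
qed

lemma min_connecting_antichain:
  assumes "min_connecting w V A" "min_connecting w V B" "A \<subseteq> B"
  shows "A = B"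
proof (rule ccontr)
  assume "A \<noteq> B"
  then obtain e where "e \<in> B" "A \<subseteq> B - {e}" using assms(3) by blast
  then show False using assms(1,2) connects_mono by (metis min_connecting_def)
qed

lemma min_connecting_exists:
  assumes "finite A" "connects w V A"
  shows "\<exists>B\<subseteq>A. min_connecting w V B"
  using assms
proof (induction A rule: finite_psubset_induct)
  case (psubset A)
  show ?case
  proof (cases "\<exists>e\<in>A. connects w V (A - {e})")
    case True
    then obtain e where "e \<in> A" "connects w V (A - {e})" by blast
    then show ?thesis using psubset.IH[of "A - {e}"] by blast
  next
    case False
    then show ?thesis using psubset.prems by (auto simp: min_connecting_def)
  qed
qed

text \<open>For a connecting edge set, acyclicity says exactly that no edge is redundant.\<close>

lemma spanning_trees_iff:
  assumes H: "multigraph H" "verts H \<noteq> {}"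
  shows "T \<in> spanning_trees H \<longleftrightarrow> T \<subseteq> edges H \<and> min_connecting (ends H) (verts H) T"
proof (cases "T \<subseteq> edges H")
  case True
  let ?w = "ends H" and ?V = "verts H"
  have conn: "graph_connected (H\<lparr>edges := T\<rparr>) \<longleftrightarrow> connects ?w ?V T"
    using H(2) by (simp add: graph_connected_def connects_def adjacency_eq)
  have "is_forest (H\<lparr>edges := T\<rparr>) \<longleftrightarrow>
     (\<forall>e\<in>T. \<forall>p q. ?w e = {p, q} \<longrightarrow> (p, q) \<notin> reach ?w (T - {e}))"
    using multigraph_update_edges[OF H(1) True] acyclic_iff[of "H\<lparr>edges := T\<rparr>"]
    by (simp add: is_forest_def)
  moreover have "(\<forall>p q. ?w e = {p, q} \<longrightarrow> (p, q) \<notin> reach ?w (T - {e})) \<longleftrightarrow> \<not> connects ?w ?V (T - {e})"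
    if c: "connects ?w ?V T" and e: "e \<in> T" for e
  proof -
    obtain p q where pq: "?w e = {p, q}" "p \<in> ?V" "q \<in> ?V"
      using multigraph_endsE[OF H(1), of e] True e by blast
    show ?thesis
      using connects_delete[OF c] pq unfolding connects_def by metis
  qed
  ultimately show ?thesis
    using True conn by (auto simp: spanning_trees_def is_tree_def min_connecting_def)
qed (simp add: spanning_trees_def)

text \<open>Every class of parallel non-loops is a cut, because the other edges do not join its
  ends. So a spanning tree meets each class, by minimality in one edge only, and contains no loop.
  Conversely, one edge per class still connects. Spanning trees are therefore the choice functions,
  and the sum over these factors.\<close>

lemma tree_like_spanning_tree_sum:
  assumes H: "multigraph H" "graph_connected H" and tl: "tree_like (adjacency H)"
  shows "spanning_tree_sum H x =
    (\<Prod>s\<in>ends H ` {e \<in> edges H. card (ends H e) = 2}. \<Sum>e\<in>{e \<in> edges H. ends H e = s}. x e)"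
proof -
  let ?w = "ends H" and ?V = "verts H"
  define J where "J = ?w ` {e \<in> edges H. card (?w e) = 2}"
  define C where "C = (\<lambda>s. {e \<in> edges H. ?w e = s})"
  have fin: "finite (edges H)" "finite J" "\<And>s. finite (C s)" using H(1) by (auto simp: J_def C_def multigraph_def)
  have V: "?V \<noteq> {}" using H(2) by (simp add: graph_connected_def)
  have conn: "connects ?w ?V (edges H)" using H(2) by (simp add: graph_connected_def connects_def adjacency_eq)
  have J: "\<exists>u v. s = {u, v} \<and> u \<noteq> v \<and> u \<in> ?V \<and> v \<in> ?V \<and>
      (u, v) \<notin> reach ?w {f \<in> edges H. ?w f \<noteq> s}" if s: "s \<in> J" for s
  proof -
    obtain e where e: "e \<in> edges H" "?w e = s" "card s = 2" using s by (auto simp: J_def)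
    obtain u v where uv: "s = {u, v}" "u \<in> ?V" "v \<in> ?V" using multigraph_endsE[OF H(1) e(1)] e(2) by metis
    have "u \<noteq> v" using e(3) uv(1) by auto
    moreover have "(u, v) \<in> adjacency H" using e uv by (auto simp: adjacency_def)
    ultimately have "(u, v) \<notin> reach ?w {f \<in> edges H. ?w f \<noteq> {u, v}}"
      using tree_likeD[OF tl] unfolding adj_Diff_class adjacency_eq by blast
    then show ?thesis using uv \<open>u \<noteq> v\<close> by blast
  qed
  have ends_J: "?w e \<in> J" if "e \<in> edges H" "?w e = {p, q}" "p \<noteq> q" for e p q
    using that by (auto simp: J_def)
  have mem: "T \<in> spanning_trees H \<longleftrightarrow> T \<subseteq> edges H \<and> min_connecting ?w ?V T" for T
    by (rule spanning_trees_iff[OF H(1) V])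
  have ex: "\<exists>e\<in>T. ?w e = s" if T: "T \<in> spanning_trees H" and s: "s \<in> J" for T s
  proof (rule ccontr)
    assume "\<not> ?thesis"
    then have "T \<subseteq> {f \<in> edges H. ?w f \<noteq> s}" using T by (auto simp: mem)
    moreover have "connects ?w ?V T" using T by (simp add: mem min_connecting_def)
    ultimately have "connects ?w ?V {f \<in> edges H. ?w f \<noteq> s}" using connects_mono by blast
    then show False using J[OF s] unfolding connects_def by blast
  qed
  have uniq: "e = f" if T: "T \<in> spanning_trees H" and ef: "e \<in> T" "f \<in> T" "?w e = ?w f" for T e f
  proof (rule ccontr)
    assume ne: "e \<noteq> f"
    have Tm: "T \<subseteq> edges H" "min_connecting ?w ?V T" using T by (auto simp: mem)
    have eH: "e \<in> edges H" using Tm(1) ef(1) by (rule subsetD)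
    obtain p q where pq: "?w e = {p, q}" using multigraph_endsE[OF H(1) eH] by metis
    have "(p, q) \<in> reach ?w (T - {e})" using ne ef pq by (intro reach_edge[of f]) auto
    then show False using Tm(2) ef(1) connects_delete[where w = ?w and V = ?V and A = T, OF _ pq] \<open>(p, q) \<in> reach ?w (T - {e})\<close> unfolding min_connecting_def by blast
  qed
  have nonloop: "?w e \<in> J" if T: "T \<in> spanning_trees H" and e: "e \<in> T" for T e
  proof -
    have Tm: "T \<subseteq> edges H" "min_connecting ?w ?V T" using T by (auto simp: mem)
    have eH: "e \<in> edges H" using Tm(1) e by (rule subsetD)
    obtain p q where pq: "?w e = {p, q}" using multigraph_endsE[OF H(1) eH] by metis
    have "p \<noteq> q"
    proof
      assume "p = q"
      then have "(p, q) \<in> reach ?w (T - {e})" by simp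
      then show False using Tm(2) e connects_delete[where w = ?w and V = ?V and A = T, OF _ pq] \<open>(p, q) \<in> reach ?w (T - {e})\<close> unfolding min_connecting_def by blast
    qed
    then show ?thesis using ends_J[OF eH pq] by simp
  qed
  have image: "\<phi> ` J \<in> spanning_trees H" if \<phi>: "\<phi> \<in> PiE J C" for \<phi>
    unfolding mem min_connecting_def
  proof (intro conjI ballI)
    have \<phi>': "\<phi> s \<in> edges H" "?w (\<phi> s) = s" if "s \<in> J" for s
      using PiE_mem[OF \<phi> that] by (auto simp: C_def)
    show "\<phi> ` J \<subseteq> edges H" using \<phi>' by auto
    show "connects ?w ?V (\<phi> ` J)"
    proof (rule connectsI_reach[OF conn])
      fix e p q assume e: "e \<in> edges H" "?w e = {p, q}"
      show "(p, q) \<in> reach ?w (\<phi> ` J)"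
      proof (cases "p = q")
        case False
        then have "{p, q} \<in> J" using ends_J[OF e] e(2) by simp
        then show ?thesis using \<phi>' by (intro reach_edge[of "\<phi> {p, q}"]) auto
      qed simp
    qed
    fix e assume "e \<in> \<phi> ` J"
    then obtain s where s: "s \<in> J" "e = \<phi> s" by blast
    have sub: "\<phi> ` J - {e} \<subseteq> {f \<in> edges H. ?w f \<noteq> s}" using \<phi>' s by auto
    show "\<not> connects ?w ?V (\<phi> ` J - {e})"
    proof
      assume "connects ?w ?V (\<phi> ` J - {e})"
      then have "connects ?w ?V {f \<in> edges H. ?w f \<noteq> s}" using sub by (rule connects_mono)
      then show False using J[OF s(1)] unfolding connects_def by blast
    qed
  qed
  have "spanning_tree_sum H x = (\<Sum>\<phi>\<in>PiE J C. \<Prod>s\<in>J. x (\<phi> s))"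
    unfolding spanning_tree_sum_def
  proof (rule sum.reindex_bij_witness[where i = "\<lambda>\<phi>. \<phi> ` J"
        and j = "\<lambda>T. restrict (\<lambda>s. SOME e. e \<in> T \<and> ?w e = s) J"])
    fix T assume T: "T \<in> spanning_trees H"
    define c where "c = restrict (\<lambda>s. SOME e. e \<in> T \<and> ?w e = s) J"
    have c: "c s \<in> T \<and> ?w (c s) = s" if "s \<in> J" for s
      using someI_ex[of "\<lambda>e. e \<in> T \<and> ?w e = s"] ex[OF T that] that unfolding c_def by auto
    have c_eq: "c (?w e) = e" if "e \<in> T" for e
      using uniq[OF T _ that] c[OF nonloop[OF T that]] by blast
    have TE: "T \<subseteq> edges H" using T by (simp add: mem)
    show img: "c ` J = T"
      using c c_eq nonloop[OF T] by force
    show "c \<in> PiE J C" using c TE by (auto simp: C_def c_def)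
    have inj: "inj_on c J" using c by (metis inj_on_def)
    show "(\<Prod>s\<in>J. x (c s)) = (\<Prod>e\<in>T. x e)"
      using prod.reindex[OF inj, of x] img by simp
  next
    fix \<phi> assume \<phi>: "\<phi> \<in> PiE J C"
    then show T: "\<phi> ` J \<in> spanning_trees H" by (rule image)
    have \<phi>': "?w (\<phi> s) = s" if "s \<in> J" for s
      using PiE_mem[OF \<phi> that] by (auto simp: C_def)
    show "restrict (\<lambda>s. SOME e. e \<in> \<phi> ` J \<and> ?w e = s) J = \<phi>"
    proof
      fix s
      show "restrict (\<lambda>s. SOME e. e \<in> \<phi> ` J \<and> ?w e = s) J s = \<phi> s"
      proof (cases "s \<in> J")
        case True
        have "(SOME e. e \<in> \<phi> ` J \<and> ?w e = s) = \<phi> s"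
          by (rule some_equality) (use True \<phi>' in auto)
        then show ?thesis using True by simp
      next
        case False
        then show ?thesis using PiE_arb[OF \<phi> False] by (simp only: restrict_apply if_False)
      qed
    qed
  qed
  also have "\<dots> = (\<Prod>s\<in>J. \<Sum>e\<in>C s. x e)"
    using fin by (intro prod_sum_PiE[symmetric]) auto
  finally show ?thesis by (simp add: J_def C_def)
qed

text \<open>Take a spanning tree that avoids all edges parallel to \<open>c\<close>. Its path from u
  to v has at least two edges; \<open>c\<close> closes this path to a cycle, and deleting either of
  two chosen edges leaves a tree again.\<close>

lemma exchange_trees:
  assumes F: "finite F" and conn: "connects w V F" and V: "\<And>f. f \<in> F \<Longrightarrow> \<exists>p\<in>V. \<exists>q\<in>V. w f = {p, q}"
    and c: "c \<in> F" "w c = {u, v}" "u \<noteq> v" and uv: "(u, v) \<in> reach w {f \<in> F. w f \<noteq> {u, v}}"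
  obtains T a b where "T \<subseteq> F" "c \<notin> T" "a \<in> T" "b \<in> T" "a \<noteq> b"
    "min_connecting w V T" "min_connecting w V (insert c (T - {a}))" "min_connecting w V (insert c (T - {b}))"
proof -
  have uvV: "u \<in> V" "v \<in> V" using V[OF c(1)] c(2) by (auto simp: doubleton_eq_iff)
  let ?A = "{f \<in> F. w f \<noteq> {u, v}}"
  \<comment> \<open>An edge parallel to \<open>c\<close> can be replaced by the given
    bypass.\<close>
  have "connects w V ?A"
  proof (rule connectsI_reach[OF conn])
    fix e p q assume "e \<in> F" "w e = {p, q}"
    then show "(p, q) \<in> reach w ?A"
      using uv reach_sym[OF uv] reach_edge[of e ?A w p q] by (cases "{p, q} = {u, v}") (auto simp: doubleton_eq_iff)
  qed
  then obtain T where T: "T \<subseteq> ?A" "min_connecting w V T"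
    using min_connecting_exists[of ?A w V] F by auto
  have Tc: "connects w V T" and Tm: "\<And>e. e \<in> T \<Longrightarrow> \<not> connects w V (T - {e})"
    using T(2) by (auto simp: min_connecting_def)
  have cT: "c \<notin> T" using T(1) c(2) by auto
  have finT: "finite T" using T(1) F by (auto intro: finite_subset)
  have Vuv: "connects w {u, v} B \<longleftrightarrow> (u, v) \<in> reach w B" for B
    using reach_sym by (force simp: connects_def)
  have "connects w {u, v} T" using Tc uvV by (auto simp: connects_def)
  \<comment> \<open>The edge set of the path from u to v in \<open>T\<close>, obtained as a minimal
    subset joining the two.\<close>
  then obtain P where P: "P \<subseteq> T" "min_connecting w {u, v} P"
    using min_connecting_exists[OF finT] by blast
  have Puv: "(u, v) \<in> reach w P" and Pm: "\<And>a. a \<in> P \<Longrightarrow> (u, v) \<notin> reach w (P - {a})"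
    using P(2) by (auto simp: min_connecting_def Vuv)
  have nil: "x = y" if "(x, y) \<in> reach w {}" for x y using that by (simp add: adj_def)
  have "P \<noteq> {}" using Puv nil c(3) by blast
  \<comment> \<open>A single edge joining u and v would be parallel to \<open>c\<close>, and
    \<open>T\<close> contains no such edge.\<close>
  moreover have "P \<noteq> {a}" for a
  proof
    assume "P = {a}"
    then have "(u, v) \<in> reach w (insert a {})" using Puv by simp
    from reach_insertE[OF this] obtain p q where "w a = {p, q}" "u = p" "q = v"
      using nil c(3) by blast
    then show False using \<open>P = {a}\<close> P(1) T(1) by auto
  qed
  ultimately obtain a b where ab: "a \<in> P" "b \<in> P" "a \<noteq> b" by blast
  \<comment> \<open>Were u and v still joined without \<open>a\<close>, the two pieces of
    \<open>P\<close> on either side of \<open>a\<close> would join the ends of \<open>a\<close>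
    inside T - {a}, against the minimality of \<open>T\<close>.\<close>
  have sep: "(u, v) \<notin> reach w (T - {a})" if a: "a \<in> P" for a
  proof
    assume *: "(u, v) \<in> reach w (T - {a})"
    have "(u, v) \<in> reach w (insert a (P - {a}))" using Puv a by (simp add: insert_absorb)
    then obtain p q where pq: "w a = {p, q}" "(u, p) \<in> reach w (P - {a})" "(q, v) \<in> reach w (P - {a})"
      using reach_insertE Pm[OF a] by metis
    have sub: "P - {a} \<subseteq> T - {a}" using P(1) by blast
    have "(p, u) \<in> reach w (T - {a})" "(v, q) \<in> reach w (T - {a})"
      using pq(2,3) reach_mono[OF sub] reach_sym by metis+
    then have "(p, q) \<in> reach w (T - {a})" using * by (meson rtrancl_trans)
    then have "connects w V (T - {a})" using connects_delete[OF Tc pq(1)] by blast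
    then show False using Tm a P(1) by blast
  qed
  have swap: "min_connecting w V (insert c (T - {a}))" if a: "a \<in> P" for a
    unfolding min_connecting_def
  proof (intro conjI ballI)
    have aT: "a \<in> T" using a P(1) by blast
    let ?S = "insert c (T - {a})"
    have "(u, v) \<in> reach w (insert a (T - {a}))" using Tc uvV aT by (auto simp: connects_def insert_absorb)
    then obtain p q where pq: "w a = {p, q}" "(u, p) \<in> reach w (T - {a})" "(q, v) \<in> reach w (T - {a})"
      using reach_insertE sep[OF a] by metis
    have sub: "T - {a} \<subseteq> ?S" by blast
    have pu: "(p, u) \<in> reach w ?S" "(v, q) \<in> reach w ?S"
      using pq(2,3) reach_mono[OF sub] reach_sym by metis+
    moreover have "(u, v) \<in> reach w ?S" using c(2) by (intro reach_edge[of c]) auto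
    ultimately have pq': "(p, q) \<in> reach w ?S" by (meson rtrancl_trans)
    show "connects w V ?S"
    proof (rule connectsI_reach[OF Tc])
      fix e p' q' assume e: "e \<in> T" "w e = {p', q'}"
      show "(p', q') \<in> reach w ?S"
      proof (cases "e = a")
        case True
        then show ?thesis using e pq(1) pq' reach_sym by (metis doubleton_eq_iff)
      next
        case False
        then show ?thesis using e by (intro reach_edge[of e]) auto
      qed
    qed
    fix f assume f: "f \<in> ?S"
    show "\<not> connects w V (?S - {f})"
    proof (cases "f = c")
      case True
      then have "?S - {f} = T - {a}" using cT by auto
      then show ?thesis using Tm[OF aT] by simp
    next
      case False
      then have fT: "f \<in> T" "f \<noteq> a" using f by auto
      then obtain r s where rs: "r \<in> V" "s \<in> V" "w f = {r, s}" using V T(1) by blast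
      \<comment> \<open>If \<open>f\<close> were redundant, a walk between its ends would have to
        cross \<open>c\<close>; replacing that crossing by the rest of the walk and \<open>f\<close>
        joins u and v inside T - {a}, against \<open>sep\<close>.\<close>
      define B where "B = T - {a, f}"
      have SB: "?S - {f} = insert c B" using False by (auto simp: B_def)
      show ?thesis
      proof
        assume "connects w V (?S - {f})"
        then have "(r, s) \<in> reach w (insert c B)" using rs by (simp add: SB connects_def)
        moreover have "(r, s) \<notin> reach w B"
        proof
          assume "(r, s) \<in> reach w B"
          then have "(r, s) \<in> reach w (T - {f})" by (rule reach_mono[rotated]) (auto simp: B_def)
          then show False using connects_delete[OF Tc rs(3)] Tm[OF fT(1)] by blast
        qed
        ultimately obtain u' v' where u': "w c = {u', v'}" "(r, u') \<in> reach w B" "(v', s) \<in> reach w B"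
          using reach_insertE by metis
        have sub: "B \<subseteq> T - {a}" by (auto simp: B_def)
        have "(u', r) \<in> reach w (T - {a})" "(s, v') \<in> reach w (T - {a})"
          using u'(2,3) reach_mono[OF sub] reach_sym by metis+
        moreover have "(r, s) \<in> reach w (T - {a})" using fT rs(3) by (intro reach_edge[of f]) auto
        ultimately have "(u', v') \<in> reach w (T - {a})" by (meson rtrancl_trans)
        then have "(u, v) \<in> reach w (T - {a})" using u'(1) c(2) reach_sym by (metis doubleton_eq_iff)
        then show False using sep[OF a] by blast
      qed
    qed
  qed
  show thesis
    by (rule that[of T a b]) (use T cT ab P swap in auto)
qed

section \<open>The spanning-tree polynomial and complete monotonicity\<close>

lemma reach_in_component:
  assumes G: "multigraph G" and A: "A \<subseteq> edges G" and z: "z \<in> verts G"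
    and x: "x \<in> component_of G z" and xy: "(x, y) \<in> reach (ends G) A"
  shows "y \<in> component_of G z \<and> (x, y) \<in> reach (ends G) {f \<in> A. ends G f \<subseteq> component_of G z}"
  using xy
proof (induction rule: rtrancl_induct)
  case base
  then show ?case using x by simp
next
  case (step y y')
  obtain e where e: "e \<in> A" "ends G e = {y, y'}" using step.hyps(2) by (auto simp: adj_def)
  have "y' \<in> verts G" using e A G by (auto simp: multigraph_def)
  moreover have "(y, y') \<in> adjacency G" using e A by (auto simp: adjacency_def)
  ultimately have y': "y' \<in> component_of G z"
    using step.IH by (auto simp: component_of_def intro: rtrancl.rtrancl_into_rtrancl)
  then have "(y, y') \<in> adj (ends G) {f \<in> A. ends G f \<subseteq> component_of G z}"
    using e step.IH by (auto simp: adj_def)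
  then show ?case using y' step.IH by (blast intro: rtrancl.rtrancl_into_rtrancl)
qed

lemma component_refl: "z \<in> verts G \<Longrightarrow> z \<in> component_of G z"
  by (simp add: component_of_def)

lemma component_eq:
  assumes "y \<in> component_of G z"
  shows "component_of G y = component_of G z"
proof -
  have zy: "(z, y) \<in> (adjacency G)\<^sup>*" using assms by (simp add: component_of_def)
  then have "(y, z) \<in> (adjacency G)\<^sup>*" by (simp add: adjacency_eq reach_sym)
  then show ?thesis using zy by (auto simp: component_of_def intro: rtrancl_trans)
qed

lemma component_graph:
  assumes G: "multigraph G" and H: "H \<in> graph_components G"
  shows "multigraph H" "graph_connected H" "edges H \<subseteq> edges G" "ends H = ends G"
    "adjacency H \<subseteq> adjacency G"
proof -
  obtain z where z: "z \<in> verts G" "H = induced_subgraph G (component_of G z)"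
    using H by (auto simp: graph_components_def)
  have sub: "component_of G z \<subseteq> verts G" by (auto simp: component_of_def)
  show "multigraph H" using G sub unfolding multigraph_def z(2) induced_subgraph_def
    by (auto intro: finite_subset)
  show E: "edges H \<subseteq> edges G" and w: "ends H = ends G" by (auto simp: z(2) induced_subgraph_def)
  show "adjacency H \<subseteq> adjacency G" unfolding adjacency_eq w by (rule adj_mono[OF E])
  show "graph_connected H"
    unfolding graph_connected_def
  proof (intro conjI ballI)
    show "verts H \<noteq> {}" using component_refl[OF z(1)] by (auto simp: z(2) induced_subgraph_def)
    fix x y assume "x \<in> verts H" "y \<in> verts H"
    then have xy: "x \<in> component_of G z" "y \<in> component_of G z" by (auto simp: z(2) induced_subgraph_def)
    then have "y \<in> component_of G x" using component_eq by metis
    then have "(x, y) \<in> reach (ends G) (edges G)" by (simp add: component_of_def adjacency_eq)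
    from reach_in_component[OF G subset_refl z(1) xy(1) this]
    show "(x, y) \<in> (adjacency H)\<^sup>*" by (simp add: adjacency_eq z(2) induced_subgraph_def)
  qed
qed

lemma finite_graph_components: "multigraph G \<Longrightarrow> finite (graph_components G)"
  by (simp add: graph_components_def multigraph_def)

text \<open>Merges the two cases of the definition: a connected graph is its own only
  component.\<close>

lemma spanning_tree_poly_components:
  assumes G: "multigraph G"
  shows "spanning_tree_poly G x = (\<Prod>H\<in>graph_components G. spanning_tree_sum H x)"
proof (cases "graph_connected G")
  case True
  have "component_of G u = verts G" if "u \<in> verts G" for u
    using True that by (auto simp: component_of_def graph_connected_def)
  moreover have "induced_subgraph G (verts G) = G"
    using G by (intro mgraph.equality) (auto simp: induced_subgraph_def multigraph_def)
  ultimately have "graph_components G = {G}"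
    using True by (auto simp: graph_components_def graph_connected_def)
  then show ?thesis using True by (simp add: spanning_tree_poly_def)
qed (simp add: spanning_tree_poly_def)

lemma tree_like_cm_class:
  assumes G: "multigraph G" and tl: "tree_like (adjacency G)" and b: "0 < \<beta>"
  shows "G \<in> cm_class \<beta>"
proof -
  define cls where "cls = (\<lambda>H::('a, 'b) mgraph. ends H ` {e \<in> edges H. card (ends H e) = 2})"
  \<comment> \<open>Pairs of a component and a parallel class, to flatten the double
    product.\<close>
  define J where "J = Sigma (graph_components G) cls"
  define C where "C = (\<lambda>(H::('a, 'b) mgraph, s). {e \<in> edges H. ends H e = s})"
  have finc: "finite (cls H)" if "H \<in> graph_components G" for H
    using component_graph(1)[OF G that] by (simp add: cls_def multigraph_def)
  have "completely_monotone (edges G) (\<lambda>x. spanning_tree_poly G x powr - \<beta>)"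
  proof (rule completely_monotone_lin_power[where J = J and C = C])
    show "finite (edges G)" using G by (simp add: multigraph_def)
    show "finite J" unfolding J_def using finc finite_graph_components[OF G] by (intro finite_SigmaI)
    fix j assume "j \<in> J"
    then obtain H s where j: "j = (H, s)" "H \<in> graph_components G" "s \<in> cls H" by (auto simp: J_def)
    then show "C j \<subseteq> edges G \<and> C j \<noteq> {}"
      using component_graph(3)[OF G j(2)] by (auto simp: C_def cls_def)
  next
    fix x
    have "spanning_tree_poly G x = (\<Prod>H\<in>graph_components G. \<Prod>s\<in>cls H. \<Sum>e\<in>C (H, s). x e)"
      unfolding spanning_tree_poly_components[OF G]
    proof (rule prod.cong[OF refl])
      fix H assume H: "H \<in> graph_components G"
      have "tree_like (adjacency H)"
        using component_graph(5)[OF G H] by (intro tree_like_mono[OF tl]) auto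
      from tree_like_spanning_tree_sum[OF component_graph(1,2)[OF G H] this]
      show "spanning_tree_sum H x = (\<Prod>s\<in>cls H. \<Sum>e\<in>C (H, s). x e)"
        by (simp add: cls_def C_def)
    qed
    also have "\<dots> = (\<Prod>j\<in>J. \<Sum>e\<in>C j. x e)"
      unfolding J_def using finc finite_graph_components[OF G]
      by (subst prod.Sigma) (auto simp: case_prod_unfold)
    finally show "spanning_tree_poly G x = (\<Prod>j\<in>J. \<Sum>e\<in>C j. x e)" .
  qed (rule b)
  then show ?thesis using G by (simp add: cm_class_def)
qed

text \<open>The three trees \<open>T\<close>, \<open>T - a + c\<close>, \<open>T - b + c\<close> are the only spanning trees between \<open>R = T - {a, b}\<close>
  and \<open>R \<union> {a, b, c}\<close>. Giving weight \<open>M\<close> to \<open>R\<close> and \<open>1/M\<close> to all other edges except \<open>a, b, c\<close> isolates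
  them as \<open>M\<close> tends to infinity.\<close>

definition triangle_weight :: "'e set \<Rightarrow> 'e \<Rightarrow> 'e \<Rightarrow> 'e \<Rightarrow> real \<Rightarrow> (nat \<Rightarrow> real) \<Rightarrow> 'e \<Rightarrow> real" where
  "triangle_weight R a b c M y e =
     (if e = a then y 0 else if e = b then y 1 else if e = c then y 2
      else if e \<in> R then M else 1 / M)"

text \<open>After division by the power of M there remains one factor 1/M for each edge of
  \<open>R\<close> missing from \<open>T\<close> and one for each edge of \<open>T\<close> outside
  \<open>R\<close> and {a, b, c}. The exponent is zero exactly if R \<subseteq> T \<subseteq> R
  \<union> {a, b, c}. The weights of a, b, c do not depend on M, so the argument 1 on the right is a
  placeholder.\<close>

lemma prod_triangle_weight:
  assumes fin: "finite R" "finite T" and M: "M > 0" and abc: "{a, b, c} \<inter> R = {}"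
  shows "(\<Prod>e\<in>T. triangle_weight R a b c M y e) / M ^ card R =
    (\<Prod>e\<in>T \<inter> {a, b, c}. triangle_weight R a b c 1 y e) * (1 / M) ^ (card (R - T) + card (T - R - {a, b, c}))"
proof -
  have T: "T = (T \<inter> {a, b, c}) \<union> ((T \<inter> R) \<union> (T - R - {a, b, c}))" by auto
  have "(\<Prod>e\<in>T. triangle_weight R a b c M y e) = (\<Prod>e\<in>T \<inter> {a, b, c}. triangle_weight R a b c M y e)
     * ((\<Prod>e\<in>T \<inter> R. triangle_weight R a b c M y e) * (\<Prod>e\<in>T - R - {a, b, c}. triangle_weight R a b c M y e))"
  proof -
    let ?g = "triangle_weight R a b c M y"
    have "prod ?g T = prod ?g ((T \<inter> {a, b, c}) \<union> ((T \<inter> R) \<union> (T - R - {a, b, c})))"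
      by (rule arg_cong[OF T])
    also have "\<dots> = prod ?g (T \<inter> {a, b, c}) * prod ?g ((T \<inter> R) \<union> (T - R - {a, b, c}))"
      by (rule prod.union_disjoint) (use fin abc in auto)
    also have "prod ?g ((T \<inter> R) \<union> (T - R - {a, b, c})) = prod ?g (T \<inter> R) * prod ?g (T - R - {a, b, c})"
      by (rule prod.union_disjoint) (use fin in auto)
    finally show ?thesis .
  qed
  also have "(\<Prod>e\<in>T \<inter> {a, b, c}. triangle_weight R a b c M y e) = (\<Prod>e\<in>T \<inter> {a, b, c}. triangle_weight R a b c 1 y e)"
    by (rule prod.cong) (auto simp: triangle_weight_def)
  also have "(\<Prod>e\<in>T \<inter> R. triangle_weight R a b c M y e) = (\<Prod>e\<in>T \<inter> R. M)"
    by (rule prod.cong) (use abc in \<open>auto simp: triangle_weight_def\<close>)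
  also have "(\<Prod>e\<in>T - R - {a, b, c}. triangle_weight R a b c M y e) = (\<Prod>e\<in>T - R - {a, b, c}. 1 / M)"
    by (rule prod.cong) (auto simp: triangle_weight_def)
  finally have 1: "(\<Prod>e\<in>T. triangle_weight R a b c M y e) = (\<Prod>e\<in>T \<inter> {a, b, c}. triangle_weight R a b c 1 y e)
     * (M ^ card (T \<inter> R) * (1 / M) ^ card (T - R - {a, b, c}))" by simp
  have "card R = card (T \<inter> R) + card (R - T)"
    using fin by (subst card_Un_disjoint[symmetric]) (auto intro: arg_cong[where f = card])
  then have "M ^ card (T \<inter> R) / M ^ card R = (1 / M) ^ card (R - T)"
    using M by (simp add: power_add power_one_over)
  then have 2: "z * (M ^ card (T \<inter> R) * y) / M ^ card R = z * ((1 / M) ^ card (R - T) * y)" for z y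
    by (metis times_divide_eq_left times_divide_eq_right)
  show ?thesis unfolding 1 2 power_add ..
qed

lemma spanning_tree_sum_triangle_limit:
  assumes H: "multigraph H" "verts H \<noteq> {}" and ab: "a \<in> T" "b \<in> T" "a \<noteq> b" "c \<notin> T"
    and T: "T \<in> spanning_trees H" "insert c (T - {a}) \<in> spanning_trees H" "insert c (T - {b}) \<in> spanning_trees H"
  defines "R \<equiv> T - {a, b}"
  shows "(\<lambda>n. spanning_tree_sum H (triangle_weight R a b c (real (Suc n)) y) / real (Suc n) ^ card R) \<longlonglongrightarrow> esym2 y"
proof -
  let ?S = "spanning_trees H"
  let ?W = "triangle_weight R a b c"
  have finE: "finite (edges H)" using H by (simp add: multigraph_def)
  have finS: "finite ?S" by (rule finite_subset[of _ "Pow (edges H)"]) (auto simp: spanning_trees_def finE)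
  have finT: "finite S" if "S \<in> ?S" for S
    using that finE by (auto simp: spanning_trees_def intro: finite_subset)
  have finR: "finite R" using finT[OF T(1)] by (simp add: R_def)
  have abc: "{a, b, c} \<inter> R = {}" using ab by (auto simp: R_def)
  have anti: "A = B" if "A \<in> ?S" "B \<in> ?S" "A \<subseteq> B" for A B
    using that min_connecting_antichain by (metis spanning_trees_iff[OF H])
  have lim0: "(\<lambda>n. (1 / real (Suc n)) ^ k) \<longlonglongrightarrow> (if k = 0 then 1 else 0)" for k
  proof (cases "k = 0")
    case False
    have "(\<lambda>n. (1 / real (Suc n)) ^ k) \<longlonglongrightarrow> 0 ^ k"
      by (intro tendsto_power) (use LIMSEQ_inverse_real_of_nat in \<open>simp add: inverse_eq_divide\<close>)
    then show ?thesis using False by (simp add: power_0_left)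
  qed simp
  define P where "P = (\<lambda>S. \<Prod>e\<in>S \<inter> {a, b, c}. ?W 1 y e)"
  define k where "k = (\<lambda>S. card (R - S) + card (S - R - {a, b, c}))"
  have "(\<lambda>n. \<Sum>S\<in>?S. P S * (1 / real (Suc n)) ^ k S) \<longlonglongrightarrow> (\<Sum>S\<in>?S. P S * (if k S = 0 then 1 else 0))"
    by (intro tendsto_sum tendsto_mult tendsto_const lim0)
  moreover have "spanning_tree_sum H (?W (real (Suc n)) y) / real (Suc n) ^ card R
     = (\<Sum>S\<in>?S. P S * (1 / real (Suc n)) ^ k S)" for n
    unfolding spanning_tree_sum_def sum_divide_distrib P_def k_def
    by (rule sum.cong[OF refl]) (rule prod_triangle_weight, use finR finT abc in auto)
  moreover have "(\<Sum>S\<in>?S. P S * (if k S = 0 then 1 else 0)) = esym2 y"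
  proof -
    let ?T1 = "insert c (T - {a})" and ?T2 = "insert c (T - {b})"
    have ne: "a \<noteq> b" "b \<noteq> a" "a \<noteq> c" "c \<noteq> a" "b \<noteq> c" "c \<noteq> b" using ab by auto
    have k0: "k S = 0 \<longleftrightarrow> R \<subseteq> S \<and> S \<subseteq> R \<union> {a, b, c}" if "S \<in> ?S" for S
      using finR finT[OF that] by (auto simp: k_def)
    \<comment> \<open>A subset of {a, b, c} is comparable with some two-element subset, so S is
      comparable with one of the three trees; minimal connecting sets form an antichain, which
      forces equality.\<close>
    have only: "S \<in> {T, ?T1, ?T2}" if S: "S \<in> ?S" "R \<subseteq> S" "S \<subseteq> R \<union> {a, b, c}" for S
    proof -
      have RT: "T = R \<union> {a, b}" "?T1 = R \<union> {b, c}" "?T2 = R \<union> {a, c}" using ab by (auto simp: R_def)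
      consider "R \<union> {a, b} \<subseteq> S" | "R \<union> {b, c} \<subseteq> S" | "R \<union> {a, c} \<subseteq> S"
        | "S \<subseteq> R \<union> {a, b}" | "S \<subseteq> R \<union> {b, c}" | "S \<subseteq> R \<union> {a, c}"
        using S(2,3) by blast
      then show ?thesis
      proof cases
        case 1
        from anti[OF T(1) S(1) ord_eq_le_trans[OF RT(1) this]] show ?thesis by simp
      next
        case 2
        from anti[OF T(2) S(1) ord_eq_le_trans[OF RT(2) this]] show ?thesis by simp
      next
        case 3
        from anti[OF T(3) S(1) ord_eq_le_trans[OF RT(3) this]] show ?thesis by simp
      next
        case 4
        from anti[OF S(1) T(1) ord_le_eq_trans[OF this RT(1)[symmetric]]] show ?thesis by simp
      next
        case 5
        from anti[OF S(1) T(2) ord_le_eq_trans[OF this RT(2)[symmetric]]] show ?thesis by simp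
      next
        case 6
        from anti[OF S(1) T(3) ord_le_eq_trans[OF this RT(3)[symmetric]]] show ?thesis by simp
      qed
    qed
    have "(\<Sum>S\<in>?S. P S * (if k S = 0 then 1 else 0)) = (\<Sum>S\<in>{T, ?T1, ?T2}. P S)"
    proof (rule sum.mono_neutral_cong_right[OF finS])
      show "\<forall>S\<in>?S - {T, ?T1, ?T2}. P S * (if k S = 0 then 1 else 0) = 0" using only k0 by auto
      fix S assume S: "S \<in> {T, ?T1, ?T2}"
      have "R \<subseteq> S \<and> S \<subseteq> R \<union> {a, b, c}" using S by (auto simp: R_def)
      moreover have "S \<in> ?S" using S T by auto
      ultimately show "P S * (if k S = 0 then 1 else 0) = P S" using k0 by simp
    qed (use T in auto)
    also have "\<dots> = P T + P ?T1 + P ?T2"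
    proof -
      have "T \<noteq> ?T1" "T \<noteq> ?T2" "?T1 \<noteq> ?T2" using ab by auto
      then show ?thesis by (simp add: add.assoc)
    qed
    also have "P T = y 0 * y 1"
    proof -
      have "T \<inter> {a, b, c} = {a, b}" using ab by auto
      then show ?thesis unfolding P_def using ne by (simp add: triangle_weight_def)
    qed
    also have "P ?T1 = y 1 * y 2"
    proof -
      have "?T1 \<inter> {a, b, c} = {b, c}" using ab by auto
      then show ?thesis unfolding P_def using ne by (simp add: triangle_weight_def)
    qed
    also have "P ?T2 = y 2 * y 0"
    proof -
      have "?T2 \<inter> {a, b, c} = {a, c}" using ab by auto
      then show ?thesis unfolding P_def using ne by (simp add: triangle_weight_def)
    qed
    finally show ?thesis by (simp add: esym2_def)
  qed
  ultimately show ?thesis by simp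
qed

text \<open>A step in the i-th parameter changes only the coordinate \<open>\<iota> i\<close> of the
  image point, by the same amount, so differences in the parameters are differences of
  \<open>f\<close>.\<close>

lemma neg_diff_reparametrize:
  assumes "\<And>i h y. i \<in> I \<Longrightarrow> \<sigma> (y(i := y i + h)) = (\<sigma> y)(\<iota> i := \<sigma> y (\<iota> i) + h)"
    and "ds \<in> lists (I \<times> {0<..})"
  shows "foldr neg_diff ds (\<lambda>y. f (\<sigma> y)) y = foldr neg_diff (map (\<lambda>(i, h). (\<iota> i, h)) ds) f (\<sigma> y)"
  using assms(2)
proof (induction ds arbitrary: y rule: list.induct)
  case (Cons d ds)
  obtain i h where d: "d = (i, h)" by (cases d)
  then have "i \<in> I" "ds \<in> lists (I \<times> {0<..})" using Cons.prems by auto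
  then show ?case using Cons.IH assms(1) d by (simp add: neg_diff_def del: fun_upd_apply)
qed simp

lemma spanning_tree_sum_one_pos:
  assumes H: "multigraph H" "graph_connected H"
  shows "0 < spanning_tree_sum H (\<lambda>_. 1)"
proof -
  have V: "verts H \<noteq> {}" and c: "connects (ends H) (verts H) (edges H)"
    using H(2) by (auto simp: graph_connected_def connects_def adjacency_eq)
  have finE: "finite (edges H)" using H by (simp add: multigraph_def)
  have finS: "finite (spanning_trees H)"
    by (rule finite_subset[of _ "Pow (edges H)"]) (auto simp: spanning_trees_def finE)
  obtain T where "T \<in> spanning_trees H"
    using min_connecting_exists[OF finE c] spanning_trees_iff[OF H(1) V] by blast
  then have "card (spanning_trees H) > 0" using finS by (auto simp: card_gt_0_iff)
  then show ?thesis by (simp add: spanning_tree_sum_def)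
qed

lemma spanning_tree_sum_cong:
  "(\<And>e. e \<in> edges H \<Longrightarrow> x e = y e) \<Longrightarrow> spanning_tree_sum H x = spanning_tree_sum H y"
  unfolding spanning_tree_sum_def by (intro sum.cong prod.cong) (auto simp: spanning_trees_def)

lemma cm_class_tree_like:
  assumes cm: "G \<in> cm_class \<beta>" and b: "0 < \<beta>" "\<beta> < 1/2"
  shows "tree_like (adjacency G)"
proof (rule ccontr)
  assume "\<not> tree_like (adjacency G)"
  then obtain u v where uv: "(u, v) \<in> adjacency G" "u \<noteq> v"
    "(u, v) \<in> (adjacency G - {(u, v), (v, u)})\<^sup>*"
    unfolding tree_like_def by metis
  have G: "multigraph G" and cm': "completely_monotone (edges G) (\<lambda>x. spanning_tree_poly G x powr - \<beta>)"
    using cm by (auto simp: cm_class_def)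
  obtain c where c: "c \<in> edges G" "ends G c = {u, v}" using uv(1) by (auto simp: adjacency_def)
  have V: "u \<in> verts G" "v \<in> verts G" using c G by (auto simp: multigraph_def)
  define U where "U = component_of G u"
  define H where "H = induced_subgraph G U"
  have Hc: "H \<in> graph_components G" using V by (auto simp: H_def U_def graph_components_def)
  note HG = component_graph[OF G Hc]
  have Hd: "verts H = U" "edges H = {f \<in> edges G. ends G f \<subseteq> U}" "ends H = ends G"
    by (auto simp: H_def induced_subgraph_def)
  have uU: "u \<in> U" "v \<in> U"
    using V uv(1) by (auto simp: U_def component_of_def)
  have VH: "verts H \<noteq> {}" using uU Hd by auto
  have "(u, v) \<in> reach (ends G) {f \<in> edges G. ends G f \<noteq> {u, v}}"
    using uv(3) by (simp add: adj_Diff_class adjacency_eq)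
  then have "(u, v) \<in> reach (ends G) {f \<in> {f \<in> edges G. ends G f \<noteq> {u, v}}. ends G f \<subseteq> U}"
    using reach_in_component[OF G _ V(1), of "{f \<in> edges G. ends G f \<noteq> {u, v}}" u v] uU(1)
    by (auto simp: U_def)
  then have r: "(u, v) \<in> reach (ends G) {f \<in> edges H. ends G f \<noteq> {u, v}}"
    by (rule reach_mono[rotated]) (auto simp: Hd)
  have finE: "finite (edges G)" "finite (edges H)" using G HG(1) by (auto simp: multigraph_def)
  have conn: "connects (ends G) U (edges H)"
    using HG(2) by (simp add: graph_connected_def connects_def adjacency_eq Hd)
  have endsH: "\<exists>p\<in>U. \<exists>q\<in>U. ends G f = {p, q}" if "f \<in> edges H" for f
    using multigraph_endsE[OF HG(1) that] by (metis Hd(1,3))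
  have cH: "c \<in> edges H" using c uU by (simp add: Hd)
  obtain T a b' where T: "T \<subseteq> edges H" "c \<notin> T" "a \<in> T" "b' \<in> T" "a \<noteq> b'"
    "min_connecting (ends G) U T" "min_connecting (ends G) U (insert c (T - {a}))"
    "min_connecting (ends G) U (insert c (T - {b'}))"
    using exchange_trees[OF finE(2) conn endsH cH c(2) uv(2) r] by metis
  have trees: "T \<in> spanning_trees H" "insert c (T - {a}) \<in> spanning_trees H"
    "insert c (T - {b'}) \<in> spanning_trees H"
    using T cH by (auto simp: spanning_trees_iff[OF HG(1) VH] Hd)
  define R where "R = T - {a, b'}"
  \<comment> \<open>Edges outside \<open>H\<close> will get weight one, so the other components
    contribute the product of their numbers of spanning trees.\<close>
  define K where "K = (\<Prod>H'\<in>graph_components G - {H}. spanning_tree_sum H' (\<lambda>_. 1))"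
  have K: "K > 0" unfolding K_def
    using component_graph(1,2)[OF G] spanning_tree_sum_one_pos by (intro prod_pos) blast
  \<comment> \<open>The restriction to \<open>edges G\<close> places the point in the extensional
    orthant on which complete monotonicity is stated.\<close>
  define \<sigma> where "\<sigma> = (\<lambda>M y. restrict (\<lambda>e. if e \<in> edges H then triangle_weight R a b' c M y e else 1) (edges G))"
  have poly: "spanning_tree_poly G (\<sigma> M y) = K * spanning_tree_sum H (triangle_weight R a b' c M y)" for M y
  proof -
    have "spanning_tree_poly G (\<sigma> M y) = spanning_tree_sum H (\<sigma> M y) *
        (\<Prod>H'\<in>graph_components G - {H}. spanning_tree_sum H' (\<sigma> M y))"
      unfolding spanning_tree_poly_components[OF G]
      by (rule prod.remove[OF finite_graph_components[OF G] Hc])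
    also have "spanning_tree_sum H (\<sigma> M y) = spanning_tree_sum H (triangle_weight R a b' c M y)"
      using HG(3) by (intro spanning_tree_sum_cong) (auto simp: \<sigma>_def)
    also have "(\<Prod>H'\<in>graph_components G - {H}. spanning_tree_sum H' (\<sigma> M y)) = K"
      unfolding K_def
    proof (intro prod.cong refl spanning_tree_sum_cong)
      fix H' e assume H': "H' \<in> graph_components G - {H}" and e: "e \<in> edges H'"
      obtain z where z: "z \<in> verts G" "H' = induced_subgraph G (component_of G z)"
        using H' by (auto simp: graph_components_def)
      have eG: "e \<in> edges G" and ez: "ends G e \<subseteq> component_of G z"
        using e by (auto simp: z(2) induced_subgraph_def)
      obtain p q where pq: "ends G e = {p, q}" using multigraph_endsE[OF G eG] by metis
      \<comment> \<open>Distinct components share no edge, since an end of \<open>e\<close>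
        determines the component.\<close>
      have "e \<notin> edges H"
      proof
        assume "e \<in> edges H"
        then have "p \<in> U" "p \<in> component_of G z" using ez pq by (auto simp: Hd)
        then have "component_of G z = U" using component_eq unfolding U_def by metis
        then show False using H' z by (simp add: H_def)
      qed
      then show "\<sigma> M y e = 1" using eG by (simp add: \<sigma>_def)
    qed
    finally show ?thesis by simp
  qed
  define \<iota> where "\<iota> = (\<lambda>i::nat. if i = 0 then a else if i = 1 then b' else c)"
  have abcE: "a \<in> edges H" "b' \<in> edges H" "a \<noteq> c" "b' \<noteq> c" "c \<noteq> a" "c \<noteq> b'" "b' \<noteq> a"
    using T by auto
  have abcG: "a \<in> edges G" "b' \<in> edges G" using abcE HG(3) by auto
  have upd: "\<sigma> M (y(i := y i + h)) = (\<sigma> M y)(\<iota> i := \<sigma> M y (\<iota> i) + h)" if "i \<in> {0, 1, 2}" for M i h y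
    using that abcE abcG c(1) cH T(5) by (auto simp: fun_eq_iff \<sigma>_def triangle_weight_def \<iota>_def)
  have \<sigma>_pos: "\<sigma> M y \<in> pos_orthant (edges G)" if "M > 0" "\<forall>i\<in>{0, 1, 2}. 0 < y i" for M y
    using that by (auto simp: pos_orthant_def \<sigma>_def triangle_weight_def)
  have \<iota>: "\<iota> i \<in> edges G" for i using abcG c(1) by (simp add: \<iota>_def)
  \<comment> \<open>The prefactor cancels, at exponent -\<beta>, both the constant K and the growth
    of the tree sum like the power of M with exponent \<open>card R\<close>.\<close>
  define F where "F = (\<lambda>n y. (K * real (Suc n) ^ card R) powr \<beta> * spanning_tree_poly G (\<sigma> (real (Suc n)) y) powr - \<beta>)"
  have "alternating {0, 1, 2} (F n)" for n
    unfolding F_def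
  proof (rule alternating_scale)
    show "alternating {0, 1, 2} (\<lambda>y. spanning_tree_poly G (\<sigma> (real (Suc n)) y) powr - \<beta>)"
      unfolding alternating_def
    proof (intro ballI allI impI)
      fix ds :: "(nat \<times> real) list" and y :: "nat \<Rightarrow> real"
      assume ds: "ds \<in> lists ({0, 1, 2} \<times> {0<..})" and y: "\<forall>i\<in>{0, 1, 2}. 0 < y i"
      have "map (\<lambda>(i, h). (\<iota> i, h)) ds \<in> lists (edges G \<times> {0<..})"
        using ds \<iota> by (auto simp: in_lists_conv_set)
      then have "0 \<le> foldr neg_diff (map (\<lambda>(i, h). (\<iota> i, h)) ds)
          (\<lambda>x. spanning_tree_poly G x powr - \<beta>) (\<sigma> (real (Suc n)) y)"
        by (rule completely_monotone_neg_diffs[OF cm']) (use \<sigma>_pos y in simp)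
      then show "0 \<le> foldr neg_diff ds (\<lambda>y. spanning_tree_poly G (\<sigma> (real (Suc n)) y) powr - \<beta>) y"
        using neg_diff_reparametrize[where \<sigma> = "\<sigma> (real (Suc n))", OF upd ds,
            of "\<lambda>x. spanning_tree_poly G x powr - \<beta>"] by simp
    qed
  qed simp
  moreover have "(\<lambda>n. F n y) \<longlonglongrightarrow> esym2 y powr - \<beta>" if y: "\<forall>i\<in>{0, 1, 2}. 0 < y i" for y
  proof -
    let ?S = "\<lambda>n. spanning_tree_sum H (triangle_weight R a b' c (real (Suc n)) y)"
    have L: "(\<lambda>n. ?S n / real (Suc n) ^ card R) \<longlonglongrightarrow> esym2 y"
      unfolding R_def
      by (rule spanning_tree_sum_triangle_limit[OF HG(1) VH T(3,4,5,2) trees])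
    have S: "?S n \<ge> 0" for n
      unfolding spanning_tree_sum_def using y
      by (intro sum_nonneg prod_nonneg) (auto simp: triangle_weight_def)
    have "F n y = (?S n / real (Suc n) ^ card R) powr - \<beta>" for n
    proof -
      have "F n y = K powr \<beta> * (real (Suc n) ^ card R) powr \<beta> * (K powr - \<beta> * ?S n powr - \<beta>)"
        unfolding F_def poly using K S by (simp add: powr_mult)
      also have "\<dots> = (?S n / real (Suc n) ^ card R) powr - \<beta>"
        using K S by (simp add: powr_divide powr_minus field_simps)
      finally show ?thesis .
    qed
    moreover have "esym2 y > 0" using y by (intro esym2_pos) (simp add: pos3_def)
    ultimately show ?thesis using L by (simp add: tendsto_powr)
  qed
  ultimately have "alternating {0, 1, 2} (\<lambda>y. esym2 y powr - \<beta>)"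
    by (rule alternating_limit)
  then show False using esym2_powr_not_alternating[OF b] by blast
qed

theorem theorem7p10:
  fixes G :: "('v, 'e) mgraph" and \<beta> :: real
  assumes "multigraph G" and "0 < \<beta>" and "\<beta> < 1/2"
  shows "(G \<in> cm_class \<beta> \<longleftrightarrow> forest_extension G)
       \<and> (forest_extension G \<longleftrightarrow> \<not> has_minor G K3)
       \<and> (G \<in> cm_class \<beta> \<longrightarrow> (\<forall>\<beta>'>0. G \<in> cm_class \<beta>'))"
proof -
  have cm: "\<gamma> > 0 \<Longrightarrow> tree_like (adjacency G) \<Longrightarrow> G \<in> cm_class \<gamma>" for \<gamma>
    using assms(1) by (intro tree_like_cm_class)
  have 1: "G \<in> cm_class \<beta> \<longleftrightarrow> tree_like (adjacency G)"
    using cm_class_tree_like[OF _ assms(2,3), of G] cm[OF assms(2)] by (rule iffI)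
  have 2: "forest_extension G \<longleftrightarrow> tree_like (adjacency G)"
    using forest_extension_tree_like[of G] tree_like_forest_extension[OF assms(1)] by (rule iffI)
  have 3: "\<not> has_minor G K3 \<longleftrightarrow> tree_like (adjacency G)"
    using tree_like_no_K3_minor[OF assms(1)] not_tree_like_K3_minor[OF assms(1)] by metis
  show ?thesis unfolding 1 2 3 using cm by simp
qed

end
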